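(* If $\lambda$ is a countable infinite limit ordinal, then the ordered sets $(\mathcal{P}_\lambda,<_h)$ and $(\mathcal{P}_0,<_h)$ are isomorphic, i.e. there is a bijection $\psi\colon\mathcal{P}_\lambda\to\mathcal{P}_0$ such that for all $a,b\in\mathcal{P}_\lambda$: $a<_h b$ if and only if $\psi(a)<_h\psi(b)$.
   Context: A topological space is a $P$-space if all its $G_\delta$ subsets are open. A space is scattered if every non-empty subspace has an isolated point. $X^{(\alpha)}$ is the $\alpha$-th Cantor--Bendixson derivative of $X$, and for scattered $X$ the Cantor--Bendixson rank $N(X)$ is the least ordinal with $X^{(N(X))}=\emptyset$. $X\subset_h Y$ means that $X$ is homeomorphic to a subspace of $Y$; $X=_hY$ means $X\subset_hY$ and $Y\subset_hX$; $[X]_h$ is the equivalence class of $X$ with respect to $=_h$. For $\lambda=0$ or $\lambda$ an infinite limit ordinal, $\mathcal{P}_\lambda$ is the family of equivalence classes $[X]_h$ of regular ($T_1$ included) scattered $P$-spaces $X$ of weight at most $\omega_1$ such that $\lambda<N(X)\leq\lambda+\omega$. The (reflexive) partial order $<_h$ on $\mathcal{P}_\lambda$ is defined by: $[X]_h<_h[Y]_h$ if and only if $X\subset_hY$. *)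

theory Defs
  imports "HOL-Analysis.Analysis"
begin

unbundle cardinal_syntax

section \<open>Classes of spaces\<close>

definition P_space :: "'a topology \<Rightarrow> bool" where
  "P_space X \<longleftrightarrow> (\<forall>S. gdelta_in X S \<longrightarrow> openin X S)"

definition scattered_space :: "'a topology \<Rightarrow> bool" where
  "scattered_space X \<longleftrightarrow>
     (\<forall>S \<subseteq> topspace X. S \<noteq> {} \<longrightarrow> (\<exists>x\<in>S. openin (subtopology X S) {x}))"

text \<open>A cardinal is a well-order as in the library of cardinal orders, so \<open>cardSuc natLeq\<close>
  stands for \<open>\<omega>\<^sub>1\<close>.\<close>

definition weight_le :: "'a topology \<Rightarrow> 'k rel \<Rightarrow> bool" where
  "weight_le X \<kappa> \<longleftrightarrow>
     (\<exists>\<B>. |\<B>| \<le>o \<kappa> \<and> (\<forall>V\<in>\<B>. openin X V) \<and>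
        (\<forall>U x. openin X U \<and> x \<in> U \<longrightarrow> (\<exists>V\<in>\<B>. x \<in> V \<and> V \<subseteq> U)))"


section \<open>Ordinals\<close>

text \<open>An ordinal is given by any well-order of that order type; ordinals are compared
  by \<open><o\<close> and \<open>\<le>o\<close>. Thus \<open>{}\<close> is \<open>0\<close> and \<open>natLeq\<close> is \<open>\<omega>\<close>.\<close>

definition ord_sum :: "'a rel \<Rightarrow> 'b rel \<Rightarrow> ('a + 'b) rel" where
  "ord_sum r s = map_prod Inl Inl ` r \<union> map_prod Inr Inr ` s \<union>
     {(Inl a, Inr b) | a b. a \<in> Field r \<and> b \<in> Field s}"

text \<open>A nonzero ordinal without a largest element; such an ordinal is automatically infinite.\<close>

definition limit_ordinal :: "'a rel \<Rightarrow> bool" where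
  "limit_ordinal r \<longleftrightarrow> Well_order r \<and> Field r \<noteq> {} \<and>
     \<not> (\<exists>m\<in>Field r. \<forall>i\<in>Field r. (i, m) \<in> r)"


section \<open>Cantor-Bendixson derivatives and rank\<close>

text \<open>The non-isolated points of the subspace \<open>S\<close>.\<close>

definition cb_step :: "'a topology \<Rightarrow> 'a set \<Rightarrow> 'a set" where
  "cb_step X S = S \<inter> X derived_set_of S"

text \<open>For an element \<open>a\<close> of a well-order \<open>r\<close>, \<open>cb_level X r a\<close> is \<open>X\<^sup>(\<^sup>\<alpha>\<^sup>)\<close>, where \<open>\<alpha>\<close> is the order type
  of the elements strictly below \<open>a\<close>; \<open>cb_derivative X r\<close> is \<open>X\<^sup>(\<^sup>\<alpha>\<^sup>)\<close>, where \<open>\<alpha>\<close> is the order type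
  of \<open>r\<close>. The single recursion \<open>X\<^sup>(\<^sup>\<alpha>\<^sup>) = (\<Inter>\<beta><\<alpha>. cb_step X (X\<^sup>(\<^sup>\<beta>\<^sup>)))\<close> (all of \<open>X\<close> for \<open>\<alpha> = 0\<close>) covers
  the usual three clauses: \<open>cb_derivative_zero\<close>, \<open>cb_derivative_succ\<close>, \<open>cb_derivative_limit\<close>.\<close>

definition cb_level :: "'a topology \<Rightarrow> 'b rel \<Rightarrow> 'b \<Rightarrow> 'a set" where
  "cb_level X r = wo_rel.worec r
     (\<lambda>D a. topspace X \<inter> (\<Inter>b\<in>underS r a. cb_step X (D b)))"

definition cb_derivative :: "'a topology \<Rightarrow> 'b rel \<Rightarrow> 'a set" where
  "cb_derivative X r = topspace X \<inter> (\<Inter>b\<in>Field r. cb_step X (cb_level X r b))"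

text \<open>Every ordinal below \<open>r\<close> is the order type of a proper initial segment of \<open>r\<close>, so nothing is
  lost by letting \<open>s\<close> range over well-orders on the same type as \<open>r\<close>.\<close>

definition has_cb_rank :: "'a topology \<Rightarrow> 'b rel \<Rightarrow> bool" where
  "has_cb_rank X r \<longleftrightarrow> Well_order r \<and> cb_derivative X r = {} \<and>
     (\<forall>s :: 'b rel. s <o r \<longrightarrow> cb_derivative X s \<noteq> {})"

text \<open>The rank of a scattered space has at most as many elements as the space, so it is
  represented by a well-order on the type of points (\<open>has_cb_rank_cb_rank\<close>) and unique up to
  order isomorphism (\<open>has_cb_rank_ordIso\<close>).\<close>

definition cb_rank :: "'a topology \<Rightarrow> 'a rel" where
  "cb_rank X = (SOME r. has_cb_rank X r)"


lemma cb_level_rec: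
  assumes "Well_order r"
  shows "cb_level X r a = topspace X \<inter> (\<Inter>b\<in>underS r a. cb_step X (cb_level X r b))"
proof -
  have wo: "wo_rel r" using assms by (simp add: wo_rel_def)
  have "wo_rel.adm_wo r (\<lambda>D a. topspace X \<inter> (\<Inter>b\<in>underS r a. cb_step X (D b)))"
    by (auto simp: wo_rel.adm_wo_def[OF wo])
  from wo_rel.worec_fixpoint[OF wo this] show ?thesis
    unfolding cb_level_def by metis
qed

lemma cb_level_subset_topspace: "Well_order r \<Longrightarrow> cb_level X r a \<subseteq> topspace X"
  by (subst cb_level_rec) auto

lemma cb_level_subset_step:
  "Well_order r \<Longrightarrow> b \<in> underS r a \<Longrightarrow> cb_level X r a \<subseteq> cb_step X (cb_level X r b)"
  by (subst cb_level_rec[of _ _ a]) auto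

lemma cb_level_embed:
  assumes r: "Well_order r" and s: "Well_order s" and f: "embed r s f" and a: "a \<in> Field r"
  shows "cb_level X s (f a) = cb_level X r a"
proof -
  have wo: "wo_rel r" using r by (simp add: wo_rel_def)
  have "a \<in> Field r \<longrightarrow> cb_level X s (f a) = cb_level X r a"
  proof (rule wo_rel.well_order_induct[OF wo, of _ a], rule impI)
    fix x assume IH: "\<forall>y. y \<noteq> x \<and> (y, x) \<in> r \<longrightarrow> y \<in> Field r \<longrightarrow> cb_level X s (f y) = cb_level X r y"
      and x: "x \<in> Field r"
    have "f ` underS r x = underS s (f x)"
      using embed_underS[OF r f x] by (simp add: bij_betw_def)
    then have "underS s (f x) = f ` underS r x" by simp
    moreover have "cb_level X s (f y) = cb_level X r y" if "y \<in> underS r x" for y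
      using that IH by (auto simp: underS_def Field_def)
    ultimately show "cb_level X s (f x) = cb_level X r x"
      unfolding cb_level_rec[OF r, of X x] cb_level_rec[OF s, of X "f x"]
      by force
  qed
  with a show ?thesis by blast
qed

lemma cb_derivative_ordIso:
  assumes "(r, s) \<in> ordIso"
  shows "cb_derivative X r = cb_derivative X s"
proof -
  obtain f where r: "Well_order r" and s: "Well_order s" and f: "iso r s f"
    using assms by (auto simp: ordIso_def)
  have e: "embed r s f" and "f ` Field r = Field s"
    using f by (simp_all add: iso_def bij_betw_def)
  then have "Field s = f ` Field r" by simp
  moreover have "cb_level X s (f a) = cb_level X r a" if "a \<in> Field r" for a
    by (rule cb_level_embed[OF r s e that])
  ultimately show ?thesis unfolding cb_derivative_def by force
qed

lemma Restr_underS: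
  assumes r: "Well_order r"
  shows "Field (Restr r (underS r a)) = underS r a"
    and "Well_order (Restr r (underS r a))"
    and "embed (Restr r (underS r a)) r id"
proof -
  have wo: "wo_rel r" using r by (simp add: wo_rel_def)
  have o: "wo_rel.ofilter r (underS r a)"
    using wo_rel.underS_ofilter[OF wo] .
  show "Field (Restr r (underS r a)) = underS r a" using Field_Restr_ofilter[OF r o] .
  show "Well_order (Restr r (underS r a))" using Well_order_Restr[OF r] .
  show "embed (Restr r (underS r a)) r id" using ofilter_embed[OF r] o by blast
qed

lemma cb_derivative_initial:
  assumes "Well_order r"
  shows "cb_derivative X (Restr r (underS r a)) = cb_level X r a"
proof -
  have "cb_level X (Restr r (underS r a)) b = cb_level X r b" if "b \<in> underS r a" for b
    using cb_level_embed[OF Restr_underS(2)[OF assms] assms Restr_underS(3)[OF assms], of b a X]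
      that by (simp add: Restr_underS(1)[OF assms])
  then show ?thesis
    unfolding cb_derivative_def cb_level_rec[OF assms, of X a] Restr_underS(1)[OF assms] by simp
qed

lemma cb_derivative_zero: "cb_derivative X {} = topspace X"
  by (simp add: cb_derivative_def)

lemma cb_step_subset: "cb_step X S \<subseteq> S"
  by (auto simp: cb_step_def)

lemma cb_level_antimono:
  assumes r: "Well_order r" and "(a, b) \<in> r"
  shows "cb_level X r b \<subseteq> cb_level X r a"
proof -
  have "trans r" using r by (auto simp: order_on_defs)
  moreover have "antisym r" using r by (auto simp: order_on_defs)
  ultimately have "underS r a \<subseteq> underS r b"
    using assms unfolding underS_def trans_def antisym_def by blast
  then show ?thesis
    unfolding cb_level_rec[OF r, of X a] cb_level_rec[OF r, of X b] by blast
qed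

lemma cb_derivative_succ:
  assumes r: "Well_order r" and m: "m \<in> Field r" "\<forall>i\<in>Field r. (i, m) \<in> r"
  shows "cb_derivative X r = cb_step X (cb_derivative X (Restr r (underS r m)))"
proof -
  have "Field r = insert m (underS r m)"
    using m by (auto simp: underS_def Field_def)
  then have "cb_derivative X r = cb_level X r m \<inter> cb_step X (cb_level X r m)"
    unfolding cb_derivative_def using cb_level_rec[OF r, of X m] by auto
  then show ?thesis
    unfolding cb_derivative_initial[OF r] using cb_step_subset[of X "cb_level X r m"] by auto
qed

lemma cb_derivative_limit:
  assumes "limit_ordinal r"
  shows "cb_derivative X r = (\<Inter>a\<in>Field r. cb_derivative X (Restr r (underS r a)))"
proof -
  have r: "Well_order r" and ne: "Field r \<noteq> {}"
    and nomax: "\<And>m. m \<in> Field r \<Longrightarrow> \<exists>i\<in>Field r. (i, m) \<notin> r"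
    using assms by (auto simp: limit_ordinal_def)
  have "\<exists>b\<in>Field r. a \<in> underS r b" if a: "a \<in> Field r" for a
  proof -
    obtain i where "i \<in> Field r" "(i, a) \<notin> r" using nomax[OF a] by blast
    then have "a \<in> underS r i"
      using wo_rel.TOTALS[of r] r a by (auto simp: underS_def wo_rel_def)
    with \<open>i \<in> Field r\<close> show ?thesis by blast
  qed
  then have "(\<Inter>a\<in>Field r. cb_level X r a) \<subseteq> (\<Inter>b\<in>Field r. cb_step X (cb_level X r b))"
    using cb_level_subset_step[OF r, of _ _ X] by blast
  moreover obtain m where "m \<in> Field r" using ne by blast
  then have "(\<Inter>a\<in>Field r. cb_level X r a) \<subseteq> topspace X"
    using cb_level_subset_topspace[OF r, of X m] by blast
  moreover have "(\<Inter>b\<in>Field r. cb_step X (cb_level X r b)) \<subseteq> (\<Inter>a\<in>Field r. cb_level X r a)"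
    by (intro INF_mono' cb_step_subset)
  ultimately show ?thesis
    unfolding cb_derivative_initial[OF r] unfolding cb_derivative_def by (intro equalityI) auto
qed

lemma cb_step_proper:
  assumes "scattered_space X" "S \<subseteq> topspace X" "S \<noteq> {}"
  shows "\<exists>x\<in>S. x \<notin> cb_step X S"
proof -
  obtain x where x: "x \<in> S" "openin (subtopology X S) {x}"
    using assms by (auto simp: scattered_space_def)
  then obtain T where "openin X T" "{x} = T \<inter> S"
    by (auto simp: openin_subtopology)
  then have "x \<notin> X derived_set_of S"
    unfolding derived_set_of_def by blast
  with x show ?thesis by (auto simp: cb_step_def)
qed

lemma scattered_imp_has_cb_rank:
  fixes X :: "'a topology"
  assumes X: "scattered_space X"
  shows "\<exists>r :: 'a rel. has_cb_rank X r"
proof -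
  define R where "R = |UNIV :: 'a set set|"
  have R: "Well_order R" "Field R = UNIV" unfolding R_def by (rule card_of_Well_order, rule Field_card_of)
  have woR: "wo_rel R" using R by (simp add: wo_rel_def)
  have sub: "cb_level X R i \<subseteq> topspace X" for i
    by (rule cb_level_subset_topspace[OF R(1)])
  have "\<exists>x. cb_level X R i \<noteq> {} \<longrightarrow> x \<in> cb_level X R i \<and> x \<notin> cb_step X (cb_level X R i)" for i
    using cb_step_proper[OF X sub] by blast
  then obtain p where p: "\<And>i. cb_level X R i \<noteq> {} \<Longrightarrow>
      p i \<in> cb_level X R i \<and> p i \<notin> cb_step X (cb_level X R i)" by metis
  have p_neq: "p i \<noteq> p j" if "i \<in> underS R j" "cb_level X R i \<noteq> {}" "cb_level X R j \<noteq> {}" for i j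
    using that p[of i] p[of j] cb_level_subset_step[OF R(1), of i j X] by auto
  have inj: "inj_on p {i. cb_level X R i \<noteq> {}}"
  proof (rule inj_onI, rule ccontr)
    fix i j assume *: "i \<in> {i. cb_level X R i \<noteq> {}}" "j \<in> {i. cb_level X R i \<noteq> {}}"
      "p i = p j" "i \<noteq> j"
    have "i \<in> underS R j \<or> j \<in> underS R i"
      using wo_rel.TOTALS[OF woR] R(2) \<open>i \<noteq> j\<close> by (auto simp: underS_def)
    then show False
    proof
      assume "i \<in> underS R j"
      from p_neq[OF this] * show False by simp
    next
      assume "j \<in> underS R i"
      from p_neq[OF this] * show False by simp
    qed
  qed
  have "{i. cb_level X R i = {}} \<noteq> {}"
  proof
    assume "{i. cb_level X R i = {}} = {}"
    then have "{i. cb_level X R i \<noteq> {}} = UNIV" by blast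
    with inj have "inj p" by simp
    moreover have "surj (inv p)" using \<open>inj p\<close> by (rule inj_imp_surj_inv)
    ultimately show False using Cantors_theorem[of "UNIV :: 'a set"] by (metis Pow_UNIV)
  qed
  moreover define k where "k = wo_rel.minim R {i. cb_level X R i = {}}"
  ultimately have k: "cb_level X R k = {}" 
    and kmin: "\<And>i. cb_level X R i = {} \<Longrightarrow> (k, i) \<in> R"
    using wo_rel.minim_in[OF woR, of "{i. cb_level X R i = {}}"]
      wo_rel.minim_least[OF woR, of "{i. cb_level X R i = {}}"] R(2) by auto
  have below: "cb_level X R i \<noteq> {}" if "i \<in> underS R k" for i
    using that kmin[of i] wo_rel.ANTISYM[OF woR] by (auto simp: underS_def antisym_def)
  define q where "q = Restr R (underS R k)"
  have q: "Well_order q" "Field q = underS R k" "cb_derivative X q = {}"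
    unfolding q_def using Restr_underS[OF R(1), of k] cb_derivative_initial[OF R(1), of X k] k
    by simp_all
  have "inj_on p (Field q)"
    using inj below q(2) by (auto intro: inj_on_subset)
  define r where "r = dir_image q p"
  have qr: "(q, r) \<in> ordIso" unfolding r_def using dir_image_ordIso[OF q(1) \<open>inj_on p (Field q)\<close>] .
  have r: "Well_order r" using qr by (auto simp: ordIso_def)
  have "cb_derivative X s \<noteq> {}" if "s <o r" for s :: "'a rel"
  proof -
    have sq: "s <o q" using that qr by (meson ordIso_symmetric ordLess_ordIso_trans)
    then have "Well_order s" by (auto simp: ordLess_def)
    then obtain a where a: "a \<in> Field q" "(s, Restr q (underS q a)) \<in> ordIso"
      using ordLess_iff_ordIso_Restr[OF q(1)] sq by blast
    have "embed q R id" unfolding q_def by (rule Restr_underS(3)[OF R(1)])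
    from cb_level_embed[OF q(1) R(1) this a(1), of X] have "cb_level X q a = cb_level X R a"
      by simp
    then have "cb_derivative X s = cb_level X R a"
      using cb_derivative_ordIso[OF a(2), of X] cb_derivative_initial[OF q(1), of X a] by simp
    with below a q(2) show ?thesis by auto
  qed
  then have "has_cb_rank X r"
    using r cb_derivative_ordIso[OF qr, of X] q(3) by (simp add: has_cb_rank_def)
  then show ?thesis by blast
qed

lemma has_cb_rank_cb_rank: "scattered_space X \<Longrightarrow> has_cb_rank X (cb_rank X)"
  unfolding cb_rank_def by (rule someI_ex) (rule scattered_imp_has_cb_rank)

lemma has_cb_rankD:
  assumes "has_cb_rank X r"
  shows "Well_order r" and "cb_derivative X r = {}"
  using assms unfolding has_cb_rank_def by (rule conjunct1, rule conjunct2[THEN conjunct1])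

lemma has_cb_rank_not_less:
  fixes r :: "'b rel" and s :: "'c rel"
  assumes r: "has_cb_rank X r" and s: "has_cb_rank X s"
  shows "\<not> s <o r"
proof
  assume less: "s <o r"
  have wo: "Well_order r" "Well_order s" by (fact has_cb_rankD(1)[OF r], fact has_cb_rankD(1)[OF s])
  obtain a where a: "(s, Restr r (underS r a)) \<in> ordIso"
    using less ordLess_iff_ordIso_Restr[OF wo] by blast
  then have "Restr r (underS r a) <o r"
    by (rule ordIso_ordLess_trans[OF ordIso_symmetric less])
  then have "cb_derivative X (Restr r (underS r a)) \<noteq> {}"
    using r unfolding has_cb_rank_def by (elim conjE allE impE)
  moreover have "cb_derivative X s = {}" using s by (rule has_cb_rankD)
  ultimately show False using cb_derivative_ordIso[OF a, of X] by simp
qed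

lemma has_cb_rank_ordIso:
  fixes r :: "'b rel" and s :: "'c rel"
  assumes r: "has_cb_rank X r" and s: "has_cb_rank X s"
  shows "(r, s) \<in> ordIso"
proof -
  have wo: "Well_order r" "Well_order s" by (fact has_cb_rankD(1)[OF r], fact has_cb_rankD(1)[OF s])
  have "r \<le>o s" "s \<le>o r"
    using has_cb_rank_not_less[OF r s] has_cb_rank_not_less[OF s r]
      not_ordLess_iff_ordLeq[OF wo] not_ordLess_iff_ordLeq[OF wo(2,1)] by simp_all
  then show ?thesis by (simp add: ordIso_iff_ordLeq)
qed

lemma scattered_card_le_weight:
  assumes X: "scattered_space X" and w: "weight_le X \<kappa>"
  shows "|topspace X| \<le>o \<kappa>"
proof -
  define r where "r = cb_rank X"
  have r: "Well_order r" "cb_derivative X r = {}"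
    using has_cb_rank_cb_rank[OF X] unfolding r_def by (rule has_cb_rankD)+
  have wo: "wo_rel r" using r by (simp add: wo_rel_def)
  obtain \<B> where B: "|\<B>| \<le>o \<kappa>" "\<forall>V\<in>\<B>. openin X V"
      "\<And>U x. openin X U \<Longrightarrow> x \<in> U \<Longrightarrow> \<exists>V\<in>\<B>. x \<in> V \<and> V \<subseteq> U"
    using w unfolding weight_le_def by metis
  have "\<exists>a\<in>Field r. \<exists>V\<in>\<B>. V \<inter> cb_level X r a = {x}" if x: "x \<in> topspace X" for x
  proof -
    define A where "A = {a \<in> Field r. x \<notin> cb_step X (cb_level X r a)}"
    have A: "A \<subseteq> Field r" "A \<noteq> {}"
      using r(2) x by (auto simp: A_def cb_derivative_def)
    define a where "a = wo_rel.minim r A"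
    have a: "a \<in> A" and least: "\<And>b. b \<in> A \<Longrightarrow> (a, b) \<in> r"
      using wo_rel.minim_in[OF wo A] wo_rel.minim_least[OF wo A(1)] by (auto simp: a_def)
    have "x \<in> cb_step X (cb_level X r b)" if "b \<in> underS r a" for b
    proof (rule ccontr)
      assume "x \<notin> cb_step X (cb_level X r b)"
      with that have "b \<in> A" by (auto simp: A_def underS_def Field_def)
      from least[OF this] that show False
        using wo_rel.ANTISYM[OF wo] by (auto simp: underS_def antisym_def)
    qed
    then have xa: "x \<in> cb_level X r a"
      unfolding cb_level_rec[OF r(1), of X a] using x by simp
    then have "x \<notin> X derived_set_of (cb_level X r a)"
      using a by (auto simp: A_def cb_step_def)
    then obtain T where T: "x \<in> T" "openin X T" "\<forall>y. y \<noteq> x \<longrightarrow> y \<in> cb_level X r a \<longrightarrow> y \<notin> T"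
      using x unfolding derived_set_of_def by blast
    obtain V where "V \<in> \<B>" "x \<in> V" "V \<subseteq> T" using B(3)[OF T(2,1)] by blast
    moreover have "V \<inter> cb_level X r a = {x}" using T(3) xa calculation by blast
    ultimately show ?thesis using a by (auto simp: A_def)
  qed
  then obtain a V where aV: "\<And>x. x \<in> topspace X \<Longrightarrow>
      a x \<in> Field r \<and> V x \<in> \<B> \<and> V x \<inter> cb_level X r (a x) = {x}" by metis
  have "inj_on V (topspace X)"
  proof (rule inj_onI)
    fix x y assume xy: "x \<in> topspace X" "y \<in> topspace X" "V x = V y"
    have "(a x, a y) \<in> r \<or> (a y, a x) \<in> r"
      using wo_rel.TOTALS[OF wo] aV[OF xy(1)] aV[OF xy(2)] by simp
    then have "cb_level X r (a x) \<subseteq> cb_level X r (a y) \<or> cb_level X r (a y) \<subseteq> cb_level X r (a x)"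
      by (elim disjE) (simp_all add: cb_level_antimono[OF r(1)])
    then have "x \<in> V y \<inter> cb_level X r (a y) \<or> y \<in> V x \<inter> cb_level X r (a x)"
      using aV[OF xy(1)] aV[OF xy(2)] unfolding xy(3) by blast
    then show "x = y" using aV[OF xy(1)] aV[OF xy(2)] by auto
  qed
  moreover have "V ` topspace X \<subseteq> \<B>" using aV by blast
  ultimately have "|topspace X| \<le>o |\<B>|"
    unfolding card_of_ordLeq[symmetric] by (intro exI conjI)
  from ordLeq_transitive[OF this B(1)] show ?thesis .
qed

lemma scattered_weight_le_representable:
  fixes X :: "'b topology"
  assumes U: "uncountable (UNIV :: 'a set)"
    and X: "scattered_space X" and w: "weight_le X (cardSuc natLeq)"
  shows "\<exists>Y :: 'a topology. X homeomorphic_space Y"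
proof -
  have "\<not> |UNIV :: 'a set| \<le>o natLeq"
  proof
    assume "|UNIV :: 'a set| \<le>o natLeq"
    from ordLeq_ordIso_trans[OF this ordIso_symmetric[OF card_of_nat]]
    have "\<exists>f :: 'a \<Rightarrow> nat. inj f \<and> range f \<subseteq> UNIV"
      unfolding card_of_ordLeq[symmetric] .
    then obtain f :: "'a \<Rightarrow> nat" where "inj f" by (elim exE conjE)
    then have "countable (UNIV :: 'a set)" by (rule countableI)
    with U show False by (rule notE)
  qed
  then have "natLeq <o |UNIV :: 'a set|"
    by (rule iffD1[OF not_ordLeq_iff_ordLess[OF natLeq_Well_order card_of_Well_order]])
  then have "cardSuc natLeq \<le>o |UNIV :: 'a set|"
    by (rule cardSuc_least[OF natLeq_Card_order card_of_Card_order])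
  then have "|topspace X| \<le>o |UNIV :: 'a set|"
    by (rule ordLeq_transitive[OF scattered_card_le_weight[OF X w]])
  then obtain f :: "'b \<Rightarrow> 'a" where f: "inj_on f (topspace X)"
    unfolding card_of_ordLeq[symmetric] by (elim exE conjE)
  define g where "g = inv_into (topspace X) f"
  define Y where "Y = pullback_topology (f ` topspace X) g X"
  have g: "g (f x) = x" if "x \<in> topspace X" for x
    unfolding g_def by (rule inv_into_f_f[OF f that])
  have tY: "topspace Y = f ` topspace X"
    using g by (auto simp: Y_def topspace_pullback_topology)
  have "continuous_map X Y f"
    unfolding Y_def
  proof (rule continuous_map_pullback')
    show "continuous_map X X (g \<circ> f)"
      by (rule continuous_map_eq[OF continuous_map_id]) (simp add: g)
  qed auto
  moreover have "continuous_map Y X g"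
    unfolding Y_def using continuous_map_pullback[OF continuous_map_id[of X], of "f ` topspace X" g] by simp
  ultimately have "homeomorphic_maps X Y f g"
    using g tY by (auto simp: homeomorphic_maps_def)
  then show ?thesis by (auto simp: homeomorphic_space_def)
qed


section \<open>Embeddability and the posets\<close>

definition embeds :: "'a topology \<Rightarrow> 'b topology \<Rightarrow> bool" (infix \<open>\<subset>\<^sub>h\<close> 50) where
  "X \<subset>\<^sub>h Y \<longleftrightarrow> (\<exists>S \<subseteq> topspace Y. X homeomorphic_space subtopology Y S)"

definition h_equiv :: "'a topology \<Rightarrow> 'b topology \<Rightarrow> bool" (infix \<open>=\<^sub>h\<close> 50) where
  "X =\<^sub>h Y \<longleftrightarrow> X \<subset>\<^sub>h Y \<and> Y \<subset>\<^sub>h X"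

definition h_class :: "'a topology \<Rightarrow> 'a topology set" (\<open>[_]\<^sub>h\<close>) where
  "[X]\<^sub>h = {Y. X =\<^sub>h Y}"

text \<open>Spaces are taken to be topologies on subsets of a fixed type \<open>'a\<close>. If this type is
  uncountable, every scattered space of weight at most \<open>\<omega>\<^sub>1\<close>, on whatever type, is homeomorphic
  to one of these (\<open>scattered_weight_le_representable\<close>), so no space is lost.\<close>

definition h_poset :: "'l rel \<Rightarrow> 'a topology set set" (\<open>\<P>\<close>) where
  "\<P> l = {[X]\<^sub>h | X :: 'a topology.
      regular_space X \<and> t1_space X \<and> scattered_space X \<and> P_space X \<and>
      weight_le X (cardSuc natLeq) \<and>
      l <o cb_rank X \<and> cb_rank X \<le>o ord_sum l natLeq}"

definition h_less :: "'a topology set \<Rightarrow> 'a topology set \<Rightarrow> bool" (infix \<open><\<^sub>h\<close> 50) where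
  "a <\<^sub>h b \<longleftrightarrow> (\<exists>X Y. a = [X]\<^sub>h \<and> b = [Y]\<^sub>h \<and> X \<subset>\<^sub>h Y)"

end

theory Submission
  imports Defs
begin

text \<open>
  The isomorphism sends the class of \<open>X\<close> to the class of the derivative \<open>X\<^sup>(\<^sup>\<lambda>\<^sup>)\<close>. Deriving
  \<open>\<lambda> + \<nu>\<close> times is deriving \<open>\<lambda>\<close> times and then \<open>\<nu>\<close> times (\<open>cb_derivative_ord_sum\<close>), so this map
  does go from \<open>\<P>\<^sub>\<lambda>\<close> to \<open>\<P>\<^sub>0\<close>. What remains is that \<open>X \<subset>\<^sub>h Y\<close> is equivalent to
  \<open>X\<^sup>(\<^sup>\<lambda>\<^sup>) \<subset>\<^sub>h Y\<^sup>(\<^sup>\<lambda>\<^sup>)\<close>, and that every space in \<open>\<P>\<^sub>0\<close> is, up to \<open>=\<^sub>h\<close>, such a derivative.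

  If \<open>X \<subset>\<^sub>h Y\<close>, the embedding respects the derivatives, because a continuous injection maps
  accumulation points to accumulation points (\<open>derivative_embeds\<close>).

  For the converse (\<open>embeds_of_derivative_embeds\<close>), two features of regular P-spaces of weight
  at most \<open>\<omega>\<^sub>1\<close> allow an embedding to be assembled from small pieces. First, every open cover has a disjoint
  open refinement: \<open>\<omega>\<^sub>1\<close> many clopen sets cover, and each of them minus the countably many earlier ones
  is still clopen (\<open>disjoint_open_refinement\<close>). Secondly, a point \<open>p\<close> has a decreasing clopen
  neighbourhood base indexed by \<open>\<omega>\<^sub>1\<close>, whose successive differences cut the complement of \<open>p\<close> into
  layers that converge to \<open>p\<close>; given an embedding \<open>h\<close> of a closed set through \<open>p\<close> into \<open>Y\<close>, layers
  around \<open>p\<close> and around \<open>h p\<close> can be chosen to match along \<open>h\<close> (\<open>matching_layers\<close>). Embedding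
  layer by layer and sending \<open>p\<close> to \<open>h p\<close> gives an embedding (\<open>embeds_in_layers\<close>). So by
  scatteredness it suffices to treat a point all of whose neighbours have been treated: a bad point
  that is isolated among the bad ones cannot be bad.

  The pieces that miss \<open>X\<^sup>(\<^sup>\<lambda>\<^sup>)\<close> carry no information from \<open>h\<close>, and they fit anywhere: a piece of
  rank at most \<open>\<lambda>\<close> embeds in every open set that meets all \<open>Y\<^sup>(\<^sup>\<beta>\<^sup>)\<close> with \<open>\<beta> < \<lambda>\<close>
  (\<open>embeds_in_of_empty_derivative\<close>). Indeed, a set all of whose points have rank at most
  \<open>\<beta> = \<mu> + n\<close>, with \<open>\<mu>\<close> zero or a limit and \<open>n\<close> finite, embeds in every open set that meets
  \<open>Y\<^sup>(\<^sup>\<mu>\<^sup>+\<^sup>2\<^sup>n\<^sup>+\<^sup>1\<^sup>)\<close>, and a limit ordinal is closed under \<open>\<mu> + n \<mapsto> \<mu> + 2n + 1\<close>. That \<open>\<lambda>\<close> is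
  countable makes room for these pieces: countably many points of \<open>Y\<close>, enough to witness all ranks
  below \<open>\<lambda>\<close>, can be kept away from \<open>h p\<close> by a neighbourhood of \<open>h p\<close>, so every layer around \<open>h p\<close>
  can be made to meet all these \<open>Y\<^sup>(\<^sup>\<beta>\<^sup>)\<close>.

  A given \<open>Z\<close> becomes a derivative when each isolated point of \<open>Z\<close> is made the root of a tree of
  finite sequences in which the root has rank \<open>\<lambda>\<close> and all other nodes have smaller rank
  (\<open>cb_derivative_attach_trees\<close>).
\<close>


section \<open>Well-orders and the cardinal \<open>\<omega>\<^sub>1\<close>\<close>

abbreviation \<omega>\<^sub>1 :: "nat set rel" where "\<omega>\<^sub>1 \<equiv> cardSuc natLeq"

lemma countable_iff_ordLeq_natLeq: "countable A \<longleftrightarrow> |A| \<le>o natLeq"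
proof -
  have "countable A \<longleftrightarrow> |A| \<le>o |UNIV :: nat set|"
    unfolding card_of_ordLeq[symmetric] countable_def by simp
  then show ?thesis
    using card_of_nat ordLeq_ordIso_trans ordIso_symmetric by blast
qed

lemma Card_order_omega1: "Card_order \<omega>\<^sub>1"
  by (rule cardSuc_Card_order[OF natLeq_Card_order])

lemma Well_order_omega1: "Well_order \<omega>\<^sub>1"
  by (rule cardSuc_Well_order[OF natLeq_Card_order])

lemma wo_rel_omega1: "wo_rel \<omega>\<^sub>1"
  using Well_order_omega1 by (simp add: wo_rel_def)

lemma Field_omega1_ordIso: "|Field \<omega>\<^sub>1| =o \<omega>\<^sub>1"
  by (rule card_of_Field_ordIso[OF Card_order_omega1])

lemma infinite_Field_omega1: "infinite (Field \<omega>\<^sub>1)"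
  using cardSuc_finite[OF natLeq_Card_order] by (simp add: Field_natLeq)

lemma uncountable_Field_omega1: "uncountable (Field \<omega>\<^sub>1)"
proof
  assume "countable (Field \<omega>\<^sub>1)"
  then have "|Field \<omega>\<^sub>1| \<le>o natLeq" by (simp add: countable_iff_ordLeq_natLeq)
  then have "\<omega>\<^sub>1 \<le>o natLeq" using Field_omega1_ordIso ordIso_ordLeq_trans ordIso_symmetric by blast
  then show False using cardSuc_greater[OF natLeq_Card_order]
    by (meson not_ordLess_ordLeq)
qed

lemma countable_underS_omega1:
  assumes "\<alpha> \<in> Field \<omega>\<^sub>1" shows "countable (underS \<omega>\<^sub>1 \<alpha>)"
  using card_of_underS[OF Card_order_omega1 assms]
  by (simp add: countable_iff_ordLeq_natLeq cardSuc_ordLeq_ordLess[OF natLeq_Card_order card_of_Card_order])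

lemma Well_order_linear:
  assumes "Well_order r" "a \<in> Field r" "b \<in> Field r"
  shows "a \<in> underS r b \<or> a = b \<or> b \<in> underS r a"
  using wo_rel.TOTALS[of r] assms by (auto simp: wo_rel_def underS_def)

lemma underS_irrefl: "a \<notin> underS r a"
  by (simp add: underS_def)

lemma underS_trans:
  "Well_order r \<Longrightarrow> a \<in> underS r b \<Longrightarrow> b \<in> underS r c \<Longrightarrow> a \<in> underS r c"
  using wo_rel.TRANS[of r] wo_rel.ANTISYM[of r]
  unfolding wo_rel_def underS_def trans_def antisym_def by blast

lemma underS_in_Field: "a \<in> underS r b \<Longrightarrow> a \<in> Field r \<and> b \<in> Field r"
  by (auto simp: underS_def Field_def)

lemma Well_order_induct [consumes 2, case_names less]:
  assumes "Well_order r" "a \<in> Field r"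
    and step: "\<And>a. a \<in> Field r \<Longrightarrow> (\<And>b. b \<in> underS r a \<Longrightarrow> P b) \<Longrightarrow> P a"
  shows "P a"
proof -
  have wo: "wo_rel r" using assms by (simp add: wo_rel_def)
  have "a \<in> Field r \<longrightarrow> P a"
  proof (rule wo_rel.well_order_induct[OF wo, of _ a], rule impI)
    fix x assume IH: "\<forall>y. y \<noteq> x \<and> (y, x) \<in> r \<longrightarrow> y \<in> Field r \<longrightarrow> P y" and x: "x \<in> Field r"
    show "P x" by (rule step[OF x]) (use IH in \<open>auto simp: underS_def Field_def\<close>)
  qed
  with assms show ?thesis by blast
qed

lemma Well_order_least:
  assumes "Well_order r" "A \<subseteq> Field r" "A \<noteq> {}"
  obtains a where "a \<in> A" "\<And>b. b \<in> A \<Longrightarrow> b \<notin> underS r a"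
proof -
  have wo: "wo_rel r" using assms by (simp add: wo_rel_def)
  show thesis
  proof (rule that)
    show "wo_rel.minim r A \<in> A" using wo_rel.minim_in[OF wo assms(2,3)] .
    show "b \<notin> underS r (wo_rel.minim r A)" if "b \<in> A" for b
      using wo_rel.minim_least[OF wo assms(2) that] wo_rel.ANTISYM[OF wo]
      by (auto simp: underS_def antisym_def)
  qed
qed

text \<open>
  This is the regularity of \<open>\<omega>\<^sub>1\<close>; it is what makes the tree below a P-space.
\<close>

lemma countable_bounded_omega1:
  assumes "C \<subseteq> Field \<omega>\<^sub>1" "countable C"
  obtains \<gamma> where "\<gamma> \<in> Field \<omega>\<^sub>1" "C \<subseteq> underS \<omega>\<^sub>1 \<gamma>"
proof -
  define D where "D = (\<Union>\<alpha>\<in>C. insert \<alpha> (underS \<omega>\<^sub>1 \<alpha>))"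
  have "countable D" using assms countable_underS_omega1 by (auto simp: D_def)
  then have "\<not> Field \<omega>\<^sub>1 \<subseteq> D" using uncountable_Field_omega1 countable_subset by blast
  then obtain \<gamma> where \<gamma>: "\<gamma> \<in> Field \<omega>\<^sub>1" "\<gamma> \<notin> D" by blast
  have "\<alpha> \<in> underS \<omega>\<^sub>1 \<gamma>" if "\<alpha> \<in> C" for \<alpha>
    using Well_order_linear[OF Well_order_omega1 _ \<gamma>(1), of \<alpha>] that assms \<gamma>(2) by (auto simp: D_def)
  with \<gamma> that show thesis by blast
qed

lemma ordLeq_omega1_iff: "|B| \<le>o \<omega>\<^sub>1 \<longleftrightarrow> |B| \<le>o |Field \<omega>\<^sub>1|"
  using Field_omega1_ordIso ordIso_symmetric ordLeq_ordIso_trans by blast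

lemma inj_into_omega1:
  assumes "|B| \<le>o \<omega>\<^sub>1" obtains f where "inj_on f B" "f ` B \<subseteq> Field \<omega>\<^sub>1"
  using assms unfolding ordLeq_omega1_iff card_of_ordLeq[symmetric] by blast

lemma enumeration_by_omega1:
  assumes "|B| \<le>o \<omega>\<^sub>1" obtains e where "B \<subseteq> e ` Field \<omega>\<^sub>1"
proof -
  obtain f where "inj_on f B" "f ` B \<subseteq> Field \<omega>\<^sub>1" by (rule inj_into_omega1[OF assms])
  then have "B \<subseteq> inv_into B f ` Field \<omega>\<^sub>1"
    by (metis imageI image_subset_iff inv_into_f_f subsetI)
  then show thesis by (rule that)
qed


section \<open>Regular scattered P-spaces of weight at most \<open>\<omega>\<^sub>1\<close>\<close>

definition small_P :: "'a topology \<Rightarrow> bool" where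
  "small_P X \<longleftrightarrow> regular_space X \<and> t1_space X \<and> scattered_space X \<and> P_space X \<and> weight_le X \<omega>\<^sub>1"

lemma small_PD:
  assumes "small_P X"
  shows "regular_space X" "t1_space X" "scattered_space X" "P_space X" "weight_le X \<omega>\<^sub>1"
  using assms by (auto simp: small_P_def)

lemma P_space_openin_INT:
  assumes X: "P_space X" and "countable I" "openin X U" "\<And>i. i \<in> I \<Longrightarrow> openin X (V i)"
  shows "openin X (U \<inter> (\<Inter>i\<in>I. V i))"
proof -
  have "gdelta_in X (\<Inter>(insert U (V ` I)))"
    using assms by (intro gdelta_in_Inter) (auto intro: open_imp_gdelta_in)
  then show ?thesis using X by (simp add: P_space_def)
qed

lemma P_space_openin_diff_countable:
  assumes X: "P_space X" "t1_space X" and "countable C" "openin X U"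
  shows "openin X (U - C)"
proof -
  have "openin X (U - {c})" for c
  proof (cases "c \<in> topspace X")
    case True
    then show ?thesis using closedin_t1_singleton[OF X(2)] \<open>openin X U\<close> by (simp add: openin_diff)
  next
    case False
    then have "U - {c} = U" using openin_subset[OF \<open>openin X U\<close>] by auto
    with assms show ?thesis by simp
  qed
  from P_space_openin_INT[OF X(1) \<open>countable C\<close> \<open>openin X U\<close> this]
  have "openin X (U \<inter> (\<Inter>c\<in>C. U - {c}))" .
  moreover have "U \<inter> (\<Inter>c\<in>C. U - {c}) = U - C" by auto
  ultimately show ?thesis by simp
qed

text \<open>
  In a regular space one can interpolate countably many open sets and their closures below \<open>U\<close>;
  the intersection of the sequence is closed, and open by the P-space property.
\<close>

lemma clopen_neighbourhood:
  assumes X: "regular_space X" "P_space X" and U: "openin X U" "x \<in> U"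
  obtains V where "openin X V" "closedin X V" "x \<in> V" "V \<subseteq> U"
proof -
  define Q where "Q A B \<longleftrightarrow> openin X A \<and> openin X B \<and> x \<in> B \<and> X closure_of B \<subseteq> A" for A B
  have step: "\<exists>B. Q A B" if "openin X A \<and> x \<in> A" for A
  proof -
    have "\<exists>B C. openin X B \<and> closedin X C \<and> x \<in> B \<and> B \<subseteq> C \<and> C \<subseteq> A"
      using X(1) that unfolding neighbourhood_base_of_closedin[symmetric] neighbourhood_base_of by blast
    then show ?thesis unfolding Q_def using closure_of_minimal that by (metis subset_trans)
  qed
  have "\<exists>f. \<forall>n. (openin X (f n) \<and> x \<in> f n \<and> (n = 0 \<longrightarrow> f n = U)) \<and> Q (f n) (f (Suc n))"
  proof (rule dependent_nat_choice)
    show "\<exists>A. openin X A \<and> x \<in> A \<and> (0 = (0::nat) \<longrightarrow> A = U)" using U by blast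
    show "\<exists>B. (openin X B \<and> x \<in> B \<and> (Suc n = 0 \<longrightarrow> B = U)) \<and> Q A B"
      if "openin X A \<and> x \<in> A \<and> (n = 0 \<longrightarrow> A = U)" for A n
      using step[of A] that by (auto simp: Q_def)
  qed
  then obtain f where f: "f 0 = U" "\<And>n. openin X (f n)" "\<And>n. x \<in> f n"
    "\<And>n. X closure_of f (Suc n) \<subseteq> f n" unfolding Q_def by metis
  define V where "V = (\<Inter>n. f n)"
  have sub: "f n \<subseteq> topspace X" for n by (rule openin_subset[OF f(2)])
  have "openin X V"
    using P_space_openin_INT[OF X(2) countableI_type f(2)[of 0], of UNIV f] f(2)
    by (simp add: V_def inf_absorb2 INF_lower)
  moreover have "V = (\<Inter>n. X closure_of f (Suc n))"
  proof
    show "V \<subseteq> (\<Inter>n. X closure_of f (Suc n))"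
      using closure_of_subset[OF sub] unfolding V_def by blast
    show "(\<Inter>n. X closure_of f (Suc n)) \<subseteq> V" using f(4) unfolding V_def by blast
  qed
  then have "closedin X V" by (metis (no_types, lifting) closedin_INT UNIV_not_empty closedin_closure_of)
  ultimately show thesis using that f unfolding V_def by blast
qed

text \<open>
  A base gives \<open>\<omega>\<^sub>1\<close> many clopen sets that cover and are subordinate to \<open>\<O>\<close>. Well-order them in
  type \<open>\<omega>\<^sub>1\<close> and remove from each its countably many predecessors: a countable union of clopen sets
  is clopen in a P-space.
\<close>

lemma disjoint_open_refinement:
  assumes X: "small_P X" and O: "\<And>U. U \<in> \<O> \<Longrightarrow> openin X U"
  obtains \<V> where "\<And>V. V \<in> \<V> \<Longrightarrow> openin X V" "\<And>V. V \<in> \<V> \<Longrightarrow> V \<noteq> {}"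
    "\<And>V. V \<in> \<V> \<Longrightarrow> \<exists>U\<in>\<O>. V \<subseteq> U" "disjoint \<V>" "\<Union>\<V> = \<Union>\<O>"
proof -
  note Xs = small_PD[OF X]
  obtain \<B> where B: "|\<B>| \<le>o \<omega>\<^sub>1" "\<forall>V\<in>\<B>. openin X V"
      "\<And>U x. openin X U \<Longrightarrow> x \<in> U \<Longrightarrow> \<exists>V\<in>\<B>. x \<in> V \<and> V \<subseteq> U"
    using Xs(5) unfolding weight_le_def by metis
  obtain f where f: "inj_on f \<B>" "f ` \<B> \<subseteq> Field \<omega>\<^sub>1" by (rule inj_into_omega1[OF B(1)])
  define \<B>' where "\<B>' = {G \<in> \<B>. \<exists>C. openin X C \<and> closedin X C \<and> G \<subseteq> C \<and> (\<exists>U\<in>\<O>. C \<subseteq> U)}"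
  then have "\<forall>G\<in>\<B>'. \<exists>C. openin X C \<and> closedin X C \<and> G \<subseteq> C \<and> (\<exists>U\<in>\<O>. C \<subseteq> U)" by blast
  from bchoice[OF this]
  obtain C where C: "\<And>G. G \<in> \<B>' \<Longrightarrow> openin X (C G) \<and> closedin X (C G) \<and> G \<subseteq> C G \<and> (\<exists>U\<in>\<O>. C G \<subseteq> U)"
    by blast
  have cover: "\<exists>G\<in>\<B>'. x \<in> C G" if "U \<in> \<O>" "x \<in> U" for x U
  proof -
    obtain K where K: "openin X K" "closedin X K" "x \<in> K" "K \<subseteq> U"
      using clopen_neighbourhood[OF Xs(1) Xs(4) O] \<open>U \<in> \<O>\<close> \<open>x \<in> U\<close> by blast
    obtain G where "G \<in> \<B>" "x \<in> G" "G \<subseteq> K" using B(3)[OF K(1,3)] by blast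
    then have "G \<in> \<B>'" using K that unfolding \<B>'_def by blast
    then show ?thesis using C \<open>x \<in> G\<close> by blast
  qed
  \<comment> \<open>only countably many sets precede a given one\<close>
  define before where "before G = {H \<in> \<B>'. f H \<in> underS \<omega>\<^sub>1 (f G)}" for G
  define V where "V G = C G \<inter> (\<Inter>H\<in>before G. topspace X - C H)" for G
  have "countable (before G)" if "G \<in> \<B>'" for G
  proof -
    have "countable (underS \<omega>\<^sub>1 (f G))"
      using that f(2) by (intro countable_underS_omega1) (auto simp: \<B>'_def)
    moreover have "f ` before G \<subseteq> underS \<omega>\<^sub>1 (f G)" by (auto simp: before_def)
    moreover have "inj_on f (before G)" using f(1) by (rule inj_on_subset) (auto simp: before_def \<B>'_def)
    ultimately show ?thesis using countable_subset countable_image_inj_on by blast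
  qed
  then have op: "openin X (V G)" if "G \<in> \<B>'" for G
    unfolding V_def using that C by (intro P_space_openin_INT[OF Xs(4)]) (auto simp: before_def)
  have dis: "V G \<inter> V H = {}" if "G \<in> \<B>'" "H \<in> \<B>'" "G \<noteq> H" for G H
  proof -
    have "f G \<noteq> f H" "f G \<in> Field \<omega>\<^sub>1" "f H \<in> Field \<omega>\<^sub>1"
      using f that by (auto simp: \<B>'_def inj_on_def)
    then have "G \<in> before H \<or> H \<in> before G"
      using Well_order_linear[OF Well_order_omega1] that by (auto simp: before_def)
    then show ?thesis by (auto simp: V_def)
  qed
  have cov: "\<exists>G\<in>\<B>'. x \<in> V G" if "x \<in> \<Union>\<O>" for x
  proof -
    define A where "A = f ` {G \<in> \<B>'. x \<in> C G}"
    have "A \<noteq> {}" using cover that by (auto simp: A_def)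
    moreover have "A \<subseteq> Field \<omega>\<^sub>1" using f(2) by (auto simp: A_def \<B>'_def)
    ultimately obtain a where a: "a \<in> A" "\<And>b. b \<in> A \<Longrightarrow> b \<notin> underS \<omega>\<^sub>1 a"
      using Well_order_least[OF Well_order_omega1] by metis
    then obtain G where G: "G \<in> \<B>'" "x \<in> C G" "a = f G" by (auto simp: A_def)
    have "x \<in> topspace X" using C G openin_subset by blast
    moreover have "x \<notin> C H" if "H \<in> before G" for H
      using that a(2) G by (auto simp: before_def A_def)
    ultimately have "x \<in> V G" using G by (auto simp: V_def)
    with G show ?thesis by blast
  qed
  have subV: "\<exists>U\<in>\<O>. V G \<subseteq> U" if "G \<in> \<B>'" for G
    using C[OF that] unfolding V_def by blast
  show thesis
  proof (rule that[of "V ` \<B>' - {{}}"])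
    show "disjoint (V ` \<B>' - {{}})"
      using dis unfolding disjoint_def by blast
    show "\<Union>(V ` \<B>' - {{}}) = \<Union>\<O>" using cov subV by blast
  qed (use op subV in auto)
qed

section \<open>Embeddings, pointwise\<close>

text \<open>
  This says that \<open>g\<close> restricted to \<open>U\<close> is a homeomorphism onto its image, in terms of
  neighbourhoods at each single point, so that an embedding can be checked piece by piece. In a \<open>T\<^sub>1\<close>
  space, injectivity follows from the second condition (\<open>emb_on_inj\<close>).
\<close>

definition emb_on :: "'a topology \<Rightarrow> 'a set \<Rightarrow> 'b topology \<Rightarrow> ('a \<Rightarrow> 'b) \<Rightarrow> bool" where
  "emb_on X U Y g \<longleftrightarrow> U \<subseteq> topspace X \<and> g ` U \<subseteq> topspace Y \<and>
     (\<forall>x\<in>U. (\<forall>N. openin Y N \<and> g x \<in> N \<longrightarrow> (\<exists>M. openin X M \<and> x \<in> M \<and> g ` (M \<inter> U) \<subseteq> N)) \<and>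
            (\<forall>M. openin X M \<and> x \<in> M \<longrightarrow> (\<exists>N. openin Y N \<and> g x \<in> N \<and> {y\<in>U. g y \<in> N} \<subseteq> M)))"

lemma emb_onD1: "emb_on X U Y g \<Longrightarrow> x \<in> U \<Longrightarrow> openin Y N \<Longrightarrow> g x \<in> N \<Longrightarrow>
    \<exists>M. openin X M \<and> x \<in> M \<and> g ` (M \<inter> U) \<subseteq> N"
  by (simp add: emb_on_def)

lemma emb_onD2: "emb_on X U Y g \<Longrightarrow> x \<in> U \<Longrightarrow> openin X M \<Longrightarrow> x \<in> M \<Longrightarrow>
    \<exists>N. openin Y N \<and> g x \<in> N \<and> {y\<in>U. g y \<in> N} \<subseteq> M"
  by (simp add: emb_on_def)

lemma emb_on_subset_topspace: "emb_on X U Y g \<Longrightarrow> U \<subseteq> topspace X \<and> g ` U \<subseteq> topspace Y"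
  by (simp add: emb_on_def)

lemma emb_onI:
  assumes "U \<subseteq> topspace X" "g ` U \<subseteq> topspace Y"
    and "\<And>x N. x \<in> U \<Longrightarrow> openin Y N \<Longrightarrow> g x \<in> N \<Longrightarrow> \<exists>M. openin X M \<and> x \<in> M \<and> g ` (M \<inter> U) \<subseteq> N"
    and "\<And>x M. x \<in> U \<Longrightarrow> openin X M \<Longrightarrow> x \<in> M \<Longrightarrow> \<exists>N. openin Y N \<and> g x \<in> N \<and> {y\<in>U. g y \<in> N} \<subseteq> M"
  shows "emb_on X U Y g"
  using assms by (simp add: emb_on_def)

lemma emb_on_inj:
  assumes "t1_space X" "emb_on X U Y g" shows "inj_on g U"
proof (rule inj_onI, rule ccontr)
  fix x y assume xy: "x \<in> U" "y \<in> U" "g x = g y" "x \<noteq> y"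
  have "x \<in> topspace X" "y \<in> topspace X"
    using xy(1,2) emb_on_subset_topspace[OF assms(2)] by auto
  then obtain M where M: "openin X M" "x \<in> M" "y \<notin> M"
    using assms(1) xy(4) unfolding t1_space_def by meson
  obtain N where "g x \<in> N" "{y \<in> U. g y \<in> N} \<subseteq> M"
    using emb_onD2[OF assms(2) xy(1) M(1,2)] by auto
  with xy(2,3) M(3) show False by auto
qed

lemma emb_on_mono:
  assumes "emb_on X U Y g" "U' \<subseteq> U" shows "emb_on X U' Y g"
proof (rule emb_onI)
  show "\<exists>M. openin X M \<and> x \<in> M \<and> g ` (M \<inter> U') \<subseteq> N" if "x \<in> U'" "openin Y N" "g x \<in> N" for x N
    using emb_onD1[OF assms(1) subsetD[OF assms(2) that(1)] that(2,3)] assms(2) by blast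
  show "\<exists>N. openin Y N \<and> g x \<in> N \<and> {y \<in> U'. g y \<in> N} \<subseteq> M"
    if "x \<in> U'" "openin X M" "x \<in> M" for x M
    using emb_onD2[OF assms(1) subsetD[OF assms(2) that(1)] that(2,3)] assms(2) by blast
qed (use emb_on_subset_topspace[OF assms(1)] assms(2) in blast)+

lemma emb_on_singleton:
  assumes "p \<in> topspace X" "q \<in> topspace Y" shows "emb_on X {p} Y (\<lambda>_. q)"
proof (rule emb_onI)
  show "\<exists>M. openin X M \<and> x \<in> M \<and> (\<lambda>_. q) ` (M \<inter> {p}) \<subseteq> N" if "x \<in> {p}" "openin Y N" "q \<in> N" for x N
    using that assms(1) by (intro exI[of _ "topspace X"]) auto
  show "\<exists>N. openin Y N \<and> q \<in> N \<and> {y \<in> {p}. q \<in> N} \<subseteq> M" if "x \<in> {p}" "openin X M" "x \<in> M" for x M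
    using that assms(2) by (intro exI[of _ "topspace Y"]) auto
qed (use assms in simp_all)

lemma emb_on_subtopology_source:
  assumes "A \<subseteq> topspace X"
  shows "emb_on (subtopology X A) A Y g \<longleftrightarrow> emb_on X A Y g"
proof
  assume L: "emb_on (subtopology X A) A Y g"
  show "emb_on X A Y g"
  proof (rule emb_onI)
    fix x N assume "x \<in> A" "openin Y N" "g x \<in> N"
    from emb_onD1[OF L this] show "\<exists>M. openin X M \<and> x \<in> M \<and> g ` (M \<inter> A) \<subseteq> N"
      unfolding openin_subtopology by (metis IntD1 Int_assoc Int_absorb)
  next
    fix x M assume "x \<in> A" "openin X M" "x \<in> M"
    then show "\<exists>N. openin Y N \<and> g x \<in> N \<and> {y \<in> A. g y \<in> N} \<subseteq> M"
      using emb_onD2[OF L, of x "M \<inter> A"] by (auto simp: openin_subtopology)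
  qed (use assms emb_on_subset_topspace[OF L] in auto)
next
  assume R: "emb_on X A Y g"
  show "emb_on (subtopology X A) A Y g"
  proof (rule emb_onI)
    fix x N assume x: "x \<in> A" "openin Y N" "g x \<in> N"
    then obtain M where "openin X M" "x \<in> M" "g ` (M \<inter> A) \<subseteq> N" using emb_onD1[OF R] by blast
    with x show "\<exists>M. openin (subtopology X A) M \<and> x \<in> M \<and> g ` (M \<inter> A) \<subseteq> N"
      by (intro exI[of _ "M \<inter> A"]) (auto simp: openin_subtopology)
  next
    fix x M assume "x \<in> A" "openin (subtopology X A) M" "x \<in> M"
    then obtain M' where "openin X M'" "x \<in> M'" "M = M' \<inter> A" by (auto simp: openin_subtopology)
    then show "\<exists>N. openin Y N \<and> g x \<in> N \<and> {y \<in> A. g y \<in> N} \<subseteq> M"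
      using emb_onD2[OF R \<open>x \<in> A\<close>, of M'] by auto
  qed (use assms emb_on_subset_topspace[OF R] in auto)
qed

lemma emb_on_subtopology_target:
  "emb_on X U (subtopology Y B) g \<longleftrightarrow> emb_on X U Y g \<and> g ` U \<subseteq> B"
proof safe
  assume L: "emb_on X U (subtopology Y B) g"
  then show "g x \<in> B" if "x \<in> U" for x
    using emb_on_subset_topspace[OF L] that by auto
  then show "emb_on X U Y g"
  proof (intro emb_onI)
    fix x N assume "x \<in> U" "openin Y N" "g x \<in> N"
    then show "\<exists>M. openin X M \<and> x \<in> M \<and> g ` (M \<inter> U) \<subseteq> N"
      using emb_onD1[OF L, of x "N \<inter> B"] \<open>\<And>x. x \<in> U \<Longrightarrow> g x \<in> B\<close> by (auto simp: openin_subtopology)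
  next
    fix x M assume "x \<in> U" "openin X M" "x \<in> M"
    then obtain N where "openin (subtopology Y B) N" "g x \<in> N" "{y \<in> U. g y \<in> N} \<subseteq> M"
      using emb_onD2[OF L] by blast
    moreover then obtain N' where "openin Y N'" "N = N' \<inter> B" by (auto simp: openin_subtopology)
    ultimately show "\<exists>N. openin Y N \<and> g x \<in> N \<and> {y \<in> U. g y \<in> N} \<subseteq> M"
      using \<open>\<And>x. x \<in> U \<Longrightarrow> g x \<in> B\<close> by (intro exI[of _ N']) auto
  qed (use emb_on_subset_topspace[OF L] in auto)
next
  assume R: "emb_on X U Y g" "g ` U \<subseteq> B"
  show "emb_on X U (subtopology Y B) g"
  proof (intro emb_onI)
    fix x N assume x: "x \<in> U" "openin (subtopology Y B) N" "g x \<in> N"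
    then obtain N' where "openin Y N'" "N = N' \<inter> B" by (auto simp: openin_subtopology)
    with x show "\<exists>M. openin X M \<and> x \<in> M \<and> g ` (M \<inter> U) \<subseteq> N"
      using emb_onD1[OF R(1), of x N'] R(2) by blast
  next
    fix x M assume "x \<in> U" "openin X M" "x \<in> M"
    then obtain N where "openin Y N" "g x \<in> N" "{y \<in> U. g y \<in> N} \<subseteq> M"
      using emb_onD2[OF R(1)] by blast
    then show "\<exists>N. openin (subtopology Y B) N \<and> g x \<in> N \<and> {y \<in> U. g y \<in> N} \<subseteq> M"
      using R(2) \<open>x \<in> U\<close> by (intro exI[of _ "N \<inter> B"]) (auto simp: openin_subtopology)
  qed (use emb_on_subset_topspace[OF R(1)] R in auto)
qed

lemma emb_on_imp_homeomorphic:
  assumes X: "t1_space X" and g: "emb_on X (topspace X) Y g"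
  shows "homeomorphic_map X (subtopology Y (g ` topspace X)) g"
proof (rule bijective_open_imp_homeomorphic_map)
  have im: "g ` topspace X \<subseteq> topspace Y" using emb_on_subset_topspace[OF g] by simp
  have "openin X {x \<in> topspace X. g x \<in> N}" if N: "openin Y N" for N
  proof (subst openin_subopen, safe)
    fix x assume "x \<in> topspace X" "g x \<in> N"
    from emb_onD1[OF g this(1) N this(2)] obtain M where "openin X M" "x \<in> M" "g ` (M \<inter> topspace X) \<subseteq> N" by blast
    then show "\<exists>T. openin X T \<and> x \<in> T \<and> T \<subseteq> {x \<in> topspace X. g x \<in> N}"
      using openin_subset[of X M] by blast
  qed
  then show "continuous_map X (subtopology Y (g ` topspace X)) g"
    using im by (simp add: continuous_map_in_subtopology) (auto simp: continuous_map_def)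
  show "open_map X (subtopology Y (g ` topspace X)) g"
    unfolding open_map_def
  proof (intro allI impI)
    fix M assume M: "openin X M"
    define N where "N = \<Union>{N. openin Y N \<and> {y\<in>topspace X. g y \<in> N} \<subseteq> M}"
    have sub: "M \<subseteq> topspace X" by (rule openin_subset[OF M])
    have "openin Y N" unfolding N_def by blast
    moreover have "g ` M = N \<inter> g ` topspace X"
    proof
      show "g ` M \<subseteq> N \<inter> g ` topspace X"
        using emb_onD2[OF g _ M] sub unfolding N_def by blast
      show "N \<inter> g ` topspace X \<subseteq> g ` M" unfolding N_def by blast
    qed
    ultimately show "openin (subtopology Y (g ` topspace X)) (g ` M)"
      by (auto simp: openin_subtopology)
  qed
  show "g ` topspace X = topspace (subtopology Y (g ` topspace X))" using im by auto
  show "inj_on g (topspace X)" by (rule emb_on_inj[OF X g])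
qed

lemma homeomorphic_imp_emb_on:
  assumes "homeomorphic_map X (subtopology Y S) g" "S \<subseteq> topspace Y"
  shows "emb_on X (topspace X) Y g" "g ` topspace X = S"
proof -
  have c: "continuous_map X (subtopology Y S) g" by (rule homeomorphic_imp_continuous_map[OF assms(1)])
  have o: "open_map X (subtopology Y S) g" by (rule homeomorphic_imp_open_map[OF assms(1)])
  have inj: "inj_on g (topspace X)" by (rule homeomorphic_imp_injective_map[OF assms(1)])
  have im: "g ` topspace X = S"
    using homeomorphic_imp_surjective_map[OF assms(1)] assms(2) by (metis topspace_subtopology_subset)
  show "g ` topspace X = S" by fact
  have "emb_on X (topspace X) (subtopology Y S) g"
  proof (rule emb_onI)
    fix x N assume x: "x \<in> topspace X" "openin (subtopology Y S) N" "g x \<in> N"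
    then show "\<exists>M. openin X M \<and> x \<in> M \<and> g ` (M \<inter> topspace X) \<subseteq> N"
      using openin_continuous_map_preimage[OF c x(2)]
      by (intro exI[of _ "{x \<in> topspace X. g x \<in> N}"]) auto
  next
    fix x M assume x: "x \<in> topspace X" "openin X M" "x \<in> M"
    then show "\<exists>N. openin (subtopology Y S) N \<and> g x \<in> N \<and> {y \<in> topspace X. g y \<in> N} \<subseteq> M"
      using o inj openin_subset[OF x(2)] unfolding open_map_def
      by (intro exI[of _ "g ` M"]) (auto simp: inj_on_def)
  qed (use im assms in auto)
  then show "emb_on X (topspace X) Y g" by (simp add: emb_on_subtopology_target)
qed

lemma embedsE:
  assumes "X \<subset>\<^sub>h Y"
  obtains S f where "S \<subseteq> topspace Y" "homeomorphic_map X (subtopology Y S) f"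
proof -
  obtain S where S: "S \<subseteq> topspace Y" "X homeomorphic_space subtopology Y S"
    using assms by (auto simp: embeds_def)
  obtain f where "homeomorphic_map X (subtopology Y S) f"
    using S(2) by (auto simp: homeomorphic_space)
  with S(1) show thesis by (rule that)
qed

lemma embeds_iff_emb_on:
  assumes "t1_space X"
  shows "X \<subset>\<^sub>h Y \<longleftrightarrow> (\<exists>g. emb_on X (topspace X) Y g)"
proof
  assume "X \<subset>\<^sub>h Y"
  then obtain S f where S: "S \<subseteq> topspace Y" and f: "homeomorphic_map X (subtopology Y S) f"
    by (rule embedsE)
  from homeomorphic_imp_emb_on(1)[OF f S] show "\<exists>g. emb_on X (topspace X) Y g" by blast
next
  assume "\<exists>g. emb_on X (topspace X) Y g"
  then obtain g where g: "emb_on X (topspace X) Y g" ..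
  show "X \<subset>\<^sub>h Y"
    unfolding embeds_def
  proof (intro exI conjI)
    show "g ` topspace X \<subseteq> topspace Y" using emb_on_subset_topspace[OF g] by (rule conjunct2)
    show "X homeomorphic_space subtopology Y (g ` topspace X)"
      using emb_on_imp_homeomorphic[OF assms g] by (rule homeomorphic_map_imp_homeomorphic_space)
  qed
qed

lemma embeds_iff_embedding_map: "X \<subset>\<^sub>h Y \<longleftrightarrow> (\<exists>f. embedding_map X Y f)"
proof
  assume "X \<subset>\<^sub>h Y"
  then obtain S f where S: "S \<subseteq> topspace Y" and f: "homeomorphic_map X (subtopology Y S) f"
    by (rule embedsE)
  have "f ` topspace X = S" by (rule homeomorphic_imp_emb_on(2)[OF f S])
  then have "embedding_map X Y f" unfolding embedding_map_def using f by (rule ssubst)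
  then show "\<exists>f. embedding_map X Y f" by blast
next
  assume "\<exists>f. embedding_map X Y f"
  then obtain f where f: "embedding_map X Y f" ..
  have "f ` topspace X = topspace Y \<inter> f ` topspace X"
    using homeomorphic_imp_surjective_map[OF f[unfolded embedding_map_def]]
    unfolding topspace_subtopology .
  then have "f ` topspace X \<subseteq> topspace Y" by blast
  then show "X \<subset>\<^sub>h Y"
    unfolding embeds_def using embedding_map_imp_homeomorphic_space[OF f] by (intro exI conjI)
qed

lemma embeds_refl: "X \<subset>\<^sub>h X"
  unfolding embeds_def by (intro exI[of _ "topspace X"]) (simp only: subtopology_topspace homeomorphic_space_refl order_refl)

lemma embeds_trans: "X \<subset>\<^sub>h Y \<Longrightarrow> Y \<subset>\<^sub>h Z \<Longrightarrow> X \<subset>\<^sub>h Z"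
  unfolding embeds_iff_embedding_map by (elim exE) (rule exI, rule embedding_map_compose)

lemma homeomorphic_imp_embeds: "X homeomorphic_space Y \<Longrightarrow> X \<subset>\<^sub>h Y"
  unfolding embeds_def by (intro exI[of _ "topspace Y"]) (simp only: subtopology_topspace order_refl)

lemma subtopology_embeds: "subtopology X S \<subset>\<^sub>h X"
proof -
  have "subtopology X S homeomorphic_space subtopology X (topspace X \<inter> S)"
    unfolding subtopology_restrict[of X S, symmetric] by (rule homeomorphic_space_refl)
  then show ?thesis unfolding embeds_def by (intro exI[of _ "topspace X \<inter> S"]) simp
qed

lemma scattered_space_iff:
  "scattered_space X \<longleftrightarrow> (\<forall>S. S \<subseteq> topspace X \<longrightarrow> S \<noteq> {} \<longrightarrow> (\<exists>x\<in>S. \<exists>N. openin X N \<and> N \<inter> S = {x}))"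
  unfolding scattered_space_def openin_subtopology by metis

lemma P_spaceI:
  assumes "\<And>\<C>. countable \<C> \<Longrightarrow> \<C> \<noteq> {} \<Longrightarrow> (\<And>U. U \<in> \<C> \<Longrightarrow> openin X U) \<Longrightarrow> openin X (\<Inter>\<C>)"
  shows "P_space X"
  unfolding P_space_def
proof (intro allI impI)
  fix S assume S: "gdelta_in X S"
  then obtain \<C> where C: "countable \<C>" "\<C> \<subseteq> Collect (openin X)" "\<Inter>\<C> = S"
    unfolding gdelta_in_alt intersection_of_def by blast
  show "openin X S"
  proof (cases "\<C> = {}")
    case True
    then have "topspace X = S" using C gdelta_in_subset[OF S] by auto
    then show ?thesis by auto
  next
    case False
    with C assms show ?thesis by blast
  qed
qed

text \<open>
  All five properties pass to subspaces because the open sets of \<open>X\<close> are exactly the preimages of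
  those of \<open>Y\<close>.
\<close>

lemma small_P_embeds:
  assumes "X \<subset>\<^sub>h Y" "small_P Y" shows "small_P X"
proof -
  note Y = small_PD[OF assms(2)]
  obtain S f where S: "S \<subseteq> topspace Y" and f: "homeomorphic_map X (subtopology Y S) f"
    using assms(1) by (rule embedsE)
  have hs: "X homeomorphic_space subtopology Y S"
    using f by (rule homeomorphic_map_imp_homeomorphic_space)
  have reg: "regular_space X"
    using homeomorphic_regular_space[OF hs] regular_space_subtopology[OF Y(1)] by blast
  have t1: "t1_space X"
    using homeomorphic_t1_space[OF hs] t1_space_subtopology[OF Y(2)] by blast
  have e: "emb_on X (topspace X) Y f" by (rule homeomorphic_imp_emb_on(1)[OF f S])
  have im: "f ` topspace X \<subseteq> topspace Y" using emb_on_subset_topspace[OF e] by simp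
  have inj: "inj_on f (topspace X)" by (rule emb_on_inj[OF t1 e])
  define pre where "pre V = {x \<in> topspace X. f x \<in> V}" for V
  have pre_open: "openin X (pre V)" if "openin Y V" for V
  proof (subst openin_subopen, safe)
    fix x assume x: "x \<in> pre V"
    then have "x \<in> topspace X" "f x \<in> V" by (simp_all add: pre_def)
    then obtain M where M: "openin X M" "x \<in> M" "f ` (M \<inter> topspace X) \<subseteq> V"
      using emb_onD1[OF e _ \<open>openin Y V\<close>] by meson
    then have "M \<subseteq> pre V" using openin_subset[OF M(1)] unfolding pre_def by blast
    with M(1,2) show "\<exists>T. openin X T \<and> x \<in> T \<and> T \<subseteq> pre V" by blast
  qed
  have "\<exists>V. openin Y V \<and> U = pre V" if U: "openin X U" for U
  proof (intro exI conjI)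
    let ?V = "\<Union>{N. openin Y N \<and> pre N \<subseteq> U}"
    show "openin Y ?V" by blast
    show "U = pre ?V"
    proof
      show "U \<subseteq> pre ?V"
      proof
        fix x assume x: "x \<in> U"
        then have "x \<in> topspace X" using openin_subset[OF U] by blast
        moreover from emb_onD2[OF e this U x] obtain N where
          "openin Y N" "f x \<in> N" "pre N \<subseteq> U" unfolding pre_def by meson
        ultimately show "x \<in> pre ?V" unfolding pre_def by blast
      qed
      show "pre ?V \<subseteq> U" unfolding pre_def by blast
    qed
  qed
  then obtain ext where ext: "\<And>U. openin X U \<Longrightarrow> openin Y (ext U)"
    and pre_ext: "\<And>U. openin X U \<Longrightarrow> pre (ext U) = U" by metis
  have "scattered_space X"
    unfolding scattered_space_iff
  proof (intro allI impI)
    fix T assume T: "T \<subseteq> topspace X" "T \<noteq> {}"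
    then have "f ` T \<subseteq> topspace Y" "f ` T \<noteq> {}" using im by auto
    then obtain y N where y: "y \<in> f ` T" "openin Y N" "N \<inter> f ` T = {y}"
      using Y(3) unfolding scattered_space_iff by meson
    then obtain x where x: "x \<in> T" "openin Y N" "N \<inter> f ` T = {f x}" by auto
    have "z = x" if "z \<in> pre N \<inter> T" for z
    proof -
      have "f z \<in> N \<inter> f ` T" using that by (auto simp: pre_def)
      then have "f z = f x" unfolding x(3) by simp
      then show ?thesis using inj that x(1) T(1) by (auto dest: inj_onD)
    qed
    moreover have "x \<in> pre N" using x T(1) by (auto simp: pre_def)
    ultimately have "pre N \<inter> T = {x}" using x(1) by blast
    with x(1) pre_open[OF x(2)] show "\<exists>x\<in>T. \<exists>N. openin X N \<and> N \<inter> T = {x}" by blast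
  qed
  moreover have "P_space X"
  proof (rule P_spaceI)
    fix \<C> assume C: "countable \<C>" "\<C> \<noteq> {}" "\<And>U. U \<in> \<C> \<Longrightarrow> openin X U"
    have "openin Y (topspace Y \<inter> (\<Inter>U\<in>\<C>. ext U))"
      using C ext by (intro P_space_openin_INT[OF Y(4)]) simp_all
    moreover have "\<Inter>\<C> = pre (topspace Y \<inter> (\<Inter>U\<in>\<C>. ext U))"
    proof -
      have "(\<Inter>U\<in>\<C>. pre (ext U)) = pre (topspace Y \<inter> (\<Inter>U\<in>\<C>. ext U))"
        using C(2) im unfolding pre_def by auto
      moreover have "(\<Inter>U\<in>\<C>. pre (ext U)) = \<Inter>\<C>"
      proof -
        have "(\<Inter>U\<in>\<C>. pre (ext U)) = (\<Inter>U\<in>\<C>. U)"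
          by (rule INF_cong[OF refl]) (use pre_ext C(3) in simp)
        then show ?thesis by simp
      qed
      ultimately show ?thesis by simp
    qed
    ultimately show "openin X (\<Inter>\<C>)" using pre_open by simp
  qed
  moreover have "weight_le X \<omega>\<^sub>1"
  proof -
    obtain \<B> where B: "|\<B>| \<le>o \<omega>\<^sub>1" "\<forall>V\<in>\<B>. openin Y V"
      "\<And>U x. openin Y U \<Longrightarrow> x \<in> U \<Longrightarrow> \<exists>V\<in>\<B>. x \<in> V \<and> V \<subseteq> U"
      using Y(5) unfolding weight_le_def by meson
    have "|pre ` \<B>| \<le>o \<omega>\<^sub>1" using card_of_image B(1) ordLeq_transitive by blast
    moreover have "\<exists>V\<in>pre ` \<B>. x \<in> V \<and> V \<subseteq> U" if U: "openin X U" "x \<in> U" for U x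
    proof -
      have "f x \<in> ext U" "openin Y (ext U)" "x \<in> topspace X"
        using ext[OF U(1)] pre_ext[OF U(1)] U(2) unfolding pre_def by blast+
      then obtain V where "V \<in> \<B>" "f x \<in> V" "V \<subseteq> ext U" using B(3) by blast
      moreover from this have "pre V \<subseteq> pre (ext U)" by (auto simp: pre_def)
      ultimately have "x \<in> pre V" "pre V \<subseteq> U"
        using \<open>x \<in> topspace X\<close> unfolding pre_ext[OF U(1)] by (auto simp: pre_def)
      then show ?thesis using \<open>V \<in> \<B>\<close> by blast
    qed
    moreover have "\<forall>V\<in>pre ` \<B>. openin X V" using B(2) pre_open by blast
    ultimately show ?thesis unfolding weight_le_def by (intro exI[of _ "pre ` \<B>"]) blast
  qed
  ultimately show ?thesis using reg t1 by (simp add: small_P_def)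
qed

section \<open>Gluing embeddings\<close>

definition embeds_in :: "'a topology \<Rightarrow> 'a set \<Rightarrow> 'b topology \<Rightarrow> 'b set \<Rightarrow> bool" where
  "embeds_in X U Y V \<longleftrightarrow> (\<exists>g. emb_on X U Y g \<and> g ` U \<subseteq> V)"

lemma embeds_in_mono:
  assumes "embeds_in X U Y V" "U' \<subseteq> U" "V \<subseteq> V'" shows "embeds_in X U' Y V'"
proof -
  obtain g where g: "emb_on X U Y g" "g ` U \<subseteq> V" using assms(1) by (auto simp: embeds_in_def)
  have "g ` U' \<subseteq> V'" using g(2) assms(2,3) by (auto simp: image_subset_iff)
  with emb_on_mono[OF g(1) assms(2)] show ?thesis by (auto simp: embeds_in_def)
qed

text \<open>
  Disjointness of the open targets \<open>V i\<close> is what makes the inverse continuous: near \<open>h x\<close> only the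
  piece containing \<open>x\<close> is seen.
\<close>

lemma glued_embedding:
  assumes U: "\<And>i. i \<in> I \<Longrightarrow> openin X (U i)" "disjoint_family_on U I"
    and V: "\<And>i. i \<in> I \<Longrightarrow> openin Y (V i)" "disjoint_family_on V I"
    and e: "\<And>i. i \<in> I \<Longrightarrow> embeds_in X (U i) Y (V i)"
  shows "\<exists>g. emb_on X (\<Union>i\<in>I. U i) Y g \<and> (\<forall>i\<in>I. g ` U i \<subseteq> V i)"
proof -
  have "\<forall>i\<in>I. \<exists>g. emb_on X (U i) Y g \<and> g ` U i \<subseteq> V i" using e by (simp add: embeds_in_def)
  from bchoice[OF this] obtain g where g: "\<And>i. i \<in> I \<Longrightarrow> emb_on X (U i) Y (g i)"
      "\<And>i. i \<in> I \<Longrightarrow> g i ` U i \<subseteq> V i" by meson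
  define h where "h x = g (THE i. i \<in> I \<and> x \<in> U i) x" for x
  have h: "h x = g i x" if "i \<in> I" "x \<in> U i" for i x
  proof -
    have "(THE i. i \<in> I \<and> x \<in> U i) = i"
      using that U(2) by (intro the_equality) (auto simp: disjoint_family_on_def)
    then show ?thesis by (simp add: h_def)
  qed
  have hV: "h x \<in> V i" if "i \<in> I" "x \<in> U i" for i x
    unfolding h[OF that] using g(2)[OF that(1)] that(2) by auto
  have same: "x \<in> U i" if x: "h x \<in> V i" "i \<in> I" "x \<in> (\<Union>i\<in>I. U i)" for x i
  proof -
    obtain j where j: "j \<in> I" "x \<in> U j" using x(3) by auto
    have "j = i"
    proof (rule ccontr)
      assume "j \<noteq> i"
      then have "V j \<inter> V i = {}" using V(2) j(1) x(2) by (auto simp: disjoint_family_on_def)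
      with hV[OF j] x(1) show False by auto
    qed
    with j show ?thesis by simp
  qed
  have "emb_on X (\<Union>i\<in>I. U i) Y h"
  proof (rule emb_onI)
    fix x N assume "x \<in> (\<Union>i\<in>I. U i)" and N: "openin Y N" "h x \<in> N"
    then obtain i where i: "i \<in> I" "x \<in> U i" by blast
    from emb_onD1[OF g(1)[OF i(1)] i(2) N(1) N(2)[unfolded h[OF i]]]
    obtain M where M: "openin X M" "x \<in> M" "g i ` (M \<inter> U i) \<subseteq> N" by meson
    have "h y \<in> N" if "y \<in> M \<inter> U i" for y
      using that M(3) h[OF i(1), of y] by (auto simp: image_subset_iff)
    then show "\<exists>M. openin X M \<and> x \<in> M \<and> h ` (M \<inter> (\<Union>i\<in>I. U i)) \<subseteq> N"
      using openin_Int[OF M(1) U(1)[OF i(1)]] M(2) i(2)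
      by (intro exI[of _ "M \<inter> U i"]) (simp add: image_subset_iff)
  next
    fix x M assume "x \<in> (\<Union>i\<in>I. U i)" and M: "openin X M" "x \<in> M"
    then obtain i where i: "i \<in> I" "x \<in> U i" by blast
    from emb_onD2[OF g(1)[OF i(1)] i(2) M]
    obtain N where N: "openin Y N" "h x \<in> N" "{y \<in> U i. g i y \<in> N} \<subseteq> M"
      unfolding h[OF i] by meson
    have "{y \<in> (\<Union>i\<in>I. U i). h y \<in> N \<inter> V i} \<subseteq> M"
    proof
      fix y assume y: "y \<in> {y \<in> (\<Union>i\<in>I. U i). h y \<in> N \<inter> V i}"
      then have yU: "y \<in> U i" by (intro same[OF _ i(1)]) simp_all
      have "g i y \<in> N" using y h[OF i(1) yU] by simp
      with yU N(3) show "y \<in> M" by auto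
    qed
    then show "\<exists>N. openin Y N \<and> h x \<in> N \<and> {y \<in> (\<Union>i\<in>I. U i). h y \<in> N} \<subseteq> M"
      using openin_Int[OF N(1) V(1)[OF i(1)]] hV[OF i] N(2) by (intro exI[of _ "N \<inter> V i"] conjI) simp_all
  next
    show "(\<Union>i\<in>I. U i) \<subseteq> topspace X" using openin_subset[OF U(1)] by (rule UN_least)
    show "h ` (\<Union>i\<in>I. U i) \<subseteq> topspace Y"
      using hV openin_subset[OF V(1)] by (auto simp: subset_iff)
  qed
  moreover have "\<forall>i\<in>I. h ` U i \<subseteq> V i"
    by (intro ballI image_subsetI) (rule hV)
  ultimately show ?thesis by (intro exI conjI)
qed

lemma embeds_in_UNION:
  assumes U: "\<And>i. i \<in> I \<Longrightarrow> openin X (U i)" "disjoint_family_on U I"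
    and V: "\<And>i. i \<in> I \<Longrightarrow> openin Y (V i)" "disjoint_family_on V I"
    and e: "\<And>i. i \<in> I \<Longrightarrow> embeds_in X (U i) Y (V i)"
  shows "embeds_in X (\<Union>i\<in>I. U i) Y (\<Union>i\<in>I. V i)"
proof -
  obtain g where g: "emb_on X (\<Union>i\<in>I. U i) Y g" "\<And>i. i \<in> I \<Longrightarrow> g ` U i \<subseteq> V i"
    using glued_embedding[of I X U Y V, OF U V e] by meson
  have "g ` (\<Union>i\<in>I. U i) \<subseteq> (\<Union>i\<in>I. V i)" using g(2) by (auto simp: image_subset_iff)
  with g(1) show ?thesis unfolding embeds_in_def by (intro exI conjI)
qed

text \<open>
  The sets \<open>P i\<close> converge to \<open>p\<close> in the sense suited to P-spaces: each neighbourhood of \<open>p\<close> contains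
  all but countably many of them, and removing countably many leaves a neighbourhood of \<open>p\<close>. This form
  makes no reference to an order of the index set.
\<close>

definition converging_layers :: "'a topology \<Rightarrow> 'a \<Rightarrow> 'a set \<Rightarrow> 'i set \<Rightarrow> ('i \<Rightarrow> 'a set) \<Rightarrow> bool" where
  "converging_layers X p U I P \<longleftrightarrow>
     p \<in> U \<and> openin X U \<and> disjoint_family_on P I \<and>
     (\<forall>i\<in>I. openin X (P i) \<and> P i \<subseteq> U - {p}) \<and>
     (\<forall>C. countable C \<longrightarrow> C \<subseteq> I \<longrightarrow> openin X (U - (\<Union>i\<in>C. P i))) \<and>
     (\<forall>N. openin X N \<longrightarrow> p \<in> N \<longrightarrow> countable {i\<in>I. \<not> P i \<subseteq> N})"

text \<open>
  A neighbourhood of \<open>q\<close> contains all but countably many \<open>Q i\<close>, and the union of the corresponding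
  \<open>P i\<close> together with \<open>p\<close> is a neighbourhood of \<open>p\<close>; the same holds with the roles exchanged.
\<close>

lemma embeds_in_layers:
  assumes P: "converging_layers X p U I P" and U: "U = insert p (\<Union>i\<in>I. P i)"
    and Q: "converging_layers Y q V I Q"
    and e: "\<And>i. i \<in> I \<Longrightarrow> embeds_in X (P i) Y (Q i)"
  shows "embeds_in X U Y V"
proof -
  have P': "disjoint_family_on P I" "\<And>i. i \<in> I \<Longrightarrow> openin X (P i)" "\<And>i. i \<in> I \<Longrightarrow> P i \<subseteq> U - {p}"
    "\<And>C. countable C \<Longrightarrow> C \<subseteq> I \<Longrightarrow> openin X (U - (\<Union>i\<in>C. P i))"
    "\<And>N. openin X N \<Longrightarrow> p \<in> N \<Longrightarrow> countable {i\<in>I. \<not> P i \<subseteq> N}" "openin X U"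
    using P unfolding converging_layers_def by blast+
  have Q': "disjoint_family_on Q I" "\<And>i. i \<in> I \<Longrightarrow> openin Y (Q i)" "\<And>i. i \<in> I \<Longrightarrow> Q i \<subseteq> V - {q}"
    "\<And>C. countable C \<Longrightarrow> C \<subseteq> I \<Longrightarrow> openin Y (V - (\<Union>i\<in>C. Q i))"
    "\<And>N. openin Y N \<Longrightarrow> q \<in> N \<Longrightarrow> countable {i\<in>I. \<not> Q i \<subseteq> N}" "q \<in> V" "openin Y V"
    using Q unfolding converging_layers_def by blast+
  obtain g where g: "emb_on X (\<Union>i\<in>I. P i) Y g" "\<And>i. i \<in> I \<Longrightarrow> g ` P i \<subseteq> Q i"
    using glued_embedding[of I X P Y Q, OF P'(2,1) Q'(2,1) e] by meson
  define h where "h = g(p := q)"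
  have hp: "h p = q" by (simp add: h_def)
  have pP: "p \<notin> P i" if "i \<in> I" for i using P'(3)[OF that] by blast
  have h: "h x = g x" if "x \<in> P i" "i \<in> I" for x i using that pP by (auto simp: h_def)
  have hQ: "h x \<in> Q i" if "x \<in> P i" "i \<in> I" for x i
    unfolding h[OF that] using g(2)[OF that(2)] that(1) by auto
  have same: "x \<in> P i" if x: "x \<in> U" "h x \<in> Q i" "i \<in> I" for x i
  proof -
    have "x \<noteq> p" using x(2) Q'(3)[OF x(3)] hp by auto
    then obtain j where j: "j \<in> I" "x \<in> P j" using x(1) unfolding U by auto
    have "j = i"
    proof (rule ccontr)
      assume "j \<noteq> i"
      then have "Q j \<inter> Q i = {}" using Q'(1) j(1) x(3) by (auto simp: disjoint_family_on_def)
      with hQ[OF j(2,1)] x(2) show False by auto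
    qed
    with j show ?thesis by simp
  qed
  have UX: "U \<subseteq> topspace X" and VY: "V \<subseteq> topspace Y"
    by (rule openin_subset[OF P'(6)], rule openin_subset[OF Q'(7)])
  have "h x \<in> V" if "x \<in> U" for x
  proof (cases "x = p")
    case True
    then show ?thesis using hp Q'(6) by simp
  next
    case False
    then obtain i where i: "i \<in> I" "x \<in> P i" using \<open>x \<in> U\<close> unfolding U by auto
    show ?thesis using hQ[OF i(2,1)] Q'(3)[OF i(1)] by auto
  qed
  then have hV: "h ` U \<subseteq> V" by (rule image_subsetI)
  have "emb_on X U Y h"
  proof (rule emb_onI)
    fix x N assume x: "x \<in> U" and N: "openin Y N" "h x \<in> N"
    show "\<exists>M. openin X M \<and> x \<in> M \<and> h ` (M \<inter> U) \<subseteq> N"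
    proof (cases "x = p")
      case True
      define C where "C = {i\<in>I. \<not> Q i \<subseteq> N}"
      have C: "countable C" "C \<subseteq> I" using Q'(5)[OF N(1)] N(2) hp True by (auto simp: C_def)
      have "h ` ((U - (\<Union>i\<in>C. P i)) \<inter> U) \<subseteq> N"
      proof safe
        fix y assume y: "y \<in> U" "y \<notin> (\<Union>i\<in>C. P i)"
        show "h y \<in> N"
        proof (cases "y = p")
          case False
          then obtain i where i: "i \<in> I" "y \<in> P i" using y(1) unfolding U by auto
          then have "i \<notin> C" "h y \<in> Q i" using y(2) hQ by auto
          with i(1) show ?thesis by (auto simp: C_def)
        qed (use N hp \<open>x = p\<close> in simp)
      qed
      moreover have "p \<in> U - (\<Union>i\<in>C. P i)" using pP C(2) unfolding U by auto
      ultimately show ?thesis using P'(4)[OF C] True by (intro exI[of _ "U - (\<Union>i\<in>C. P i)"]) simp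
    next
      case False
      then obtain i where i: "i \<in> I" "x \<in> P i" using x unfolding U by auto
      have xP: "x \<in> (\<Union>i\<in>I. P i)" using i by auto
      from emb_onD1[OF g(1) xP N(1) N(2)[unfolded h[OF i(2,1)]]]
      obtain M where M: "openin X M" "x \<in> M" "g ` (M \<inter> (\<Union>i\<in>I. P i)) \<subseteq> N" by meson
      have "h y \<in> N" if "y \<in> M \<inter> P i" for y
        using that M(3) h[of y i] i(1) by (auto simp: image_subset_iff)
      then show ?thesis
        using openin_Int[OF M(1) P'(2)[OF i(1)]] M(2) i(2)
        by (intro exI[of _ "M \<inter> P i"]) (simp add: image_subset_iff)
    qed
  next
    fix x M assume x: "x \<in> U" and M: "openin X M" "x \<in> M"
    show "\<exists>N. openin Y N \<and> h x \<in> N \<and> {y \<in> U. h y \<in> N} \<subseteq> M"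
    proof (cases "x = p")
      case True
      define C where "C = {i\<in>I. \<not> P i \<subseteq> M}"
      have C: "countable C" "C \<subseteq> I" using P'(5)[OF M(1)] M(2) True by (auto simp: C_def)
      have "{y \<in> U. h y \<in> V - (\<Union>i\<in>C. Q i)} \<subseteq> M"
      proof safe
        fix y assume y: "y \<in> U" "h y \<notin> (\<Union>i\<in>C. Q i)"
        show "y \<in> M"
        proof (cases "y = p")
          case False
          then obtain i where i: "i \<in> I" "y \<in> P i" using y(1) unfolding U by auto
          then have "i \<notin> C" using y(2) hQ by auto
          with i show ?thesis by (auto simp: C_def)
        qed (use M \<open>x = p\<close> in simp)
      qed
      moreover have "q \<in> V - (\<Union>i\<in>C. Q i)" using Q'(3,6) C(2) by auto
      ultimately show ?thesis using Q'(4)[OF C] True hp by (intro exI[of _ "V - (\<Union>i\<in>C. Q i)"]) simp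
    next
      case False
      then obtain i where i: "i \<in> I" "x \<in> P i" using x unfolding U by auto
      have xP: "x \<in> (\<Union>i\<in>I. P i)" using i by auto
      from emb_onD2[OF g(1) xP M]
      obtain N where N: "openin Y N" "h x \<in> N" "{y \<in> (\<Union>i\<in>I. P i). g y \<in> N} \<subseteq> M"
        unfolding h[OF i(2,1)] by meson
      have "{y \<in> U. h y \<in> N \<inter> Q i} \<subseteq> M"
      proof
        fix y assume y: "y \<in> {y \<in> U. h y \<in> N \<inter> Q i}"
        then have yP: "y \<in> P i" by (intro same[OF _ _ i(1)]) simp_all
        have "g y \<in> N" using y h[OF yP i(1)] by simp
        with yP i(1) N(3) show "y \<in> M" by auto
      qed
      then show ?thesis
        using openin_Int[OF N(1) Q'(2)[OF i(1)]] N(2) hQ[OF i(2,1)]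
        by (intro exI[of _ "N \<inter> Q i"] conjI) simp_all
    qed
  next
    show "U \<subseteq> topspace X" by (rule UX)
    show "h ` U \<subseteq> topspace Y" using hV VY by (rule order_trans)
  qed
  then show ?thesis unfolding embeds_in_def using hV by (intro exI conjI)
qed

section \<open>Cantor-Bendixson levels as closed sets\<close>

lemma mem_cb_step_iff:
  "x \<in> cb_step X S \<longleftrightarrow> x \<in> S \<and> x \<in> topspace X \<and> (\<forall>T. x \<in> T \<longrightarrow> openin X T \<longrightarrow> (\<exists>y\<in>S \<inter> T. y \<noteq> x))"
  by (auto simp: cb_step_def in_derived_set_of)

lemma closedin_cb_step:
  assumes S: "closedin X S" shows "closedin X (cb_step X S)"
proof -
  have "\<exists>T. openin X T \<and> x \<in> T \<and> T \<subseteq> topspace X - cb_step X S" if x: "x \<in> topspace X - cb_step X S" for x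
  proof (cases "x \<in> S")
    case True
    then obtain T where T: "x \<in> T" "openin X T" "\<And>y. y \<in> S \<inter> T \<Longrightarrow> y = x"
      using x by (auto simp: mem_cb_step_iff)
    have "y \<notin> cb_step X S" if "y \<in> T" for y
    proof
      assume y: "y \<in> cb_step X S"
      then have "y = x" using T(3)[of y] that by (auto simp: mem_cb_step_iff)
      with x y show False by simp
    qed
    with T openin_subset[OF T(2)] show ?thesis by (intro exI[of _ T]) auto
  next
    case False
    have "topspace X - S \<subseteq> topspace X - cb_step X S" using cb_step_subset[of X S] by auto
    moreover have "openin X (topspace X - S)" using S by (simp add: closedin_def)
    ultimately show ?thesis using x False by (intro exI[of _ "topspace X - S"]) auto
  qed
  then have "openin X (topspace X - cb_step X S)" by (subst openin_subopen) auto
  then show ?thesis by (auto simp: closedin_def mem_cb_step_iff)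
qed

lemma closedin_Int_INT:
  assumes "\<And>b. b \<in> I \<Longrightarrow> closedin X (D b)"
  shows "closedin X (topspace X \<inter> (\<Inter>b\<in>I. D b))"
proof (cases "I = {}")
  case False
  then have "closedin X (\<Inter>b\<in>I. D b)" using assms by (intro closedin_INT)
  then show ?thesis by (intro closedin_Int closedin_topspace)
qed simp

lemma closedin_cb_level:
  assumes r: "Well_order r" shows "closedin X (cb_level X r a)"
proof -
  have *: "closedin X (cb_level X r b)" if b: "b \<in> Field r" for b
    using r b
  proof (induction rule: Well_order_induct)
    case (less b)
    then show ?case
      by (subst cb_level_rec[OF r]) (intro closedin_Int_INT closedin_cb_step)
  qed
  show ?thesis
    by (subst cb_level_rec[OF r]) (intro closedin_Int_INT closedin_cb_step *, metis underS_in_Field)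
qed

lemma closedin_cb_derivative:
  assumes r: "Well_order r" shows "closedin X (cb_derivative X r)"
  unfolding cb_derivative_def by (intro closedin_Int_INT closedin_cb_step closedin_cb_level r)

text \<open>
  A continuous injection maps an accumulation point of \<open>S\<close> to an accumulation point of the image.
\<close>

lemma cb_step_image:
  assumes f: "emb_on X (topspace X) Y f" and inj: "inj_on f (topspace X)" and S: "f ` S \<subseteq> S'"
  shows "f ` cb_step X S \<subseteq> cb_step Y S'"
proof (rule image_subsetI)
  fix x assume x: "x \<in> cb_step X S"
  then have xS: "x \<in> S" "x \<in> topspace X" by (auto simp: mem_cb_step_iff)
  have "\<exists>y\<in>S' \<inter> T. y \<noteq> f x" if T: "f x \<in> T" "openin Y T" for T
  proof -
    obtain M where M: "openin X M" "x \<in> M" "f ` (M \<inter> topspace X) \<subseteq> T"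
      using emb_onD1[OF f xS(2) T(2,1)] by meson
    obtain y where y: "y \<in> S \<inter> M" "y \<noteq> x" using x M(1,2) by (auto simp: mem_cb_step_iff)
    have yX: "y \<in> topspace X" using y(1) openin_subset[OF M(1)] by auto
    then have "f y \<in> T" using y(1) M(3) by (auto simp: image_subset_iff)
    moreover have "f y \<in> S'" using y(1) S by (auto simp: image_subset_iff)
    moreover have "f y \<noteq> f x" using inj_onD[OF inj _ yX xS(2)] y(2) by auto
    ultimately show ?thesis by (intro bexI[of _ "f y"]) auto
  qed
  moreover have "f x \<in> S'" "f x \<in> topspace Y"
    using xS S emb_on_subset_topspace[OF f] by (auto simp: image_subset_iff)
  ultimately show "f x \<in> cb_step Y S'" by (simp add: mem_cb_step_iff)
qed

lemma cb_level_image: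
  assumes r: "Well_order r" and f: "emb_on X (topspace X) Y f" and inj: "inj_on f (topspace X)"
    and a: "a \<in> Field r"
  shows "f ` cb_level X r a \<subseteq> cb_level Y r a"
  using r a
proof (induction rule: Well_order_induct)
  case (less a)
  have "f x \<in> topspace Y" if "x \<in> topspace X" for x
    using that emb_on_subset_topspace[OF f] by (auto simp: image_subset_iff)
  moreover have "f x \<in> cb_step Y (cb_level Y r b)" if "b \<in> underS r a" "x \<in> cb_step X (cb_level X r b)" for b x
    using cb_step_image[OF f inj less.IH[OF that(1)]] that(2) by (auto simp: image_subset_iff)
  ultimately show ?case
    unfolding cb_level_rec[OF r, of X a] cb_level_rec[OF r, of Y a] by (auto simp: image_subset_iff)
qed

lemma cb_derivative_image:
  assumes r: "Well_order r" and f: "emb_on X (topspace X) Y f" and inj: "inj_on f (topspace X)"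
  shows "f ` cb_derivative X r \<subseteq> cb_derivative Y r"
proof (rule image_subsetI)
  fix x assume x: "x \<in> cb_derivative X r"
  then have "f x \<in> topspace Y"
    using emb_on_subset_topspace[OF f] by (auto simp: cb_derivative_def image_subset_iff)
  moreover have "f x \<in> cb_step Y (cb_level Y r b)" if "b \<in> Field r" for b
  proof -
    have "x \<in> cb_step X (cb_level X r b)" using x that by (simp add: cb_derivative_def)
    then show ?thesis
      using cb_step_image[OF f inj cb_level_image[OF r f inj that]] by (auto simp: image_subset_iff)
  qed
  ultimately show "f x \<in> cb_derivative Y r" by (simp add: cb_derivative_def)
qed


section \<open>Layers around a point\<close>

text \<open>
  A decreasing family is built along \<open>\<omega>\<^sub>1\<close>: at each stage only countably many elements have been
  chosen, so their infimum is again in \<open>\<L>\<close>, and a step \<open>\<Psi> \<alpha>\<close> can be taken from there. It will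
  be used for pairs of sets, which form a complete lattice.
\<close>

lemma omega1_recursion:
  fixes \<L> :: "'c::complete_lattice set" and \<Psi> :: "nat set \<Rightarrow> 'c \<Rightarrow> 'c \<Rightarrow> bool"
  assumes T: "T \<in> \<L>" and inf: "\<And>C. countable C \<Longrightarrow> C \<subseteq> \<L> \<Longrightarrow> C \<noteq> {} \<Longrightarrow> Inf C \<in> \<L>"
    and step: "\<And>\<alpha> G. \<alpha> \<in> Field \<omega>\<^sub>1 \<Longrightarrow> G \<in> \<L> \<Longrightarrow> \<exists>G'\<in>\<L>. G' \<le> G \<and> \<Psi> \<alpha> G G'"
  shows "\<exists>L. \<forall>\<alpha>\<in>Field \<omega>\<^sub>1. L \<alpha> \<in> \<L> \<and> L \<alpha> \<le> inf T (INF \<beta>\<in>underS \<omega>\<^sub>1 \<alpha>. L \<beta>) \<and>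
    \<Psi> \<alpha> (inf T (INF \<beta>\<in>underS \<omega>\<^sub>1 \<alpha>. L \<beta>)) (L \<alpha>)"
proof -
  define pre where "pre D \<alpha> = inf T (INF \<beta>\<in>underS \<omega>\<^sub>1 \<alpha>. D \<beta>)" for D :: "nat set \<Rightarrow> 'c" and \<alpha>
  define F where "F D \<alpha> = (SOME G'. G' \<in> \<L> \<and> G' \<le> pre D \<alpha> \<and> \<Psi> \<alpha> (pre D \<alpha>) G')" for D \<alpha>
  define L where "L = wo_rel.worec \<omega>\<^sub>1 F"
  have "F f x = F g x" if "\<forall>y\<in>underS \<omega>\<^sub>1 x. f y = g y" for f g x
  proof -
    have "pre f x = pre g x" unfolding pre_def using that by (simp cong: INF_cong)
    then show ?thesis by (simp add: F_def)
  qed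
  then have "wo_rel.adm_wo \<omega>\<^sub>1 F" unfolding wo_rel.adm_wo_def[OF wo_rel_omega1] by blast
  from wo_rel.worec_fixpoint[OF wo_rel_omega1 this] have L: "L \<alpha> = F L \<alpha>" for \<alpha>
    unfolding L_def by metis
  have "L \<alpha> \<in> \<L> \<and> L \<alpha> \<le> pre L \<alpha> \<and> \<Psi> \<alpha> (pre L \<alpha>) (L \<alpha>)" if "\<alpha> \<in> Field \<omega>\<^sub>1" for \<alpha>
    using Well_order_omega1 that
  proof (induction rule: Well_order_induct)
    case (less \<alpha>)
    have "Inf (insert T (L ` underS \<omega>\<^sub>1 \<alpha>)) \<in> \<L>"
      using less T countable_underS_omega1[OF less.hyps] by (intro inf) auto
    then have "pre L \<alpha> \<in> \<L>" by (simp add: pre_def)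
    from step[OF less.hyps this]
    have "\<exists>G'. G' \<in> \<L> \<and> G' \<le> pre L \<alpha> \<and> \<Psi> \<alpha> (pre L \<alpha>) G'" by blast
    from someI_ex[OF this] show ?case unfolding L[of \<alpha>] F_def .
  qed
  then show ?thesis unfolding pre_def by blast
qed

definition rel_clopen :: "'a topology \<Rightarrow> 'a set \<Rightarrow> 'a set \<Rightarrow> bool" where
  "rel_clopen X U G \<longleftrightarrow> G \<subseteq> U \<and> openin X G \<and> openin X (U - G)"

lemma rel_clopen_INT:
  assumes "P_space X" "openin X U" "countable I" "\<And>i. i \<in> I \<Longrightarrow> rel_clopen X U (G i)"
  shows "rel_clopen X U (U \<inter> (\<Inter>i\<in>I. G i))"
proof -
  have "openin X (U \<inter> (\<Inter>i\<in>I. G i))"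
    using assms by (intro P_space_openin_INT) (auto simp: rel_clopen_def)
  moreover have "openin X (\<Union>i\<in>I. U - G i)"
    using assms(4) by (intro openin_Union) (auto simp: rel_clopen_def)
  moreover have "U - (U \<inter> (\<Inter>i\<in>I. G i)) = (\<Union>i\<in>I. U - G i)" by auto
  ultimately show ?thesis by (simp add: rel_clopen_def)
qed

lemma rel_clopen_Int:
  assumes "rel_clopen X U G" "rel_clopen X U H" shows "rel_clopen X U (G \<inter> H)"
proof -
  have "U - G \<inter> H = (U - G) \<union> (U - H)" by auto
  then show ?thesis using assms by (auto simp: rel_clopen_def openin_Int openin_Un)
qed

lemma rel_clopen_neighbourhood:
  assumes "regular_space X" "P_space X" "openin X U" "openin X N" "x \<in> N" "N \<subseteq> U"
  shows "\<exists>G. rel_clopen X U G \<and> x \<in> G \<and> G \<subseteq> N"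
proof -
  obtain G where G: "openin X G" "closedin X G" "x \<in> G" "G \<subseteq> N"
    by (rule clopen_neighbourhood[OF assms(1,2,4,5)])
  have "openin X (U - G)" using assms(3) G(2) by (rule openin_diff)
  with G assms(6) show ?thesis by (intro exI[of _ G]) (auto simp: rel_clopen_def)
qed

text \<open>
  The complements of the two sets cover \<open>U\<close>; take a disjoint refinement and collect the pieces
  that meet \<open>F1\<close>.
\<close>

lemma rel_clopen_separation:
  assumes X: "small_P X" and F: "openin X (U - F1)" "openin X (U - F2)" "F1 \<inter> F2 = {}" "F1 \<subseteq> U"
  shows "\<exists>G. rel_clopen X U G \<and> F1 \<subseteq> G \<and> G \<inter> F2 = {}"
proof -
  obtain \<V> where V: "\<And>V. V \<in> \<V> \<Longrightarrow> openin X V" "\<And>V. V \<in> \<V> \<Longrightarrow> \<exists>W\<in>{U - F1, U - F2}. V \<subseteq> W"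
    "disjoint \<V>" "\<Union>\<V> = \<Union>{U - F1, U - F2}"
    by (rule disjoint_open_refinement[OF X, of "{U - F1, U - F2}"]) (use F in auto)
  have cover: "\<Union>\<V> = U" using V(4) F(3) by auto
  define G where "G = \<Union>{V\<in>\<V>. V \<inter> F1 \<noteq> {}}"
  define H where "H = \<Union>{V\<in>\<V>. V \<inter> F1 = {}}"
  have "G \<union> H = U" unfolding cover[symmetric] G_def H_def by auto
  moreover have "G \<inter> H = {}"
  proof -
    have "V \<inter> W = {}" if "V \<in> \<V>" "V \<inter> F1 \<noteq> {}" "W \<in> \<V>" "W \<inter> F1 = {}" for V W
      using V(3) that by (auto simp: disjoint_def)
    then show ?thesis unfolding G_def H_def by blast
  qed
  ultimately have "U - G = H" "G \<subseteq> U" by auto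
  moreover have "openin X G" "openin X H" unfolding G_def H_def using V(1) by (auto intro!: openin_Union)
  moreover have "F1 \<subseteq> G"
  proof
    fix x assume "x \<in> F1"
    then have "x \<in> \<Union>\<V>" using F(4) cover by auto
    with \<open>x \<in> F1\<close> show "x \<in> G" unfolding G_def by auto
  qed
  moreover have "V \<inter> F2 = {}" if "V \<in> \<V>" "V \<inter> F1 \<noteq> {}" for V using V(2)[OF that(1)] that(2) by auto
  then have "G \<inter> F2 = {}" unfolding G_def by blast
  ultimately show ?thesis by (auto simp: rel_clopen_def)
qed

text \<open>
  The layers are the differences between \<open>G \<alpha>\<close> and what is left before stage \<open>\<alpha>\<close>. The earlier
  stages have to be intersected, since the filtration need not be continuous at limits.
\<close>

lemma converging_layers_of_filtration:
  assumes X: "small_P X" and U: "openin X U" and G: "\<And>\<alpha>. \<alpha> \<in> Field \<omega>\<^sub>1 \<Longrightarrow> rel_clopen X U (G \<alpha>) \<and> p \<in> G \<alpha>"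
    and dec: "\<And>\<alpha> \<beta>. \<alpha> \<in> Field \<omega>\<^sub>1 \<Longrightarrow> \<beta> \<in> underS \<omega>\<^sub>1 \<alpha> \<Longrightarrow> G \<alpha> \<subseteq> G \<beta>"
    and small: "\<And>N. openin X N \<Longrightarrow> p \<in> N \<Longrightarrow> \<exists>\<alpha>\<in>Field \<omega>\<^sub>1. G \<alpha> \<subseteq> N"
    and P: "\<And>\<alpha>. P \<alpha> = U \<inter> (\<Inter>\<beta>\<in>underS \<omega>\<^sub>1 \<alpha>. G \<beta>) - G \<alpha>"
  shows "converging_layers X p U (Field \<omega>\<^sub>1) P" and "U = insert p (\<Union>\<alpha>\<in>Field \<omega>\<^sub>1. P \<alpha>)"
proof -
  let ?W = "Field \<omega>\<^sub>1"
  note Xs = small_PD[OF X]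
  obtain \<alpha>0 where "\<alpha>0 \<in> ?W" using infinite_Field_omega1 by (metis finite.emptyI ex_in_conv)
  then have pU: "p \<in> U" using G by (auto simp: rel_clopen_def)
  have Gf: "rel_clopen X U (G \<beta>)" "p \<in> G \<beta>" if "\<beta> \<in> ?W" for \<beta> using G[OF that] by auto
  have below: "\<beta> \<in> ?W" if "\<beta> \<in> underS \<omega>\<^sub>1 \<alpha>" for \<alpha> \<beta> using underS_in_Field[OF that] by simp
  have PU: "P \<alpha> \<subseteq> U - {p}" if "\<alpha> \<in> ?W" for \<alpha> using Gf(2)[OF that] by (auto simp: P)
  have pre: "rel_clopen X U (U \<inter> (\<Inter>\<beta>\<in>underS \<omega>\<^sub>1 \<alpha>. G \<beta>))" if "\<alpha> \<in> ?W" for \<alpha>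
    using Xs(4) U countable_underS_omega1[OF that] Gf(1)[OF below] by (rule rel_clopen_INT)
  have Pop: "openin X (P \<alpha>)" "openin X (U - P \<alpha>)" if "\<alpha> \<in> ?W" for \<alpha>
  proof -
    let ?A = "U \<inter> (\<Inter>\<beta>\<in>underS \<omega>\<^sub>1 \<alpha>. G \<beta>)"
    have A: "openin X ?A" "openin X (U - ?A)" and G': "openin X (G \<alpha>)" "openin X (U - G \<alpha>)" "G \<alpha> \<subseteq> U"
      using pre[OF that] Gf(1)[OF that] by (simp_all add: rel_clopen_def)
    have "P \<alpha> = ?A \<inter> (U - G \<alpha>)" unfolding P by auto
    then show "openin X (P \<alpha>)" using A(1) G'(2) by (simp add: openin_Int)
    have "U - P \<alpha> = (U - ?A) \<union> G \<alpha>" unfolding P using G'(3) by auto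
    then show "openin X (U - P \<alpha>)" using A(2) G'(1) by (simp add: openin_Un)
  qed
  have dis: "P \<alpha> \<inter> P \<beta> = {}" if "\<alpha> \<in> underS \<omega>\<^sub>1 \<beta>" for \<alpha> \<beta> using that by (auto simp: P)
  have "disjoint_family_on P ?W"
    unfolding disjoint_family_on_def
  proof (intro ballI impI)
    fix \<alpha> \<beta> assume "\<alpha> \<in> ?W" "\<beta> \<in> ?W" "\<alpha> \<noteq> \<beta>"
    then have "\<alpha> \<in> underS \<omega>\<^sub>1 \<beta> \<or> \<beta> \<in> underS \<omega>\<^sub>1 \<alpha>" using Well_order_linear[OF Well_order_omega1] by blast
    then show "P \<alpha> \<inter> P \<beta> = {}" using dis by blast
  qed
  moreover have "openin X (U - (\<Union>\<alpha>\<in>C. P \<alpha>))" if C: "countable C" "C \<subseteq> ?W" for C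
  proof -
    have "openin X (U \<inter> (\<Inter>\<alpha>\<in>C. U - P \<alpha>))"
      using C Pop(2) by (intro P_space_openin_INT[OF Xs(4) _ U]) auto
    moreover have "U \<inter> (\<Inter>\<alpha>\<in>C. U - P \<alpha>) = U - (\<Union>\<alpha>\<in>C. P \<alpha>)" by auto
    ultimately show ?thesis by simp
  qed
  moreover have "countable {\<alpha>\<in>?W. \<not> P \<alpha> \<subseteq> N}" if N: "openin X N" "p \<in> N" for N
  proof -
    obtain \<gamma> where \<gamma>: "\<gamma> \<in> ?W" "G \<gamma> \<subseteq> N" using small[OF N] by blast
    have "\<alpha> \<in> insert \<gamma> (underS \<omega>\<^sub>1 \<gamma>)" if "\<alpha> \<in> ?W" "\<not> P \<alpha> \<subseteq> N" for \<alpha>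
    proof (rule ccontr)
      assume "\<alpha> \<notin> insert \<gamma> (underS \<omega>\<^sub>1 \<gamma>)"
      then have "\<gamma> \<in> underS \<omega>\<^sub>1 \<alpha>" using Well_order_linear[OF Well_order_omega1 that(1) \<gamma>(1)] by auto
      then have "P \<alpha> \<subseteq> G \<gamma>" by (auto simp: P)
      with \<gamma>(2) that(2) show False by auto
    qed
    then have "{\<alpha>\<in>?W. \<not> P \<alpha> \<subseteq> N} \<subseteq> insert \<gamma> (underS \<omega>\<^sub>1 \<gamma>)" by blast
    moreover have "countable (insert \<gamma> (underS \<omega>\<^sub>1 \<gamma>))" using countable_underS_omega1[OF \<gamma>(1)] by simp
    ultimately show ?thesis using countable_subset by blast
  qed
  ultimately show "converging_layers X p U ?W P"
    unfolding converging_layers_def using pU U Pop(1) PU by simp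
  show "U = insert p (\<Union>\<alpha>\<in>?W. P \<alpha>)"
  proof
    show "insert p (\<Union>\<alpha>\<in>?W. P \<alpha>) \<subseteq> U" using pU PU by auto
    show "U \<subseteq> insert p (\<Union>\<alpha>\<in>?W. P \<alpha>)"
    proof
      fix x assume x: "x \<in> U"
      show "x \<in> insert p (\<Union>\<alpha>\<in>?W. P \<alpha>)"
      proof (cases "x = p")
        case False
        have "openin X (U - {x})" using P_space_openin_diff_countable[OF Xs(4,2) _ U, of "{x}"] by simp
        then obtain \<gamma> where "\<gamma> \<in> ?W" "G \<gamma> \<subseteq> U - {x}" using small[of "U - {x}"] pU False by auto
        then have "{\<gamma>\<in>?W. x \<notin> G \<gamma>} \<noteq> {}" by auto
        then obtain \<alpha> where \<alpha>: "\<alpha> \<in> {\<gamma>\<in>?W. x \<notin> G \<gamma>}" "\<And>\<beta>. \<beta> \<in> {\<gamma>\<in>?W. x \<notin> G \<gamma>} \<Longrightarrow> \<beta> \<notin> underS \<omega>\<^sub>1 \<alpha>"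
          using Well_order_least[OF Well_order_omega1, of "{\<gamma>\<in>?W. x \<notin> G \<gamma>}"] by auto
        then have "x \<in> G \<beta>" if "\<beta> \<in> underS \<omega>\<^sub>1 \<alpha>" for \<beta> using below[OF that] that by auto
        then have "x \<in> P \<alpha>" using x \<alpha>(1) by (auto simp: P)
        with \<alpha>(1) show ?thesis by auto
      qed simp
    qed
  qed
qed

lemma base_enumeration:
  assumes "weight_le X \<omega>\<^sub>1"
  shows "\<exists>\<B> e. (\<forall>B\<in>\<B>. openin X B) \<and>
    (\<forall>N. openin X N \<longrightarrow> p \<in> N \<longrightarrow> (\<exists>\<alpha>\<in>Field \<omega>\<^sub>1. e \<alpha> \<in> \<B> \<and> p \<in> e \<alpha> \<and> e \<alpha> \<subseteq> N))"
proof -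
  obtain \<B> where B: "|\<B>| \<le>o \<omega>\<^sub>1" "\<forall>V\<in>\<B>. openin X V"
    "\<And>U x. openin X U \<Longrightarrow> x \<in> U \<Longrightarrow> \<exists>V\<in>\<B>. x \<in> V \<and> V \<subseteq> U"
    using assms unfolding weight_le_def by meson
  obtain e where e: "\<B> \<subseteq> e ` Field \<omega>\<^sub>1" by (rule enumeration_by_omega1[OF B(1)])
  have "\<exists>\<alpha>\<in>Field \<omega>\<^sub>1. e \<alpha> \<in> \<B> \<and> p \<in> e \<alpha> \<and> e \<alpha> \<subseteq> N" if N: "openin X N" "p \<in> N" for N
  proof -
    obtain V where V: "V \<in> \<B>" "p \<in> V" "V \<subseteq> N" using B(3)[OF N] by blast
    then obtain \<alpha> where "\<alpha> \<in> Field \<omega>\<^sub>1" "V = e \<alpha>" using e by blast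
    with V show ?thesis by blast
  qed
  with B(2) show ?thesis by (intro exI[of _ \<B>] exI[of _ e]) blast
qed

text \<open>
  Neighbourhoods \<open>G\<close> of \<open>p\<close> and \<open>H\<close> of \<open>h p\<close> that cut out the same part of \<open>A\<close> (via \<open>h\<close>) are shrunk
  simultaneously along \<open>\<omega>\<^sub>1\<close>, running through bases at \<open>p\<close> and \<open>h p\<close>. In each step \<open>H\<close> is first made
  to avoid a countable set \<open>C\<close> that witnesses \<open>Rich\<close>, so that the layer removed from \<open>H\<close> is rich.
\<close>

lemma matching_layers:
  assumes X: "small_P X" and Y: "small_P Y" and U: "openin X U" "p \<in> U" and V: "openin Y V"
    and A: "closedin X A" "p \<in> A" and h: "emb_on X (A \<inter> U) Y h" "h ` (A \<inter> U) \<subseteq> V"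
    and mono: "\<And>S T. Rich S \<Longrightarrow> S \<subseteq> T \<Longrightarrow> Rich T"
    and rich: "\<And>W. openin Y W \<Longrightarrow> h p \<in> W \<Longrightarrow> W \<subseteq> V \<Longrightarrow> \<exists>C. countable C \<and> C \<subseteq> W - {h p} \<and> Rich C"
  shows "\<exists>P Q. converging_layers X p U (Field \<omega>\<^sub>1) P \<and> U = insert p (\<Union>\<alpha>\<in>Field \<omega>\<^sub>1. P \<alpha>) \<and>
    converging_layers Y (h p) V (Field \<omega>\<^sub>1) Q \<and>
    (\<forall>\<alpha>\<in>Field \<omega>\<^sub>1. Rich (Q \<alpha>) \<and> h ` (A \<inter> P \<alpha>) \<subseteq> Q \<alpha>)"
proof -
  let ?W = "Field \<omega>\<^sub>1"
  note Xs = small_PD[OF X] and Ys = small_PD[OF Y]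
  define q where "q = h p"
  have pA: "p \<in> A \<inter> U" using A(2) U(2) by simp
  have qV: "q \<in> V" using h(2) pA by (auto simp: q_def)
  have hV: "h x \<in> V" if "x \<in> A \<inter> U" for x using that h(2) by auto
  obtain \<B>X eX where BX: "\<forall>B\<in>\<B>X. openin X B"
      "\<And>N. openin X N \<Longrightarrow> p \<in> N \<Longrightarrow> \<exists>\<alpha>\<in>?W. eX \<alpha> \<in> \<B>X \<and> p \<in> eX \<alpha> \<and> eX \<alpha> \<subseteq> N"
    using base_enumeration[OF Xs(5), of p] by meson
  obtain \<B>Y eY where BY: "\<forall>B\<in>\<B>Y. openin Y B"
      "\<And>N. openin Y N \<Longrightarrow> q \<in> N \<Longrightarrow> \<exists>\<alpha>\<in>?W. eY \<alpha> \<in> \<B>Y \<and> q \<in> eY \<alpha> \<and> eY \<alpha> \<subseteq> N"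
    using base_enumeration[OF Ys(5), of q] by meson
  define \<L> where "\<L> = {(G, H). rel_clopen X U G \<and> p \<in> G \<and> rel_clopen Y V H \<and> q \<in> H \<and>
      (\<forall>x\<in>A \<inter> U. x \<in> G \<longleftrightarrow> h x \<in> H)}"
  define \<Psi> where "\<Psi> \<alpha> Z Z' \<longleftrightarrow> (eX \<alpha> \<in> \<B>X \<longrightarrow> p \<in> eX \<alpha> \<longrightarrow> fst Z' \<subseteq> eX \<alpha>) \<and>
      (eY \<alpha> \<in> \<B>Y \<longrightarrow> q \<in> eY \<alpha> \<longrightarrow> snd Z' \<subseteq> eY \<alpha>) \<and> Rich (snd Z - snd Z')"
    for \<alpha> and Z Z' :: "'a set \<times> 'b set"
  have top: "(U, V) \<in> \<L>"
    using U V qV hV by (auto simp: \<L>_def rel_clopen_def)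
  have inf: "Inf C \<in> \<L>" if C: "countable C" "C \<subseteq> \<L>" "C \<noteq> {}" for C
  proof -
    have L: "rel_clopen X U (fst c)" "p \<in> fst c" "rel_clopen Y V (snd c)" "q \<in> snd c"
        "\<forall>x\<in>A \<inter> U. x \<in> fst c \<longleftrightarrow> h x \<in> snd c" if "c \<in> C" for c
      using subsetD[OF C(2) that] by (auto simp: \<L>_def)
    have "rel_clopen X U (U \<inter> (\<Inter>c\<in>C. fst c))" "rel_clopen Y V (V \<inter> (\<Inter>c\<in>C. snd c))"
      using L C(1) by (intro rel_clopen_INT Xs(4) Ys(4) U V; simp)+
    moreover obtain c0 where "c0 \<in> C" using C(3) by auto
    then have "(\<Inter>c\<in>C. fst c) \<subseteq> U" "(\<Inter>c\<in>C. snd c) \<subseteq> V"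
      using L(1,3)[of c0] by (auto simp: rel_clopen_def)
    then have "U \<inter> (\<Inter>c\<in>C. fst c) = (\<Inter>c\<in>C. fst c)" "V \<inter> (\<Inter>c\<in>C. snd c) = (\<Inter>c\<in>C. snd c)" by auto
    moreover have "\<forall>x\<in>A \<inter> U. x \<in> (\<Inter>c\<in>C. fst c) \<longleftrightarrow> h x \<in> (\<Inter>c\<in>C. snd c)" using L(5) by auto
    ultimately have "((\<Inter>c\<in>C. fst c), (\<Inter>c\<in>C. snd c)) \<in> \<L>" using L(2,4) by (simp add: \<L>_def)
    moreover have "Inf C = ((\<Inter>c\<in>C. fst c), (\<Inter>c\<in>C. snd c))" by (simp add: Inf_prod_def)
    ultimately show ?thesis by simp
  qed
  have step: "\<exists>Z'\<in>\<L>. Z' \<le> Z \<and> \<Psi> \<alpha> Z Z'" if "\<alpha> \<in> ?W" and Z: "Z \<in> \<L>" for \<alpha> Z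
  proof -
    obtain G H where GH: "Z = (G, H)" by (cases Z)
    have G: "rel_clopen X U G" "p \<in> G" and H: "rel_clopen Y V H" "q \<in> H"
      using Z by (auto simp: GH \<L>_def)
    have Go: "openin X G" "G \<subseteq> U" and Ho: "openin Y H" "H \<subseteq> V"
      using G(1) H(1) by (auto simp: rel_clopen_def)
    define BX' where "BX' = (if eX \<alpha> \<in> \<B>X \<and> p \<in> eX \<alpha> then eX \<alpha> else U)"
    define BY' where "BY' = (if eY \<alpha> \<in> \<B>Y \<and> q \<in> eY \<alpha> then eY \<alpha> else V)"
    have BX': "openin X BX'" "p \<in> BX'" using BX(1) U by (auto simp: BX'_def)
    have BY': "openin Y BY'" "q \<in> BY'" using BY(1) V qV by (auto simp: BY'_def)
    obtain C where C: "countable C" "C \<subseteq> H - {q}" "Rich C"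
      using rich[OF Ho(1) _ Ho(2)] H(2) unfolding q_def by meson
    \<comment> \<open>\<open>H1\<close> leaves the rich set \<open>C\<close> behind, \<open>G1\<close> is mapped into \<open>H1\<close>, and \<open>H2\<close> pulls back into \<open>G1\<close>\<close>
    have "openin Y (H \<inter> BY' - C)"
      using P_space_openin_diff_countable[OF Ys(4,2) C(1) openin_Int[OF Ho(1) BY'(1)]] .
    moreover have "q \<in> H \<inter> BY' - C" using H(2) BY'(2) C(2) by auto
    ultimately obtain H1 where H1: "rel_clopen Y V H1" "q \<in> H1" "H1 \<subseteq> H \<inter> BY' - C"
      using rel_clopen_neighbourhood[OF Ys(1,4) V, of "H \<inter> BY' - C" q] Ho(2) by auto
    have H1o: "openin Y H1" using H1(1) by (simp add: rel_clopen_def)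
    obtain M where M: "openin X M" "p \<in> M" "h ` (M \<inter> (A \<inter> U)) \<subseteq> H1"
      using emb_onD1[OF h(1) pA H1o H1(2)[unfolded q_def]] by meson
    obtain G1 where G1: "rel_clopen X U G1" "p \<in> G1" "G1 \<subseteq> G \<inter> BX' \<inter> M"
      using rel_clopen_neighbourhood[OF Xs(1,4) U(1), of "G \<inter> BX' \<inter> M" p] Go BX' M(1,2) G(2)
      by (auto simp: openin_Int)
    have G1o: "openin X G1" using G1(1) by (simp add: rel_clopen_def)
    obtain N where N: "openin Y N" "h p \<in> N" "{y \<in> A \<inter> U. h y \<in> N} \<subseteq> G1"
      using emb_onD2[OF h(1) pA G1o G1(2)] by meson
    obtain H2 where H2: "rel_clopen Y V H2" "q \<in> H2" "H2 \<subseteq> H1 \<inter> N"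
      using rel_clopen_neighbourhood[OF Ys(1,4) V, of "H1 \<inter> N" q] H1 H1o N(1,2)
      by (auto simp: openin_Int q_def rel_clopen_def)
    \<comment> \<open>\<open>G2\<close> extends the trace \<open>F1\<close> of \<open>H2\<close> on \<open>A\<close> to a relatively clopen set\<close>
    have cl: "openin X (U - {x\<in>A \<inter> U. h x \<notin> K})" if K: "openin Y K" for K
    proof (subst openin_subopen, rule ballI)
      fix x assume x: "x \<in> U - {x\<in>A \<inter> U. h x \<notin> K}"
      show "\<exists>T. openin X T \<and> x \<in> T \<and> T \<subseteq> U - {x\<in>A \<inter> U. h x \<notin> K}"
      proof (cases "x \<in> A")
        case True
        then have "x \<in> A \<inter> U" "h x \<in> K" using x by auto
        then obtain M where M: "openin X M" "x \<in> M" "h ` (M \<inter> (A \<inter> U)) \<subseteq> K"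
          using emb_onD1[OF h(1) _ K] by meson
        have "y \<in> U - {x\<in>A \<inter> U. h x \<notin> K}" if "y \<in> M \<inter> U" for y using that M(3) by (auto simp: image_subset_iff)
        then have "M \<inter> U \<subseteq> U - {x\<in>A \<inter> U. h x \<notin> K}" by (rule subsetI)
        with openin_Int[OF M(1) U(1)] M(2) x show ?thesis by (intro exI[of _ "M \<inter> U"]) auto
      next
        case False
        have "openin X (U - A)" by (rule openin_diff[OF U(1) A(1)])
        then show ?thesis using False x by (intro exI[of _ "U - A"]) auto
      qed
    qed
    have H2o: "openin Y H2" "openin Y (V - H2)" using H2(1) by (simp_all add: rel_clopen_def)
    define F1 where "F1 = {x\<in>A \<inter> U. h x \<notin> V - H2}"
    define F2 where "F2 = {x\<in>A \<inter> U. h x \<notin> H2}"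
    have F1: "F1 = {x\<in>A \<inter> U. h x \<in> H2}" unfolding F1_def using hV by auto
    have F12: "F1 \<inter> F2 = {}" "F1 \<subseteq> U" unfolding F1 F2_def by auto
    have F12o: "openin X (U - F1)" "openin X (U - F2)" unfolding F1_def F2_def
      by (rule cl[OF H2o(2)], rule cl[OF H2o(1)])
    obtain G2 where G2: "rel_clopen X U G2" "F1 \<subseteq> G2" "G2 \<inter> F2 = {}"
      using rel_clopen_separation[OF X F12o F12] by meson
    have "F1 \<subseteq> G1" using H2(3) N(3) unfolding F1 by auto
    have "(G2 \<inter> G1, H2) \<in> \<L>"
    proof -
      have "p \<in> F1" using pA H2(2) unfolding F1 by (simp add: q_def)
      then have "p \<in> G2 \<inter> G1" using G2(2) G1(2) by auto
      moreover have "x \<in> G2 \<inter> G1 \<longleftrightarrow> h x \<in> H2" if "x \<in> A \<inter> U" for x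
      proof
        assume "x \<in> G2 \<inter> G1"
        then have "x \<notin> F2" using G2(3) by auto
        with that show "h x \<in> H2" by (auto simp: F2_def)
      next
        assume "h x \<in> H2"
        then have "x \<in> F1" using that by (auto simp: F1)
        then show "x \<in> G2 \<inter> G1" using G2(2) \<open>F1 \<subseteq> G1\<close> by auto
      qed
      ultimately show ?thesis using rel_clopen_Int[OF G2(1) G1(1)] H2(1,2) by (simp add: \<L>_def)
    qed
    moreover have "(G2 \<inter> G1, H2) \<le> Z" using G1(3) H2(3) H1(3) by (auto simp: GH less_eq_prod_def)
    moreover have "\<Psi> \<alpha> Z (G2 \<inter> G1, H2)"
    proof -
      have "C \<subseteq> H - H2" using C(2) H2(3) H1(3) by auto
      then have "Rich (H - H2)" using mono[OF C(3)] by simp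
      then show ?thesis using G1(3) H1(3) H2(3) by (auto simp: \<Psi>_def GH BX'_def BY'_def)
    qed
    ultimately show ?thesis by (intro bexI conjI)
  qed
  have "\<exists>L. \<forall>\<alpha>\<in>?W. L \<alpha> \<in> \<L> \<and> L \<alpha> \<le> inf (U, V) (INF \<beta>\<in>underS \<omega>\<^sub>1 \<alpha>. L \<beta>) \<and>
      \<Psi> \<alpha> (inf (U, V) (INF \<beta>\<in>underS \<omega>\<^sub>1 \<alpha>. L \<beta>)) (L \<alpha>)"
    by (rule omega1_recursion) (rule top, rule inf, assumption+, rule step, assumption+)
  then obtain L where L0: "\<forall>\<alpha>\<in>?W. L \<alpha> \<in> \<L> \<and> L \<alpha> \<le> inf (U, V) (INF \<beta>\<in>underS \<omega>\<^sub>1 \<alpha>. L \<beta>) \<and>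
      \<Psi> \<alpha> (inf (U, V) (INF \<beta>\<in>underS \<omega>\<^sub>1 \<alpha>. L \<beta>)) (L \<alpha>)"
    by (elim exE)
  note L = conjunct1[OF bspec[OF L0]] conjunct1[OF conjunct2[OF bspec[OF L0]]]
    conjunct2[OF conjunct2[OF bspec[OF L0]]]
  define G where "G \<alpha> = fst (L \<alpha>)" for \<alpha>
  define H where "H \<alpha> = snd (L \<alpha>)" for \<alpha>
  define P where "P \<alpha> = U \<inter> (\<Inter>\<beta>\<in>underS \<omega>\<^sub>1 \<alpha>. G \<beta>) - G \<alpha>" for \<alpha>
  define Q where "Q \<alpha> = V \<inter> (\<Inter>\<beta>\<in>underS \<omega>\<^sub>1 \<alpha>. H \<beta>) - H \<alpha>" for \<alpha>
  have pre: "fst (inf (U, V) (INF \<beta>\<in>underS \<omega>\<^sub>1 \<alpha>. L \<beta>)) = U \<inter> (\<Inter>\<beta>\<in>underS \<omega>\<^sub>1 \<alpha>. G \<beta>)"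
    "snd (inf (U, V) (INF \<beta>\<in>underS \<omega>\<^sub>1 \<alpha>. L \<beta>)) = V \<inter> (\<Inter>\<beta>\<in>underS \<omega>\<^sub>1 \<alpha>. H \<beta>)" for \<alpha>
    by (simp_all add: G_def H_def inf_prod_def Inf_prod_def image_image)
  have Lf: "rel_clopen X U (G \<alpha>)" "p \<in> G \<alpha>" "rel_clopen Y V (H \<alpha>)" "q \<in> H \<alpha>"
      "\<forall>x\<in>A \<inter> U. x \<in> G \<alpha> \<longleftrightarrow> h x \<in> H \<alpha>" if "\<alpha> \<in> ?W" for \<alpha>
    using L(1)[OF that] by (auto simp: \<L>_def G_def H_def split: prod.splits)
  have dec: "G \<alpha> \<subseteq> U \<inter> (\<Inter>\<beta>\<in>underS \<omega>\<^sub>1 \<alpha>. G \<beta>)" "H \<alpha> \<subseteq> V \<inter> (\<Inter>\<beta>\<in>underS \<omega>\<^sub>1 \<alpha>. H \<beta>)" if "\<alpha> \<in> ?W" for \<alpha>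
    using L(2)[OF that] unfolding less_eq_prod_def pre by (simp_all add: G_def H_def)
  have \<Psi>: "eX \<alpha> \<in> \<B>X \<Longrightarrow> p \<in> eX \<alpha> \<Longrightarrow> G \<alpha> \<subseteq> eX \<alpha>" "eY \<alpha> \<in> \<B>Y \<Longrightarrow> q \<in> eY \<alpha> \<Longrightarrow> H \<alpha> \<subseteq> eY \<alpha>"
      "Rich (Q \<alpha>)" if "\<alpha> \<in> ?W" for \<alpha>
    using L(3)[OF that] unfolding \<Psi>_def pre by (simp_all add: G_def H_def Q_def)
  have smallX: "\<exists>\<alpha>\<in>?W. G \<alpha> \<subseteq> N" if N: "openin X N" "p \<in> N" for N
  proof -
    obtain \<alpha> where "\<alpha> \<in> ?W" "eX \<alpha> \<in> \<B>X" "p \<in> eX \<alpha>" "eX \<alpha> \<subseteq> N" using BX(2)[OF N] by meson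
    with \<Psi>(1) show ?thesis by (intro bexI[of _ \<alpha>]) auto
  qed
  have smallY: "\<exists>\<alpha>\<in>?W. H \<alpha> \<subseteq> N" if N: "openin Y N" "q \<in> N" for N
  proof -
    obtain \<alpha> where "\<alpha> \<in> ?W" "eY \<alpha> \<in> \<B>Y" "q \<in> eY \<alpha>" "eY \<alpha> \<subseteq> N" using BY(2)[OF N] by meson
    with \<Psi>(2) show ?thesis by (intro bexI[of _ \<alpha>]) auto
  qed
  have decX: "G \<alpha> \<subseteq> G \<beta>" if "\<alpha> \<in> ?W" "\<beta> \<in> underS \<omega>\<^sub>1 \<alpha>" for \<alpha> \<beta> using dec(1)[OF that(1)] that(2) by auto
  have decY: "H \<alpha> \<subseteq> H \<beta>" if "\<alpha> \<in> ?W" "\<beta> \<in> underS \<omega>\<^sub>1 \<alpha>" for \<alpha> \<beta> using dec(2)[OF that(1)] that(2) by auto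
  have "converging_layers X p U ?W P" "U = insert p (\<Union>\<alpha>\<in>?W. P \<alpha>)"
    using converging_layers_of_filtration[OF X U(1) conjI[OF Lf(1,2)] decX smallX P_def] by simp_all
  moreover have "converging_layers Y (h p) V ?W Q"
    using converging_layers_of_filtration(1)[OF Y V conjI[OF Lf(3,4)] decY smallY Q_def] by (simp add: q_def)
  moreover have "h ` (A \<inter> P \<alpha>) \<subseteq> Q \<alpha>" if "\<alpha> \<in> ?W" for \<alpha>
  proof (rule image_subsetI)
    fix x assume x: "x \<in> A \<inter> P \<alpha>"
    then have xU: "x \<in> A \<inter> U" by (auto simp: P_def)
    have "h x \<in> H \<beta>" if \<beta>: "\<beta> \<in> underS \<omega>\<^sub>1 \<alpha>" for \<beta>
    proof -
      have "\<beta> \<in> ?W" using underS_in_Field[OF \<beta>] by simp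
      moreover have "x \<in> G \<beta>" using x \<beta> by (auto simp: P_def)
      ultimately show ?thesis using Lf(5) xU by blast
    qed
    moreover have "h x \<notin> H \<alpha>" using Lf(5)[OF that] xU x by (auto simp: P_def)
    ultimately show "h x \<in> Q \<alpha>" using hV[OF xU] by (auto simp: Q_def)
  qed
  ultimately show ?thesis using \<Psi>(3) by (intro exI[of _ P] exI[of _ Q]) simp
qed

section \<open>Spaces of small rank embed everywhere\<close>

lemma cb_step_infinite:
  assumes Y: "small_P Y" and x: "x \<in> cb_step Y S" and W: "openin Y W" "x \<in> W"
  shows "infinite (W \<inter> S - {x})"
proof
  assume "finite (W \<inter> S - {x})"
  then have "countable (W \<inter> S - {x})" by (rule countable_finite)
  from P_space_openin_diff_countable[OF small_PD(4,2)[OF Y] this W(1)]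
  have "openin Y (W - (W \<inter> S - {x}))" .
  moreover have "x \<in> W - (W \<inter> S - {x})" using W(2) by simp
  ultimately obtain y where "y \<in> S \<inter> (W - (W \<inter> S - {x}))" "y \<noteq> x"
    using x unfolding mem_cb_step_iff by meson
  then show False by auto
qed

text \<open>
  These are the layers around \<open>v\<close>, obtained from the matching of \<open>v\<close> with itself.
\<close>

lemma cb_step_spread:
  assumes Y: "small_P Y" and V: "openin Y V" "v \<in> V" and v: "v \<in> cb_step Y D"
  shows "\<exists>V'. disjoint_family_on V' (Field \<omega>\<^sub>1) \<and>
    (\<forall>\<alpha>\<in>Field \<omega>\<^sub>1. openin Y (V' \<alpha>) \<and> V' \<alpha> \<subseteq> V \<and> V' \<alpha> \<inter> D \<noteq> {})"
proof -
  have vY: "v \<in> topspace Y" using v by (simp add: mem_cb_step_iff)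
  have rich: "\<exists>C. countable C \<and> C \<subseteq> W - {v} \<and> C \<inter> D \<noteq> {}" if "openin Y W" "v \<in> W" for W
  proof -
    obtain y where "y \<in> W \<inter> D - {v}"
      using cb_step_infinite[OF Y v \<open>openin Y W\<close> \<open>v \<in> W\<close>] by (metis finite.emptyI ex_in_conv)
    then show ?thesis by (intro exI[of _ "{y}"]) auto
  qed
  have "\<exists>P Q. converging_layers Y v V (Field \<omega>\<^sub>1) P \<and> V = insert v (\<Union>\<alpha>\<in>Field \<omega>\<^sub>1. P \<alpha>) \<and>
    converging_layers Y ((\<lambda>_. v) v) V (Field \<omega>\<^sub>1) Q \<and>
    (\<forall>\<alpha>\<in>Field \<omega>\<^sub>1. Q \<alpha> \<inter> D \<noteq> {} \<and> (\<lambda>_. v) ` ({v} \<inter> P \<alpha>) \<subseteq> Q \<alpha>)"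
  proof (rule matching_layers[OF Y Y V V(1)])
    show "closedin Y {v}" using small_PD(2)[OF Y] vY by (rule closedin_t1_singleton)
    show "emb_on Y ({v} \<inter> V) Y (\<lambda>_. v)" using emb_on_singleton[OF vY vY] by (rule emb_on_mono) simp
  qed (use V rich in auto)
  then obtain Q where Q: "converging_layers Y v V (Field \<omega>\<^sub>1) Q" "\<forall>\<alpha>\<in>Field \<omega>\<^sub>1. Q \<alpha> \<inter> D \<noteq> {}" by auto
  have "disjoint_family_on Q (Field \<omega>\<^sub>1)" "\<forall>\<alpha>\<in>Field \<omega>\<^sub>1. openin Y (Q \<alpha>) \<and> Q \<alpha> \<subseteq> V - {v}"
    using Q(1) unfolding converging_layers_def by simp_all
  with Q(2) show ?thesis by (intro exI[of _ Q]) auto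
qed

lemma injective_choice:
  assumes I: "countable I" and A: "\<And>i. i \<in> I \<Longrightarrow> infinite (A i)"
  shows "\<exists>v. inj_on v I \<and> (\<forall>i\<in>I. v i \<in> A i)"
proof -
  define P where "P f n r \<longleftrightarrow> (from_nat_into I n \<in> I \<longrightarrow> r \<in> A (from_nat_into I n) - f ` {..<n})"
    for f and n :: nat and r
  have "\<exists>w. \<forall>n. P w n (w n)"
  proof (rule dependent_wellorder_choice)
    show "P f n r = P g n r" if "\<And>m. m < n \<Longrightarrow> f m = g m" for r f g n
    proof -
      have "f ` {..<n} = g ` {..<n}" using that by (intro image_cong) auto
      then show ?thesis by (simp add: P_def)
    qed
    show "\<exists>r. P f n r" for n f
    proof (cases "from_nat_into I n \<in> I")
      case True
      then have "infinite (A (from_nat_into I n) - f ` {..<n})" using A by (intro Diff_infinite_finite) auto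
      then obtain r where "r \<in> A (from_nat_into I n) - f ` {..<n}" by (metis finite.emptyI ex_in_conv)
      then show ?thesis by (auto simp: P_def)
    qed (simp add: P_def)
  qed
  then obtain w where w: "\<And>n. P w n (w n)" by blast
  define v where "v i = w (to_nat_on I i)" for i
  have "v i \<in> A i" "v i \<notin> w ` {..<to_nat_on I i}" if "i \<in> I" for i
    using w[of "to_nat_on I i"] that I by (simp_all add: P_def v_def)
  note v = this
  have "inj_on v I"
  proof (rule inj_onI, rule ccontr)
    fix i j assume ij: "i \<in> I" "j \<in> I" "v i = v j" "i \<noteq> j"
    then have "to_nat_on I i \<noteq> to_nat_on I j" using I by (simp add: inj_on_eq_iff[OF inj_on_to_nat_on])
    then consider "to_nat_on I i < to_nat_on I j" | "to_nat_on I j < to_nat_on I i" by linarith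
    then show False
    proof cases
      case 1
      then have "v i \<in> w ` {..<to_nat_on I j}" by (auto simp: v_def)
      with v(2)[OF ij(2)] ij(3) show False by simp
    next
      case 2
      then have "v j \<in> w ` {..<to_nat_on I i}" by (auto simp: v_def)
      with v(2)[OF ij(1)] ij(3) show False by simp
    qed
  qed
  with v(1) show ?thesis by blast
qed

lemma disjoint_neighbourhoods:
  assumes Y: "small_P Y" and I: "countable I" and v: "inj_on v I" "v ` I \<subseteq> V" and V: "openin Y V"
  shows "\<exists>N. disjoint_family_on N I \<and> (\<forall>i\<in>I. openin Y (N i) \<and> N i \<subseteq> V \<and> v i \<in> N i)"
proof -
  define Ob where "Ob i = V - (v ` I - {v i})" for i
  have O: "openin Y (Ob i)" for i
    unfolding Ob_def using I V by (intro P_space_openin_diff_countable[OF small_PD(4,2)[OF Y]]) auto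
  obtain \<V> where \<V>: "\<And>K. K \<in> \<V> \<Longrightarrow> openin Y K" "\<And>K. K \<in> \<V> \<Longrightarrow> \<exists>U\<in>Ob ` I. K \<subseteq> U"
    "disjoint \<V>" "\<Union>\<V> = \<Union>(Ob ` I)"
    by (rule disjoint_open_refinement[OF Y, of "Ob ` I"]) (use O in auto)
  have "\<exists>K\<in>\<V>. v i \<in> K" if "i \<in> I" for i
  proof -
    have "v i \<in> Ob i" using that v(2) by (auto simp: Ob_def)
    then have "v i \<in> \<Union>\<V>" unfolding \<V>(4) using that by auto
    then show ?thesis by auto
  qed
  then obtain N where N: "\<And>i. i \<in> I \<Longrightarrow> N i \<in> \<V>" "\<And>i. i \<in> I \<Longrightarrow> v i \<in> N i" by metis
  have N_sub: "\<exists>j\<in>I. N i \<subseteq> Ob j" if "i \<in> I" for i using \<V>(2)[OF N(1)[OF that]] by simp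
  have "N i \<inter> N j = {}" if "i \<in> I" "j \<in> I" "i \<noteq> j" for i j
  proof (rule ccontr)
    assume "N i \<inter> N j \<noteq> {}"
    then have eq: "N i = N j" using \<V>(3) N(1) that(1,2) unfolding disjoint_def by metis
    obtain k where k: "k \<in> I" "N i \<subseteq> Ob k" using N_sub[OF \<open>i \<in> I\<close>] by auto
    have "v i \<in> Ob k" "v j \<in> Ob k" using k(2) N(2)[OF that(1)] N(2)[OF that(2)] eq by auto
    then have "v i = v k" "v j = v k" using that by (auto simp: Ob_def)
    then have "v i = v j" by simp
    then show False using inj_onD[OF v(1) _ that(1,2)] that(3) by simp
  qed
  then have "disjoint_family_on N I" by (simp add: disjoint_family_on_def)
  moreover have "N i \<subseteq> V" if "i \<in> I" for i using N_sub[OF that] by (auto simp: Ob_def)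
  ultimately show ?thesis using \<V>(1)[OF N(1)] N(2) by (intro exI[of _ N]) simp
qed

text \<open>
  For \<open>b \<in> I\<close> let \<open>U' b\<close> be the union of the pieces of a disjoint refinement that are assigned to
  \<open>b\<close>. As \<open>I\<close> is countable and each \<open>V \<inter> D b\<close> is infinite, one can choose distinct points of these
  sets and disjoint neighbourhoods of them; the \<open>U' b\<close> go there.
\<close>

lemma embeds_in_of_countable_cover:
  assumes X: "small_P X" and Y: "small_P Y" and I: "countable I"
    and E: "\<And>b. b \<in> I \<Longrightarrow> closedin X (E b)"
    and S: "\<And>b U V. b \<in> I \<Longrightarrow> openin X U \<Longrightarrow> U \<inter> E b = {} \<Longrightarrow> openin Y V \<Longrightarrow> V \<inter> D b \<noteq> {} \<Longrightarrow>
      embeds_in X U Y V"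
    and U: "openin X U" "\<And>x. x \<in> U \<Longrightarrow> \<exists>b\<in>I. x \<notin> E b"
    and V: "openin Y V" "\<And>b. b \<in> I \<Longrightarrow> infinite (V \<inter> D b)"
  shows "embeds_in X U Y V"
proof -
  have op: "openin X (U - E b)" if "b \<in> I" for b using U(1) E[OF that] by (rule openin_diff)
  obtain \<V> where \<V>: "\<And>K. K \<in> \<V> \<Longrightarrow> openin X K" "\<And>K. K \<in> \<V> \<Longrightarrow> \<exists>T\<in>(\<lambda>b. U - E b) ` I. K \<subseteq> T"
    "disjoint \<V>" "\<Union>\<V> = (\<Union>b\<in>I. U - E b)"
    by (rule disjoint_open_refinement[OF X, of "(\<lambda>b. U - E b) ` I"]) (use op in auto)
  have "\<exists>b. b \<in> I \<and> K \<subseteq> U - E b" if "K \<in> \<V>" for K using \<V>(2)[OF that] by auto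
  then obtain \<beta> where \<beta>: "\<And>K. K \<in> \<V> \<Longrightarrow> \<beta> K \<in> I" "\<And>K. K \<in> \<V> \<Longrightarrow> K \<subseteq> U - E (\<beta> K)" by metis
  define U' where "U' b = \<Union>{K\<in>\<V>. \<beta> K = b}" for b
  have U'o: "openin X (U' b)" for b unfolding U'_def using \<V>(1) by (intro openin_Union) auto
  have "K \<inter> L = {}" if "K \<in> \<V>" "L \<in> \<V>" "\<beta> K \<noteq> \<beta> L" for K L
    using \<V>(3) that unfolding disjoint_def by metis
  then have U'd: "disjoint_family_on U' I" unfolding disjoint_family_on_def U'_def by blast
  have "(\<Union>b\<in>I. U' b) = \<Union>\<V>" unfolding U'_def using \<beta>(1) by blast
  also have "\<dots> = U" unfolding \<V>(4) using U(2) by blast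
  finally have cover: "(\<Union>b\<in>I. U' b) = U" .
  have "\<exists>v. inj_on v I \<and> (\<forall>b\<in>I. v b \<in> V \<inter> D b)" by (rule injective_choice[OF I V(2)])
  then obtain v where v: "inj_on v I" "\<And>b. b \<in> I \<Longrightarrow> v b \<in> V \<inter> D b" by meson
  have "v ` I \<subseteq> V" using v(2) by auto
  from disjoint_neighbourhoods[OF Y I v(1) this V(1)]
  obtain N where N: "disjoint_family_on N I" "\<forall>b\<in>I. openin Y (N b) \<and> N b \<subseteq> V \<and> v b \<in> N b" by meson
  have "embeds_in X (\<Union>b\<in>I. U' b) Y (\<Union>b\<in>I. N b)"
  proof (rule embeds_in_UNION)
    show "embeds_in X (U' b) Y (N b)" if b: "b \<in> I" for b
    proof (rule S[OF b U'o])
      show "U' b \<inter> E b = {}" unfolding U'_def using \<beta>(2) by auto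
      show "openin Y (N b)" using N(2) b by simp
      show "N b \<inter> D b \<noteq> {}" using N(2) b v(2)[OF b] by auto
    qed
  qed (use U'o U'd N in auto)
  then show ?thesis by (rule embeds_in_mono) (use cover N(2) in auto)
qed

lemma limit_ordinal_above:
  assumes "limit_ordinal l" "b \<in> Field l" obtains c where "b \<in> underS l c" "c \<in> Field l"
proof -
  have wr: "wo_rel l" using assms by (simp add: limit_ordinal_def wo_rel_def)
  obtain i where i: "i \<in> Field l" "(i, b) \<notin> l" using assms unfolding limit_ordinal_def by metis
  then have "b \<in> underS l i" using wo_rel.TOTALS[OF wr] assms(2) by (auto simp: underS_def)
  with i show thesis by (intro that)
qed

text \<open>
  The function is \<open>f (\<mu> + n) = \<mu> + 2n + 1\<close> for \<open>\<mu>\<close> zero or a limit; \<open>c\<close> is the predecessor of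
  \<open>f b\<close>. The gap of two between the bound for \<open>b' < b\<close> and \<open>f b\<close> pays for the two steps in
  \<open>embeds_in_of_lower_rank\<close>.
\<close>

lemma limit_ordinal_slow_lift:
  fixes l :: "'l rel"
  assumes l: "limit_ordinal l"
  shows "\<exists>f. \<forall>b\<in>Field l. \<exists>c\<in>underS l (f b). \<forall>b'\<in>underS l b. f b' \<in> underS l c"
proof -
  let ?F = "Field l"
  have wo: "Well_order l" and wr: "wo_rel l" using l by (simp_all add: limit_ordinal_def wo_rel_def)
  have irr: "b \<notin> underS l b" for b by (rule underS_irrefl)
  note tr = underS_trans[OF wo]
  have "\<exists>c. b \<in> underS l c \<and> (\<forall>y. b \<in> underS l y \<longrightarrow> y \<notin> underS l c)" if b: "b \<in> ?F" for b
  proof -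
    obtain i where "b \<in> underS l i" by (rule limit_ordinal_above[OF l b])
    then have ne: "{y. b \<in> underS l y} \<noteq> {}" by auto
    have sub: "{y. b \<in> underS l y} \<subseteq> ?F" using underS_in_Field by fastforce
    obtain c where "c \<in> {y. b \<in> underS l y}" "\<And>y. y \<in> {y. b \<in> underS l y} \<Longrightarrow> y \<notin> underS l c"
      using Well_order_least[OF wo sub ne] by metis
    then show ?thesis by auto
  qed
  then obtain s where s: "\<And>b. b \<in> ?F \<Longrightarrow> b \<in> underS l (s b)"
    "\<And>b y. b \<in> ?F \<Longrightarrow> b \<in> underS l y \<Longrightarrow> y \<notin> underS l (s b)" by metis
  have sF: "s b \<in> ?F" if "b \<in> ?F" for b using underS_in_Field[OF s(1)[OF that]] by simp
  have s_le: "y = s b \<or> s b \<in> underS l y" if "b \<in> underS l y" for b y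
    using Well_order_linear[OF wo, of y "s b"] underS_in_Field[OF that] s(2) that sF by auto
  have s_below: "b' = b \<or> b' \<in> underS l b" if "b' \<in> underS l (s b)" "b \<in> ?F" for b b'
    using Well_order_linear[OF wo, of b' b] underS_in_Field[OF that(1)] s(2)[OF that(2)] that by auto
  have s_inj: "inj_on s ?F"
  proof (rule inj_onI, rule ccontr)
    fix x y assume xy: "x \<in> ?F" "y \<in> ?F" "s x = s y" "x \<noteq> y"
    then have "x \<in> underS l y \<or> y \<in> underS l x" using Well_order_linear[OF wo] by blast
    then show False
      using s_below[of x y] s_below[of y x] s(1) s(2) xy by metis
  qed
  \<comment> \<open>this is \<open>f (s x) = s (s (f x))\<close>, and \<open>f b = s b\<close> if \<open>b\<close> is no successor\<close>
  define H where "H g b = (if b \<in> s ` ?F then s (s (g (inv_into ?F s b))) else s b)" for g b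
  have "H g b = H g' b" if "\<forall>x\<in>underS l b. g x = g' x" for g g' b
    using that s(1) s_inj by (auto simp: H_def inv_into_f_f)
  then have "wo_rel.adm_wo l H" unfolding wo_rel.adm_wo_def[OF wr] by blast
  note fix_eq = wo_rel.worec_fixpoint[OF wr this]
  define f where "f = wo_rel.worec l H"
  have f: "f b = H f b" for b unfolding f_def using fix_eq by metis
  have f_succ: "f (s b) = s (s (f b))" if "b \<in> ?F" for b
    unfolding f[of "s b"] using that s_inj by (simp add: H_def inv_into_f_f)
  have f_other: "f b = s b" if "b \<notin> s ` ?F" for b unfolding f[of b] using that by (simp add: H_def)
  have below_limit: "f b \<in> underS l y" if y: "y \<notin> s ` ?F" and b: "b \<in> underS l y" for b y
  proof -
    have "b \<in> ?F" using underS_in_Field[OF b] by simp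
    have up: "s x \<in> underS l y" if "x \<in> underS l y" for x
      using s_le[OF that] y underS_in_Field[OF that] by auto
    from wo \<open>b \<in> ?F\<close> have "b \<in> underS l y \<longrightarrow> f b \<in> underS l y"
    proof (induction rule: Well_order_induct)
      case (less b)
      show ?case
      proof
        assume by': "b \<in> underS l y"
        show "f b \<in> underS l y"
        proof (cases "b \<in> s ` ?F")
          case True
          then obtain b0 where b0: "b0 \<in> ?F" "b = s b0" by auto
          have "b0 \<in> underS l b" using s(1)[OF b0(1)] b0(2) by simp
          then have "f b0 \<in> underS l y" using less.IH tr by' by blast
          then show ?thesis unfolding b0(2) f_succ[OF b0(1)] by (intro up)
        next
          case False
          show ?thesis unfolding f_other[OF False] by (rule up[OF by'])
        qed
      qed
    qed
    with b show ?thesis by simp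
  qed
  have "b \<in> ?F \<Longrightarrow> f b \<in> ?F \<and> (\<exists>c\<in>underS l (f b). \<forall>b'\<in>underS l b. f b' \<in> underS l c)" for b
  proof -
    assume "b \<in> ?F"
    with wo show ?thesis
    proof (induction rule: Well_order_induct)
      case (less b)
      show ?case
      proof (cases "b \<in> s ` ?F")
        case True
        then obtain b0 where b0: "b0 \<in> ?F" "b = s b0" by auto
        have "b0 \<in> underS l b" using s(1)[OF b0(1)] b0(2) by simp
        from less.IH[OF this] obtain c where fF: "f b0 \<in> ?F" and
          c: "c \<in> underS l (f b0)" "\<And>b'. b' \<in> underS l b0 \<Longrightarrow> f b' \<in> underS l c" by auto
        have fb: "f b = s (s (f b0))" unfolding b0(2) by (rule f_succ[OF b0(1)])
        have s1: "f b0 \<in> underS l (s (f b0))" by (rule s(1)[OF fF])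
        have s2: "s (f b0) \<in> underS l (f b)" unfolding fb by (rule s(1)[OF sF[OF fF]])
        have "f b' \<in> underS l (s (f b0))" if b': "b' \<in> underS l b" for b'
        proof (cases "b' = b0")
          case True
          then show ?thesis using s1 by simp
        next
          case False
          then have "b' \<in> underS l b0" using s_below[of b' b0] b' b0 by auto
          from tr[OF tr[OF c(2)[OF this] c(1)] s1] show ?thesis .
        qed
        then show ?thesis using s2 underS_in_Field[OF s2] by blast
      next
        case False
        have "b \<in> underS l (f b)" unfolding f_other[OF False] by (rule s(1)[OF less.hyps])
        moreover have "f b' \<in> underS l b" if "b' \<in> underS l b" for b'
          by (rule below_limit[OF False that])
        ultimately show ?thesis using underS_in_Field by fast
      qed
    qed
  qed
  then show ?thesis by blast
qed

text \<open>
  Induction on \<open>b\<close>. A disjoint refinement cuts \<open>U\<close> into at most \<open>\<omega>\<^sub>1\<close> pieces with at most one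
  point of rank \<open>b\<close> each. Descending from \<open>f b\<close> to \<open>c\<close> gives \<open>\<omega>\<^sub>1\<close> disjoint open subsets of \<open>V\<close>, each
  with a point \<open>q\<close> in level \<open>c\<close>. Descending from \<open>c\<close> to the \<open>f b'\<close> gives layers around \<open>q\<close> that
  receive the layers around the one point of rank \<open>b\<close> of a piece.
\<close>

lemma embeds_in_of_lower_rank:
  assumes X: "small_P X" and Y: "small_P Y" and wo: "Well_order l" and count: "countable (Field l)"
    and f: "\<forall>b\<in>Field l. \<exists>c\<in>underS l (f b). \<forall>b'\<in>underS l b. f b' \<in> underS l c"
    and b: "b \<in> Field l"
    and U: "openin X U" "U \<inter> cb_step X (cb_level X l b) = {}"
    and V: "openin Y V" "V \<inter> cb_level Y l (f b) \<noteq> {}"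
  shows "embeds_in X U Y V"
  using wo b U V
proof (induction arbitrary: U V rule: Well_order_induct)
  case (less b)
  let ?W = "Field \<omega>\<^sub>1"
  note Xs = small_PD[OF X] and Ys = small_PD[OF Y]
  define I where "I = underS l b"
  have "I \<subseteq> Field l" unfolding I_def using underS_in_Field by fast
  then have I: "countable I" using count countable_subset by blast
  define L where "L = cb_level X l b"
  define E where "E b' = cb_step X (cb_level X l b')" for b'
  define D where "D b' = cb_level Y l (f b')" for b'
  have E: "closedin X (E b')" for b' unfolding E_def by (intro closedin_cb_step closedin_cb_level wo)
  have L: "closedin X L" unfolding L_def by (intro closedin_cb_level wo)
  have Leq: "L = topspace X \<inter> (\<Inter>b'\<in>I. E b')"
    unfolding L_def E_def I_def by (rule cb_level_rec[OF wo])
  \<comment> \<open>the induction hypothesis, combined over all smaller ranks\<close>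
  have lower: "embeds_in X U' Y V'" if U': "openin X U'" "U' \<inter> L = {}"
      and V': "openin Y V'" "\<And>b'. b' \<in> I \<Longrightarrow> infinite (V' \<inter> D b')" for U' V'
  proof (rule embeds_in_of_countable_cover[OF X Y I, of E D])
    show "embeds_in X U Y V" if "b' \<in> I" "openin X U" "U \<inter> E b' = {}" "openin Y V" "V \<inter> D b' \<noteq> {}"
      for b' U V using less.IH[of b' U V] that by (simp add: I_def E_def D_def)
    show "\<exists>b'\<in>I. x \<notin> E b'" if "x \<in> U'" for x
      using that U'(2) openin_subset[OF U'(1)] unfolding Leq by auto
  qed (use E U' V' in simp_all)
  obtain c where c: "c \<in> underS l (f b)" "\<And>b'. b' \<in> I \<Longrightarrow> f b' \<in> underS l c"
    using f less.hyps unfolding I_def by meson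
  have many: "infinite (N \<inter> D b' - {q})" if "openin Y N" "q \<in> N" "q \<in> cb_level Y l c" "b' \<in> I" for N q b'
  proof (rule cb_step_infinite[OF Y _ that(1,2)])
    show "q \<in> cb_step Y (D b')"
      using cb_level_subset_step[OF wo c(2)[OF that(4)], of Y] that(3) unfolding D_def by auto
  qed
  obtain v where v: "v \<in> V" "v \<in> cb_level Y l (f b)" using less.prems(4) by auto
  then have "v \<in> cb_step Y (cb_level Y l c)" using cb_level_subset_step[OF wo c(1), of Y] by auto
  from cb_step_spread[OF Y less.prems(3) v(1) this]
  obtain V' where V'd: "disjoint_family_on V' ?W"
    and V': "\<And>\<alpha>. \<alpha> \<in> ?W \<Longrightarrow> openin Y (V' \<alpha>)" "\<And>\<alpha>. \<alpha> \<in> ?W \<Longrightarrow> V' \<alpha> \<subseteq> V"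
      "\<And>\<alpha>. \<alpha> \<in> ?W \<Longrightarrow> V' \<alpha> \<inter> cb_level Y l c \<noteq> {}" by meson
  define \<O> where "\<O> = {N. openin X N \<and> N \<subseteq> U \<and> (\<exists>x. N \<inter> L \<subseteq> {x})}"
  have cover: "\<exists>N\<in>\<O>. x \<in> N" if x: "x \<in> U" for x
  proof (cases "x \<in> L")
    case True
    then have "x \<notin> cb_step X L" "x \<in> topspace X"
      using less.prems(2) x openin_subset[OF less.prems(1)] unfolding L_def by auto
    then obtain T where T: "x \<in> T" "openin X T" "\<And>y. y \<in> L \<inter> T \<Longrightarrow> y = x"
      using True unfolding mem_cb_step_iff by blast
    have "T \<inter> U \<in> \<O>" using openin_Int[OF T(2) less.prems(1)] T(3) unfolding \<O>_def by blast
    with T(1) x show ?thesis by blast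
  next
    case False
    have "U - L \<in> \<O>" using openin_diff[OF less.prems(1) L] unfolding \<O>_def by auto
    with False x show ?thesis by blast
  qed
  obtain \<V> where \<V>: "\<And>K. K \<in> \<V> \<Longrightarrow> openin X K" "\<And>K. K \<in> \<V> \<Longrightarrow> K \<noteq> {}"
    "\<And>K. K \<in> \<V> \<Longrightarrow> \<exists>N\<in>\<O>. K \<subseteq> N" "disjoint \<V>" "\<Union>\<V> = \<Union>\<O>"
    by (rule disjoint_open_refinement[OF X, of \<O>]) (auto simp: \<O>_def)
  have \<V>U: "\<Union>\<V> = U" unfolding \<V>(5) using cover by (auto simp: \<O>_def)
  \<comment> \<open>the pieces are nonempty and disjoint, and the space has at most that many points\<close>
  have "|\<V>| \<le>o \<omega>\<^sub>1"
  proof -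
    obtain pt where pt: "\<And>K. K \<in> \<V> \<Longrightarrow> pt K \<in> K" using \<V>(2) by (metis ex_in_conv)
    have "inj_on pt \<V>"
    proof (rule inj_onI, rule ccontr)
      fix K K' assume K: "K \<in> \<V>" "K' \<in> \<V>" "pt K = pt K'" "K \<noteq> K'"
      then have "K \<inter> K' = {}" using \<V>(4) unfolding disjoint_def by metis
      with pt[OF K(1)] pt[OF K(2)] K(3) show False by auto
    qed
    moreover have "pt ` \<V> \<subseteq> topspace X" using pt openin_subset[OF \<V>(1)] by fast
    ultimately have "|\<V>| \<le>o |topspace X|" unfolding card_of_ordLeq[symmetric] by (intro exI conjI)
    then show ?thesis using scattered_card_le_weight[OF Xs(3,5)] by (rule ordLeq_transitive)
  qed
  then obtain j where j: "inj_on j \<V>" "j ` \<V> \<subseteq> ?W" by (rule inj_into_omega1)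
  have jW: "j K \<in> ?W" if "K \<in> \<V>" for K using j(2) that by auto
  have "embeds_in X (\<Union>K\<in>\<V>. K) Y (\<Union>K\<in>\<V>. V' (j K))"
  proof (rule embeds_in_UNION)
    show "disjoint_family_on (\<lambda>K. K) \<V>" using \<V>(4) unfolding disjoint_def disjoint_family_on_def by simp
    show "disjoint_family_on (\<lambda>K. V' (j K)) \<V>"
      unfolding disjoint_family_on_def
    proof (intro ballI impI)
      fix K K' assume "K \<in> \<V>" "K' \<in> \<V>" "K \<noteq> K'"
      then show "V' (j K) \<inter> V' (j K') = {}"
        using V'd jW j(1) unfolding disjoint_family_on_def by (metis inj_onD)
    qed
    fix K assume K: "K \<in> \<V>"
    show "openin X K" by (rule \<V>(1)[OF K])
    show Vo: "openin Y (V' (j K))" by (rule V'(1)[OF jW[OF K]])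
    obtain q where q: "q \<in> V' (j K)" "q \<in> cb_level Y l c" using V'(3)[OF jW[OF K]] by auto
    have qY: "q \<in> topspace Y" using openin_subset[OF Vo] q(1) by auto
    show "embeds_in X K Y (V' (j K))"
    proof (cases "K \<inter> L = {}")
      case True
      show ?thesis
      proof (rule lower[OF \<V>(1)[OF K] True Vo])
        show "infinite (V' (j K) \<inter> D b')" if "b' \<in> I" for b'
          using many[OF Vo q that] by (metis finite_Diff)
      qed
    next
      case False
      then obtain p where p: "p \<in> K" "p \<in> L" by auto
      have pX: "p \<in> topspace X" using openin_subset[OF \<V>(1)[OF K]] p(1) by auto
      have only: "x = p" if "x \<in> K" "x \<in> L" for x
      proof -
        obtain N z where "K \<subseteq> N" "N \<inter> L \<subseteq> {z}" using \<V>(3)[OF K] unfolding \<O>_def by auto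
        then show ?thesis using that p by auto
      qed
      have rich: "\<exists>C. countable C \<and> C \<subseteq> W - {q} \<and> (\<forall>b'\<in>I. infinite (C \<inter> D b'))"
        if W: "openin Y W" "q \<in> W" for W
      proof -
        have "\<exists>C\<subseteq>W \<inter> D b' - {q}. countable C \<and> infinite C" if "b' \<in> I" for b'
          using infinite_countable_subset'[OF many[OF W q(2) that]] by auto
        then obtain C where C: "\<And>b'. b' \<in> I \<Longrightarrow> C b' \<subseteq> W \<inter> D b' - {q}"
          "\<And>b'. b' \<in> I \<Longrightarrow> countable (C b')" "\<And>b'. b' \<in> I \<Longrightarrow> infinite (C b')" by metis
        have "infinite ((\<Union>b'\<in>I. C b') \<inter> D b')" if "b' \<in> I" for b'
        proof -
          have "C b' \<subseteq> (\<Union>b'\<in>I. C b') \<inter> D b'" using C(1)[OF that] that by auto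
          then show ?thesis using C(3)[OF that] infinite_super by blast
        qed
        moreover have "(\<Union>b'\<in>I. C b') \<subseteq> W - {q}" using C(1) by auto
        moreover have "countable (\<Union>b'\<in>I. C b')" using I C(2) by auto
        ultimately show ?thesis by (intro exI[of _ "\<Union>b'\<in>I. C b'"]) simp
      qed
      have "\<exists>P Q. converging_layers X p K ?W P \<and> K = insert p (\<Union>\<alpha>\<in>?W. P \<alpha>) \<and>
        converging_layers Y ((\<lambda>_. q) p) (V' (j K)) ?W Q \<and>
        (\<forall>\<alpha>\<in>?W. (\<forall>b'\<in>I. infinite (Q \<alpha> \<inter> D b')) \<and> (\<lambda>_. q) ` ({p} \<inter> P \<alpha>) \<subseteq> Q \<alpha>)"
      proof (rule matching_layers[OF X Y \<V>(1)[OF K] p(1) Vo])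
        show "closedin X {p}" using Xs(2) pX by (rule closedin_t1_singleton)
        show "emb_on X ({p} \<inter> K) Y (\<lambda>_. q)" using emb_on_singleton[OF pX qY] by (rule emb_on_mono) simp
        show "(\<lambda>_. q) ` ({p} \<inter> K) \<subseteq> V' (j K)" using q(1) by auto
        show "\<forall>b'\<in>I. infinite (T \<inter> D b')" if "\<forall>b'\<in>I. infinite (S \<inter> D b')" "S \<subseteq> T" for S T
        proof
          fix b' assume "b' \<in> I"
          then have "infinite (S \<inter> D b')" using that(1) by simp
          moreover have "S \<inter> D b' \<subseteq> T \<inter> D b'" using that(2) by auto
          ultimately show "infinite (T \<inter> D b')" using infinite_super by blast
        qed
        show "\<exists>C. countable C \<and> C \<subseteq> W - {q} \<and> (\<forall>b'\<in>I. infinite (C \<inter> D b'))"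
          if "openin Y W" "q \<in> W" "W \<subseteq> V' (j K)" for W using rich[OF that(1,2)] .
      qed simp
      then obtain P Q where *: "converging_layers X p K ?W P \<and> K = insert p (\<Union>\<alpha>\<in>?W. P \<alpha>) \<and>
        converging_layers Y q (V' (j K)) ?W Q \<and>
        (\<forall>\<alpha>\<in>?W. (\<forall>b'\<in>I. infinite (Q \<alpha> \<inter> D b')) \<and> (\<lambda>_. q) ` ({p} \<inter> P \<alpha>) \<subseteq> Q \<alpha>)"
        by (elim exE)
      note PQ = conjunct1[OF *] conjunct1[OF conjunct2[OF *]] conjunct1[OF conjunct2[OF conjunct2[OF *]]]
      have Q_rich: "infinite (Q \<alpha> \<inter> D b')" if "\<alpha> \<in> ?W" "b' \<in> I" for \<alpha> b'
        using bspec[OF conjunct2[OF conjunct2[OF conjunct2[OF *]]] that(1)] that(2) by simp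
      have P: "openin X (P \<alpha>)" "P \<alpha> \<subseteq> K - {p}" and Q: "openin Y (Q \<alpha>)" if "\<alpha> \<in> ?W" for \<alpha>
        using PQ(1,3) that unfolding converging_layers_def by simp_all
      show ?thesis
      proof (rule embeds_in_layers[OF PQ])
        fix \<alpha> assume \<alpha>: "\<alpha> \<in> ?W"
        have "P \<alpha> \<inter> L = {}" using P(2)[OF \<alpha>] only by auto
        then show "embeds_in X (P \<alpha>) Y (Q \<alpha>)"
          using Q_rich[OF \<alpha>] by (intro lower[OF P(1)[OF \<alpha>] _ Q[OF \<alpha>]])
      qed
    qed
  qed
  then show ?case
  proof (rule embeds_in_mono)
    show "U \<subseteq> (\<Union>K\<in>\<V>. K)" using \<V>U by simp
    show "(\<Union>K\<in>\<V>. V' (j K)) \<subseteq> V" using V'(2)[OF jW] by (rule UN_least)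
  qed
qed

text \<open>
  A point in a later level is an accumulation point of this one.
\<close>

lemma level_infinite:
  assumes Y: "small_P Y" and l: "limit_ordinal l" and V: "openin Y V"
    and full: "\<And>b. b \<in> Field l \<Longrightarrow> V \<inter> cb_level Y l b \<noteq> {}" and b: "b \<in> Field l"
  shows "infinite (V \<inter> cb_level Y l b)"
proof -
  have wo: "Well_order l" using l by (simp add: limit_ordinal_def)
  obtain c where c: "b \<in> underS l c" "c \<in> Field l" by (rule limit_ordinal_above[OF l b])
  obtain v where v: "v \<in> V" "v \<in> cb_level Y l c" using full[OF c(2)] by auto
  have "v \<in> cb_step Y (cb_level Y l b)" using v(2) cb_level_subset_step[OF wo c(1), of Y] by auto
  from cb_step_infinite[OF Y this V v(1)] show ?thesis by (metis finite_Diff)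
qed

lemma embeds_in_of_empty_derivative:
  assumes X: "small_P X" and Y: "small_P Y" and l: "limit_ordinal l" and count: "countable (Field l)"
    and U: "openin X U" "U \<inter> cb_derivative X l = {}"
    and V: "openin Y V" "\<And>b. b \<in> Field l \<Longrightarrow> V \<inter> cb_level Y l b \<noteq> {}"
  shows "embeds_in X U Y V"
proof -
  have wo: "Well_order l" using l by (simp add: limit_ordinal_def)
  obtain f where f: "\<forall>b\<in>Field l. \<exists>c\<in>underS l (f b). \<forall>b'\<in>underS l b. f b' \<in> underS l c"
    using limit_ordinal_slow_lift[OF l] by (elim exE)
  show ?thesis
  proof (rule embeds_in_of_countable_cover[OF X Y count,
        of "\<lambda>b. cb_step X (cb_level X l b)" "\<lambda>b. cb_level Y l (f b)"])
    show "closedin X (cb_step X (cb_level X l b))" for b by (intro closedin_cb_step closedin_cb_level wo)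
    show "embeds_in X U Y V" if "b \<in> Field l" "openin X U" "U \<inter> cb_step X (cb_level X l b) = {}"
      "openin Y V" "V \<inter> cb_level Y l (f b) \<noteq> {}" for b U V
      using embeds_in_of_lower_rank[OF X Y wo count f that] .
    show "\<exists>b\<in>Field l. x \<notin> cb_step X (cb_level X l b)" if "x \<in> U" for x
      using that U(2) openin_subset[OF U(1)] unfolding cb_derivative_def by auto
    show "infinite (V \<inter> cb_level Y l (f b))" if b: "b \<in> Field l" for b
    proof -
      obtain c where "c \<in> underS l (f b)" using f b by meson
      then have "f b \<in> Field l" using underS_in_Field by fast
      then show ?thesis by (intro level_infinite[OF Y l V])
    qed
  qed (use U V in simp_all)
qed

section \<open>Extending an embedding of the derivatives\<close>

lemma embeds_in_Un:
  assumes "openin X U1" "openin X U2" "U1 \<inter> U2 = {}" "openin Y V1" "openin Y V2" "V1 \<inter> V2 = {}"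
    and "embeds_in X U1 Y V1" "embeds_in X U2 Y V2"
  shows "embeds_in X (U1 \<union> U2) Y (V1 \<union> V2)"
proof -
  have "embeds_in X (\<Union>i\<in>{True, False}. if i then U1 else U2) Y (\<Union>i\<in>{True, False}. if i then V1 else V2)"
    using assms by (intro embeds_in_UNION) (auto simp: disjoint_family_on_def)
  then show ?thesis by (simp add: Un_commute)
qed

text \<open>
  In the part of \<open>V\<close> outside \<open>Y\<^sup>(\<^sup>\<lambda>\<^sup>)\<close> there is a point of rank exactly \<open>\<beta>\<close> for every \<open>\<beta> < \<lambda>\<close>,
  since \<open>Y\<close> is scattered. Neighbourhoods of these countably many points form a place for the pieces of
  \<open>X\<close> that miss \<open>X\<^sup>(\<^sup>\<lambda>\<^sup>)\<close>, which leaves the image of \<open>X\<^sup>(\<^sup>\<lambda>\<^sup>)\<close> untouched.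
\<close>

lemma reserved_room:
  assumes Y: "small_P Y" and wo: "Well_order l" and count: "countable (Field l)"
    and V: "openin Y V" "\<And>b. b \<in> Field l \<Longrightarrow> V \<inter> cb_level Y l b \<noteq> {}"
  shows "\<exists>V0. rel_clopen Y V V0 \<and> V0 \<inter> cb_derivative Y l = {} \<and>
    (\<forall>b\<in>Field l. V0 \<inter> cb_level Y l b \<noteq> {})"
proof -
  note Ys = small_PD[OF Y]
  let ?B = "cb_derivative Y l"
  have Bo: "openin Y (V - ?B)" by (rule openin_diff[OF V(1) closedin_cb_derivative[OF wo]])
  have "\<exists>K. rel_clopen Y V K \<and> K \<inter> ?B = {} \<and> K \<inter> cb_level Y l b \<noteq> {}" if b: "b \<in> Field l" for b
  proof -
    have "V \<inter> cb_level Y l b \<subseteq> topspace Y" using openin_subset[OF V(1)] by auto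
    then obtain x N where x: "x \<in> V \<inter> cb_level Y l b" "openin Y N" "N \<inter> (V \<inter> cb_level Y l b) = {x}"
      using Ys(3) V(2)[OF b] unfolding scattered_space_iff by meson
    \<comment> \<open>\<open>x\<close> has rank exactly \<open>b\<close>\<close>
    have "x \<notin> cb_step Y (cb_level Y l b)"
    proof
      assume "x \<in> cb_step Y (cb_level Y l b)"
      moreover have "x \<in> N \<inter> V" "openin Y (N \<inter> V)" using x V(1) by (auto simp: openin_Int)
      ultimately obtain y where "y \<in> cb_level Y l b \<inter> (N \<inter> V)" "y \<noteq> x"
        unfolding mem_cb_step_iff by meson
      then have "y \<in> N \<inter> (V \<inter> cb_level Y l b)" by auto
      then show False unfolding x(3) using \<open>y \<noteq> x\<close> by simp
    qed
    then have "x \<in> V - ?B" using x(1) b unfolding cb_derivative_def by auto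
    then obtain K where K: "rel_clopen Y V K" "x \<in> K" "K \<subseteq> V - ?B"
      using rel_clopen_neighbourhood[OF Ys(1,4) V(1) Bo, of x] by auto
    then show ?thesis using x(1) by (intro exI[of _ K]) auto
  qed
  then obtain K where K: "\<And>b. b \<in> Field l \<Longrightarrow> rel_clopen Y V (K b)"
    "\<And>b. b \<in> Field l \<Longrightarrow> K b \<inter> ?B = {}" "\<And>b. b \<in> Field l \<Longrightarrow> K b \<inter> cb_level Y l b \<noteq> {}"
    by metis
  define V0 where "V0 = (\<Union>b\<in>Field l. K b)"
  have "openin Y V0" unfolding V0_def using K(1) by (auto simp: rel_clopen_def)
  moreover have "openin Y (V \<inter> (\<Inter>b\<in>Field l. V - K b))"
    using K(1) by (intro P_space_openin_INT[OF Ys(4) count V(1)]) (auto simp: rel_clopen_def)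
  moreover have "V \<inter> (\<Inter>b\<in>Field l. V - K b) = V - V0" unfolding V0_def by auto
  moreover have "V0 \<subseteq> V" unfolding V0_def using K(1) by (auto simp: rel_clopen_def)
  ultimately have "rel_clopen Y V V0" by (simp add: rel_clopen_def)
  moreover have "V0 \<inter> ?B = {}" unfolding V0_def using K(2) by blast
  moreover have "V0 \<inter> cb_level Y l b \<noteq> {}" if "b \<in> Field l" for b
    unfolding V0_def using K(3)[OF that] that by blast
  ultimately show ?thesis by blast
qed

text \<open>
  The embedding of \<open>U\<close> is not required to extend \<open>h\<close>: the local constructions can then use any
  embedding of a piece, and only the centres of layers follow \<open>h\<close>.
\<close>

definition extends_below :: "'l rel \<Rightarrow> 'a topology \<Rightarrow> 'b topology \<Rightarrow> 'a set \<Rightarrow> bool" where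
  "extends_below l X Y U \<longleftrightarrow> (\<forall>V h. openin Y V \<longrightarrow> (\<forall>b\<in>Field l. V \<inter> cb_level Y l b \<noteq> {}) \<longrightarrow>
     emb_on X (cb_derivative X l \<inter> U) Y h \<longrightarrow>
     h ` (cb_derivative X l \<inter> U) \<subseteq> V \<inter> cb_derivative Y l \<longrightarrow> embeds_in X U Y V)"

text \<open>
  All open subsets of \<open>N\<close> are included, so that the property survives cutting into pieces.
\<close>

definition locally_extends_below :: "'l rel \<Rightarrow> 'a topology \<Rightarrow> 'b topology \<Rightarrow> 'a \<Rightarrow> bool" where
  "locally_extends_below l X Y x \<longleftrightarrow>
     (\<exists>N. openin X N \<and> x \<in> N \<and> (\<forall>U. openin X U \<longrightarrow> U \<subseteq> N \<longrightarrow> extends_below l X Y U))"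

lemma cb_derivative_subset_level:
  "b \<in> Field l \<Longrightarrow> cb_derivative X l \<subseteq> cb_level X l b"
  unfolding cb_derivative_def using cb_step_subset by fast

text \<open>
  The image of \<open>S\<close> need not be closed in \<open>V\<close>, so its pieces may accumulate; but they are relatively
  open in it, hence a disjoint refinement of suitable neighbourhoods separates them.
\<close>

lemma separate_images:
  assumes X: "small_P X" and Y: "small_P Y" and V: "openin Y V"
    and \<V>: "\<And>K. K \<in> \<V> \<Longrightarrow> openin X K" "disjoint \<V>"
    and h: "emb_on X S Y h" "h ` S \<subseteq> V" "S \<subseteq> \<Union>\<V>"
  shows "\<exists>W. disjoint_family_on W \<V> \<and> (\<forall>K\<in>\<V>. openin Y (W K) \<and> W K \<subseteq> V \<and> h ` (S \<inter> K) \<subseteq> W K)"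
proof -
  define \<O> where "\<O> = {N. openin Y N \<and> N \<subseteq> V \<and> (\<exists>K\<in>\<V>. {y\<in>S. h y \<in> N} \<subseteq> K)}"
  obtain \<N> where \<N>: "\<And>N. N \<in> \<N> \<Longrightarrow> openin Y N" "\<And>N. N \<in> \<N> \<Longrightarrow> \<exists>N'\<in>\<O>. N \<subseteq> N'"
      "disjoint \<N>" "\<Union>\<N> = \<Union>\<O>"
    by (rule disjoint_open_refinement[OF Y, of \<O>]) (auto simp: \<O>_def)
  define W where "W K = \<Union>{N\<in>\<N>. N \<inter> h ` (S \<inter> K) \<noteq> {}}" for K
  have W: "openin Y (W K)" for K unfolding W_def using \<N>(1) by (auto intro!: openin_Union)
  have WV: "W K \<subseteq> V" for K unfolding W_def using \<N>(2) by (fastforce simp: \<O>_def)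
  have same: "K = K'" if N: "N \<in> \<N>" "N \<inter> h ` (S \<inter> K) \<noteq> {}" "N \<inter> h ` (S \<inter> K') \<noteq> {}"
    and K: "K \<in> \<V>" "K' \<in> \<V>" for N K K'
  proof -
    obtain N' L where L: "L \<in> \<V>" "{y\<in>S. h y \<in> N'} \<subseteq> L" "N \<subseteq> N'"
      using \<N>(2)[OF N(1)] unfolding \<O>_def by auto
    have "M = L" if M: "M \<in> \<V>" "N \<inter> h ` (S \<inter> M) \<noteq> {}" for M
    proof -
      obtain y where "y \<in> S \<inter> M" "h y \<in> N" using M(2) by auto
      then have "y \<in> M \<inter> L" using L(2,3) by auto
      then show ?thesis using \<V>(2) M(1) L(1) unfolding disjoint_def by (metis empty_iff)
    qed
    then show ?thesis using N K by metis
  qed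
  have "W K \<inter> W K' = {}" if K: "K \<in> \<V>" "K' \<in> \<V>" "K \<noteq> K'" for K K'
  proof (rule ccontr)
    assume "W K \<inter> W K' \<noteq> {}"
    then obtain y where y: "y \<in> W K" "y \<in> W K'" by auto
    obtain N where N: "N \<in> \<N>" "N \<inter> h ` (S \<inter> K) \<noteq> {}" "y \<in> N"
      using y(1) unfolding W_def by blast
    obtain N' where N': "N' \<in> \<N>" "N' \<inter> h ` (S \<inter> K') \<noteq> {}" "y \<in> N'"
      using y(2) unfolding W_def by blast
    have "N = N'"
    proof (rule ccontr)
      assume "N \<noteq> N'"
      then have "N \<inter> N' = {}" using \<N>(3) N(1) N'(1) unfolding disjoint_def by metis
      with N(3) N'(3) show False by auto
    qed
    then show False using same[OF N(1,2) _ K(1,2)] N'(2) K(3) by simp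
  qed
  then have "disjoint_family_on W \<V>" by (simp add: disjoint_family_on_def)
  moreover have "h ` (S \<inter> K) \<subseteq> W K" if K: "K \<in> \<V>" for K
  proof (rule image_subsetI)
    fix x assume x: "x \<in> S \<inter> K"
    then have xS: "x \<in> S" and xK: "x \<in> K" by auto
    obtain N where N: "openin Y N" "h x \<in> N" "{y\<in>S. h y \<in> N} \<subseteq> K"
      using emb_onD2[OF h(1) xS \<V>(1)[OF K] xK] by meson
    have "{y\<in>S. h y \<in> N \<inter> V} \<subseteq> K" using N(3) by auto
    then have "N \<inter> V \<in> \<O>" using openin_Int[OF N(1) V] K unfolding \<O>_def by auto
    moreover have "h x \<in> N \<inter> V" using N(2) xS h(2) by auto
    ultimately have "h x \<in> \<Union>\<N>" unfolding \<N>(4) by (rule UnionI)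
    then obtain N1 where "N1 \<in> \<N>" "h x \<in> N1" by auto
    then show "h x \<in> W K" using x unfolding W_def by auto
  qed
  ultimately show ?thesis using W WV by (intro exI[of _ W]) simp
qed

text \<open>
  Cut \<open>U\<close> into pieces with the extension property. Those that meet \<open>X\<^sup>(\<^sup>\<lambda>\<^sup>)\<close> go to disjoint
  neighbourhoods of their images under \<open>h\<close>, all the others together go to the reserved room.
\<close>

lemma extends_below_of_locally:
  assumes X: "small_P X" and Y: "small_P Y" and l: "limit_ordinal l" and count: "countable (Field l)"
    and U: "openin X U" and good: "\<And>x. x \<in> U \<Longrightarrow> locally_extends_below l X Y x"
  shows "extends_below l X Y U"
  unfolding extends_below_def
proof (intro allI impI)
  fix V h
  let ?A = "cb_derivative X l" and ?B = "cb_derivative Y l"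
  assume V: "openin Y V" and full: "\<forall>b\<in>Field l. V \<inter> cb_level Y l b \<noteq> {}"
    and h: "emb_on X (?A \<inter> U) Y h" "h ` (?A \<inter> U) \<subseteq> V \<inter> ?B"
  have wo: "Well_order l" using l by (simp add: limit_ordinal_def)
  obtain V0 where V0: "rel_clopen Y V V0" "V0 \<inter> ?B = {}" "\<forall>b\<in>Field l. V0 \<inter> cb_level Y l b \<noteq> {}"
    using reserved_room[OF Y wo count V] full by meson
  have V0o: "openin Y V0" "openin Y (V - V0)" "V0 \<subseteq> V" using V0(1) by (simp_all add: rel_clopen_def)
  define \<O> where "\<O> = {N. openin X N \<and> N \<subseteq> U \<and> (\<forall>U'. openin X U' \<longrightarrow> U' \<subseteq> N \<longrightarrow> extends_below l X Y U')}"
  have cover: "x \<in> \<Union>\<O>" if x: "x \<in> U" for x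
  proof -
    obtain N where N: "openin X N" "x \<in> N" "\<forall>U. openin X U \<longrightarrow> U \<subseteq> N \<longrightarrow> extends_below l X Y U"
      using good[OF x] unfolding locally_extends_below_def by meson
    then have "N \<inter> U \<in> \<O>" using U unfolding \<O>_def by (simp add: openin_Int)
    with N(2) x show ?thesis by (intro UnionI[of "N \<inter> U"]) auto
  qed
  obtain \<V> where \<V>: "\<And>K. K \<in> \<V> \<Longrightarrow> openin X K" "\<And>K. K \<in> \<V> \<Longrightarrow> \<exists>N\<in>\<O>. K \<subseteq> N"
      "disjoint \<V>" "\<Union>\<V> = \<Union>\<O>"
    by (rule disjoint_open_refinement[OF X, of \<O>]) (auto simp: \<O>_def)
  have \<V>U: "\<Union>\<V> = U" unfolding \<V>(4) using cover by (auto simp: \<O>_def)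
  have ext: "extends_below l X Y K" if "K \<in> \<V>" for K
    using \<V>(2)[OF that] \<V>(1)[OF that] unfolding \<O>_def by auto
  define \<V>1 where "\<V>1 = {K\<in>\<V>. K \<inter> ?A \<noteq> {}}"
  define \<V>0 where "\<V>0 = {K\<in>\<V>. K \<inter> ?A = {}}"
  have hV: "h ` (?A \<inter> U) \<subseteq> V - V0" using h(2) V0(2) by auto
  have "\<exists>W. disjoint_family_on W \<V> \<and> (\<forall>K\<in>\<V>. openin Y (W K) \<and> W K \<subseteq> V - V0 \<and> h ` ((?A \<inter> U) \<inter> K) \<subseteq> W K)"
    by (rule separate_images[OF X Y V0o(2) \<V>(1,3) h(1) hV]) (use \<V>U in auto)
  then obtain W where W: "disjoint_family_on W \<V>"
      "\<forall>K\<in>\<V>. openin Y (W K) \<and> W K \<subseteq> V - V0 \<and> h ` ((?A \<inter> U) \<inter> K) \<subseteq> W K" by (elim exE conjE)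
  have "embeds_in X (\<Union>K\<in>\<V>1. K) Y (\<Union>K\<in>\<V>1. W K)"
  proof (rule embeds_in_UNION)
    show "disjoint_family_on (\<lambda>K. K) \<V>1" "disjoint_family_on W \<V>1"
      using \<V>(3) W(1) unfolding disjoint_def disjoint_family_on_def \<V>1_def by auto
    fix K assume K1: "K \<in> \<V>1"
    then have K: "K \<in> \<V>" "K \<inter> ?A \<noteq> {}" by (auto simp: \<V>1_def)
    have KU: "K \<subseteq> U" using K(1) \<V>U by auto
    show "openin X K" by (rule \<V>(1)[OF K(1)])
    show Wo: "openin Y (W K)" using W(2) K(1) by simp
    have hW: "h ` (?A \<inter> K) \<subseteq> W K \<inter> ?B"
    proof (rule image_subsetI)
      fix x assume "x \<in> ?A \<inter> K"
      then have "x \<in> ?A \<inter> U" "x \<in> (?A \<inter> U) \<inter> K" using KU by auto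
      then show "h x \<in> W K \<inter> ?B" using W(2) K(1) h(2) by (auto simp: image_subset_iff)
    qed
    have "W K \<inter> cb_level Y l b \<noteq> {}" if "b \<in> Field l" for b
      using hW K(2) cb_derivative_subset_level[OF that, of Y] by (fastforce simp: image_subset_iff)
    moreover have "emb_on X (?A \<inter> K) Y h" by (rule emb_on_mono[OF h(1)]) (use KU in auto)
    ultimately show "embeds_in X K Y (W K)"
      using ext[OF K(1)] Wo hW unfolding extends_below_def by simp
  qed
  moreover have "embeds_in X (\<Union>\<V>0) Y V0"
    by (rule embeds_in_of_empty_derivative[OF X Y l count])
       (use \<V>(1) V0 V0o in \<open>auto simp: \<V>0_def intro!: openin_Union\<close>)
  ultimately have "embeds_in X ((\<Union>K\<in>\<V>1. K) \<union> \<Union>\<V>0) Y ((\<Union>K\<in>\<V>1. W K) \<union> V0)"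
  proof (intro embeds_in_Un)
    show "openin X (\<Union>K\<in>\<V>1. K)" "openin X (\<Union>\<V>0)"
      using \<V>(1) by (auto simp: \<V>1_def \<V>0_def intro!: openin_Union)
    show "(\<Union>K\<in>\<V>1. K) \<inter> \<Union>\<V>0 = {}"
    proof -
      have "K \<inter> K' = {}" if "K \<in> \<V>1" "K' \<in> \<V>0" for K K'
      proof -
        have "K \<in> \<V>" "K' \<in> \<V>" "K \<noteq> K'" using that by (auto simp: \<V>1_def \<V>0_def)
        then show ?thesis using \<V>(3) unfolding disjoint_def by metis
      qed
      then show ?thesis by blast
    qed
    show "openin Y (\<Union>K\<in>\<V>1. W K)" using W(2) by (auto simp: \<V>1_def intro!: openin_Union)
    show "(\<Union>K\<in>\<V>1. W K) \<inter> V0 = {}" using W(2) by (auto simp: \<V>1_def)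
  qed (use V0o in auto)
  then show "embeds_in X U Y V"
  proof (rule embeds_in_mono)
    show "U \<subseteq> (\<Union>K\<in>\<V>1. K) \<union> \<Union>\<V>0" unfolding \<V>U[symmetric] \<V>1_def \<V>0_def by auto
    show "(\<Union>K\<in>\<V>1. W K) \<union> V0 \<subseteq> V" using W(2) V0o(3) by (auto simp: \<V>1_def)
  qed
qed

text \<open>
  Otherwise scatteredness gives a bad point \<open>p\<close> that is isolated among the bad points. Off \<open>X\<^sup>(\<^sup>\<lambda>\<^sup>)\<close>
  nothing is bad. If \<open>p\<close> lies in \<open>X\<^sup>(\<^sup>\<lambda>\<^sup>)\<close>, then \<open>h p\<close> is an accumulation point of every level below
  \<open>\<lambda>\<close>, so matching layers exist whose targets meet all these levels, and the layers around \<open>p\<close>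
  consist of good points.
\<close>

lemma locally_extends_below_everywhere:
  assumes X: "small_P X" and Y: "small_P Y" and l: "limit_ordinal l" and count: "countable (Field l)"
    and x: "x \<in> topspace X"
  shows "locally_extends_below l X Y x"
proof (rule ccontr)
  assume bad: "\<not> locally_extends_below l X Y x"
  let ?A = "cb_derivative X l" and ?B = "cb_derivative Y l" and ?W = "Field \<omega>\<^sub>1"
  have wo: "Well_order l" using l by (simp add: limit_ordinal_def)
  define S where "S = {x\<in>topspace X. \<not> locally_extends_below l X Y x}"
  have "S \<noteq> {}" "S \<subseteq> topspace X" using x bad by (auto simp: S_def)
  then obtain p N where p: "p \<in> S" "openin X N" "N \<inter> S = {p}"
    using small_PD(3)[OF X] unfolding scattered_space_iff by meson
  have pN: "p \<in> N" using p(3) by auto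
  have good: "locally_extends_below l X Y y" if "y \<in> N" "y \<noteq> p" for y
  proof (rule ccontr)
    assume "\<not> ?thesis"
    then have "y \<in> N \<inter> S" using that(1) openin_subset[OF p(2)] by (auto simp: S_def)
    with p(3) that(2) show False by simp
  qed
  have A: "closedin X ?A" by (rule closedin_cb_derivative[OF wo])
  have "locally_extends_below l X Y p"
  proof (cases "p \<in> ?A")
    case False
    have "extends_below l X Y U" if U: "openin X U" "U \<subseteq> topspace X - ?A" for U
      unfolding extends_below_def
    proof (intro allI impI)
      fix V h assume V: "openin Y V" "\<forall>b\<in>Field l. V \<inter> cb_level Y l b \<noteq> {}"
      show "embeds_in X U Y V"
        by (rule embeds_in_of_empty_derivative[OF X Y l count U(1) _ V(1)]) (use U V in auto)
    qed
    moreover have "openin X (topspace X - ?A)" using A by (simp add: closedin_def)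
    moreover have "p \<in> topspace X - ?A" using False p(1) by (simp add: S_def)
    ultimately show ?thesis unfolding locally_extends_below_def by (intro exI[of _ "topspace X - ?A"]) simp
  next
    case pA: True
    have "extends_below l X Y U" if U: "openin X U" "U \<subseteq> N" for U
    proof (cases "p \<in> U")
      case False
      show ?thesis
      proof (rule extends_below_of_locally[OF X Y l count U(1)])
        show "locally_extends_below l X Y y" if "y \<in> U" for y using good that U(2) False by blast
      qed
    next
      case True
      show ?thesis
        unfolding extends_below_def
      proof (intro allI impI)
        fix V h assume V: "openin Y V" and full: "\<forall>b\<in>Field l. V \<inter> cb_level Y l b \<noteq> {}"
          and h: "emb_on X (?A \<inter> U) Y h" "h ` (?A \<inter> U) \<subseteq> V \<inter> ?B"
        have hB: "h p \<in> ?B" using h(2) pA True by auto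
        \<comment> \<open>countably many points witness that the levels below \<open>l\<close> are met\<close>
        have "\<exists>P Q. converging_layers X p U ?W P \<and> U = insert p (\<Union>\<alpha>\<in>?W. P \<alpha>) \<and>
          converging_layers Y (h p) V ?W Q \<and>
          (\<forall>\<alpha>\<in>?W. (\<forall>b\<in>Field l. Q \<alpha> \<inter> cb_level Y l b \<noteq> {}) \<and> h ` (?A \<inter> P \<alpha>) \<subseteq> Q \<alpha>)"
        proof (rule matching_layers[OF X Y U(1) True V A pA h(1)])
          show "h ` (?A \<inter> U) \<subseteq> V" using h(2) by simp
          show "\<forall>b\<in>Field l. T \<inter> cb_level Y l b \<noteq> {}"
            if "\<forall>b\<in>Field l. S \<inter> cb_level Y l b \<noteq> {}" "S \<subseteq> T" for S T
            using that by blast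
          show "\<exists>C. countable C \<and> C \<subseteq> W - {h p} \<and> (\<forall>b\<in>Field l. C \<inter> cb_level Y l b \<noteq> {})"
            if W: "openin Y W" "h p \<in> W" "W \<subseteq> V" for W
          proof -
            have "\<exists>y. y \<in> W \<inter> cb_level Y l b - {h p}" if b: "b \<in> Field l" for b
            proof -
              have "h p \<in> cb_step Y (cb_level Y l b)" using hB b by (simp add: cb_derivative_def)
              from cb_step_infinite[OF Y this W(1,2)] show ?thesis by (metis finite.emptyI ex_in_conv)
            qed
            then obtain y where y: "\<And>b. b \<in> Field l \<Longrightarrow> y b \<in> W \<inter> cb_level Y l b - {h p}" by metis
            have "countable (y ` Field l)" using count by simp
            moreover have "y ` Field l \<subseteq> W - {h p}" using y by auto
            moreover have "y ` Field l \<inter> cb_level Y l b \<noteq> {}" if "b \<in> Field l" for b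
              using y[OF that] that by auto
            ultimately show ?thesis by (intro exI[of _ "y ` Field l"]) simp
          qed
        qed
        then obtain P Q where *: "converging_layers X p U ?W P \<and> U = insert p (\<Union>\<alpha>\<in>?W. P \<alpha>) \<and>
          converging_layers Y (h p) V ?W Q \<and>
          (\<forall>\<alpha>\<in>?W. (\<forall>b\<in>Field l. Q \<alpha> \<inter> cb_level Y l b \<noteq> {}) \<and> h ` (?A \<inter> P \<alpha>) \<subseteq> Q \<alpha>)"
          by (elim exE)
        note PQ = conjunct1[OF *] conjunct1[OF conjunct2[OF *]] conjunct1[OF conjunct2[OF conjunct2[OF *]]]
        note Q_rich = bspec[OF conjunct2[OF conjunct2[OF conjunct2[OF *]]]]
        show "embeds_in X U Y V"
        proof (rule embeds_in_layers[OF PQ])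
          fix \<alpha> assume \<alpha>: "\<alpha> \<in> ?W"
          have P: "openin X (P \<alpha>)" "P \<alpha> \<subseteq> U - {p}" and Q: "openin Y (Q \<alpha>)"
            using PQ(1,3) \<alpha> unfolding converging_layers_def by simp_all
          have "extends_below l X Y (P \<alpha>)"
          proof (rule extends_below_of_locally[OF X Y l count P(1)])
            show "locally_extends_below l X Y y" if "y \<in> P \<alpha>" for y using good that U(2) P(2) by blast
          qed
          moreover have "emb_on X (?A \<inter> P \<alpha>) Y h" by (rule emb_on_mono[OF h(1)]) (use P(2) in auto)
          moreover have "h ` (?A \<inter> P \<alpha>) \<subseteq> Q \<alpha> \<inter> ?B"
          proof -
            have "h ` (?A \<inter> P \<alpha>) \<subseteq> h ` (?A \<inter> U)" using P(2) by (intro image_mono) auto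
            also have "\<dots> \<subseteq> ?B" using h(2) by simp
            finally show ?thesis using Q_rich[OF \<alpha>] by simp
          qed
          ultimately show "embeds_in X (P \<alpha>) Y (Q \<alpha>)"
            using Q Q_rich[OF \<alpha>] unfolding extends_below_def by simp
        qed
      qed
    qed
    then show ?thesis unfolding locally_extends_below_def using p(2) pN by (intro exI[of _ N]) simp
  qed
  with p(1) show False by (simp add: S_def)
qed

lemma derivative_embeds:
  assumes wo: "Well_order r" and X: "t1_space X" and XY: "X \<subset>\<^sub>h Y"
  shows "subtopology X (cb_derivative X r) \<subset>\<^sub>h subtopology Y (cb_derivative Y r)"
proof -
  let ?A = "cb_derivative X r" and ?B = "cb_derivative Y r"
  have AX: "?A \<subseteq> topspace X" by (simp add: cb_derivative_def)
  then have topA: "topspace (subtopology X ?A) = ?A" by auto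
  have t1: "t1_space (subtopology X ?A)" by (rule t1_space_subtopology[OF X])
  obtain f where f: "emb_on X (topspace X) Y f" using XY embeds_iff_emb_on[OF X] by blast
  have "emb_on X ?A Y f" by (rule emb_on_mono[OF f AX])
  moreover have "f ` ?A \<subseteq> ?B" by (rule cb_derivative_image[OF wo f emb_on_inj[OF X f]])
  ultimately have "emb_on (subtopology X ?A) ?A (subtopology Y ?B) f"
    by (simp add: emb_on_subtopology_source[OF AX] emb_on_subtopology_target)
  then show ?thesis unfolding embeds_iff_emb_on[OF t1] topA by blast
qed

text \<open>
  A point of \<open>Y\<^sup>(\<^sup>\<lambda>\<^sup>)\<close> exists as \<open>X\<^sup>(\<^sup>\<lambda>\<^sup>)\<close> is nonempty, and it witnesses that \<open>Y\<close> meets all levels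
  below \<open>\<lambda>\<close>. Without it, \<open>Y\<close> could have a smaller rank than \<open>X\<close>.
\<close>

theorem embeds_of_derivative_embeds:
  assumes X: "small_P X" and Y: "small_P Y" and l: "limit_ordinal l" and count: "countable (Field l)"
    and ne: "cb_derivative X l \<noteq> {}"
    and emb: "subtopology X (cb_derivative X l) \<subset>\<^sub>h subtopology Y (cb_derivative Y l)"
  shows "X \<subset>\<^sub>h Y"
proof -
  let ?A = "cb_derivative X l" and ?B = "cb_derivative Y l"
  have AX: "?A \<subseteq> topspace X" and BY: "?B \<subseteq> topspace Y" by (simp_all add: cb_derivative_def)
  then have topA: "topspace (subtopology X ?A) = ?A" by auto
  have t1: "t1_space X" "t1_space (subtopology X ?A)"
    using small_PD(2)[OF X] t1_space_subtopology by blast+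
  obtain h where "emb_on (subtopology X ?A) ?A (subtopology Y ?B) h"
    using emb unfolding embeds_iff_emb_on[OF t1(2)] topA by blast
  then have h: "emb_on X ?A Y h" "h ` ?A \<subseteq> ?B"
    by (simp_all add: emb_on_subtopology_source[OF AX] emb_on_subtopology_target)
  have "?B \<noteq> {}" using h(2) ne by auto
  then have "\<forall>b\<in>Field l. topspace Y \<inter> cb_level Y l b \<noteq> {}"
    using cb_derivative_subset_level[of _ l Y] BY by blast
  moreover have "extends_below l X Y (topspace X)"
    by (rule extends_below_of_locally[OF X Y l count openin_topspace])
       (rule locally_extends_below_everywhere[OF X Y l count])
  moreover have "?A \<inter> topspace X = ?A" "h ` ?A \<subseteq> topspace Y \<inter> ?B" using AX BY h(2) by auto
  ultimately have "embeds_in X (topspace X) Y (topspace Y)"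
    using h(1) unfolding extends_below_def by simp
  then show "X \<subset>\<^sub>h Y" unfolding embeds_iff_emb_on[OF t1(1)] embeds_in_def by blast
qed

section \<open>Ordinal sums and iterated derivatives\<close>

lemma ord_sum_simps [simp]:
  "(Inl a, Inl b) \<in> ord_sum r s \<longleftrightarrow> (a, b) \<in> r"
  "(Inr c, Inr d) \<in> ord_sum r s \<longleftrightarrow> (c, d) \<in> s"
  "(Inl a, Inr d) \<in> ord_sum r s \<longleftrightarrow> a \<in> Field r \<and> d \<in> Field s"
  "(Inr c, Inl b) \<notin> ord_sum r s"
  by (auto simp: ord_sum_def)

lemma Well_order_refl: "Well_order r \<Longrightarrow> a \<in> Field r \<Longrightarrow> (a, a) \<in> r"
  using wo_rel.REFL[of r] by (auto simp: wo_rel_def refl_on_def)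

lemma Field_ord_sum:
  assumes r: "Well_order r" and s: "Well_order s"
  shows "Field (ord_sum r s) = Inl ` Field r \<union> Inr ` Field s"
proof
  show "Field (ord_sum r s) \<subseteq> Inl ` Field r \<union> Inr ` Field s"
    by (auto simp: ord_sum_def Field_def)
  have "Inl a \<in> Field (ord_sum r s)" if "a \<in> Field r" for a
    using Well_order_refl[OF r that] by (intro FieldI1[of _ "Inl a"]) simp
  moreover have "Inr b \<in> Field (ord_sum r s)" if "b \<in> Field s" for b
    using Well_order_refl[OF s that] by (intro FieldI1[of _ "Inr b"]) simp
  ultimately show "Inl ` Field r \<union> Inr ` Field s \<subseteq> Field (ord_sum r s)" by auto
qed

lemma Well_order_ord_sum:
  assumes r: "Well_order r" and s: "Well_order s"
  shows "Well_order (ord_sum r s)"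
proof -
  have wr: "wo_rel r" and ws: "wo_rel s" using r s by (simp_all add: wo_rel_def)
  note F = Field_ord_sum[OF r s]
  have "Refl (ord_sum r s)"
    unfolding refl_on_def F using Well_order_refl[OF r] Well_order_refl[OF s] by auto
  moreover have "trans (ord_sum r s)"
  proof (rule transI)
    fix x y z assume "(x, y) \<in> ord_sum r s" "(y, z) \<in> ord_sum r s"
    then show "(x, z) \<in> ord_sum r s"
      using wo_rel.TRANS[OF wr] wo_rel.TRANS[OF ws]
      by (cases x; cases y; cases z) (auto dest: transD intro: FieldI1 FieldI2)
  qed
  moreover have "antisym (ord_sum r s)"
  proof (rule antisymI)
    fix x y assume "(x, y) \<in> ord_sum r s" "(y, x) \<in> ord_sum r s"
    then show "x = y"
      using wo_rel.ANTISYM[OF wr] wo_rel.ANTISYM[OF ws]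
      by (cases x; cases y) (auto dest: antisymD)
  qed
  moreover have "Total (ord_sum r s)"
    unfolding total_on_def F using wo_rel.TOTALS[OF wr] wo_rel.TOTALS[OF ws] by auto blast+
  moreover have "ord_sum r s \<subseteq> Field (ord_sum r s) \<times> Field (ord_sum r s)"
    by (auto intro: FieldI1 FieldI2)
  ultimately have lin: "Linear_order (ord_sum r s)" by (simp add: order_on_defs)
  have "\<exists>a\<in>A. \<forall>a'\<in>A. (a, a') \<in> ord_sum r s" if A: "A \<subseteq> Field (ord_sum r s)" "A \<noteq> {}" for A
  proof (cases "Inl -` A = {}")
    case False
    have sub: "Inl -` A \<subseteq> Field r" using A(1) unfolding F by auto
    define m where "m = wo_rel.minim r (Inl -` A)"
    have m: "m \<in> Inl -` A" "\<And>b. b \<in> Inl -` A \<Longrightarrow> (m, b) \<in> r"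
      unfolding m_def using wo_rel.minim_in[OF wr sub False] wo_rel.minim_least[OF wr sub] by auto
    have "(Inl m, a') \<in> ord_sum r s" if "a' \<in> A" for a'
    proof (cases a')
      case (Inl b)
      then show ?thesis using m(2)[of b] that by simp
    next
      case (Inr c)
      then show ?thesis using m(1) sub A(1) that unfolding F by auto
    qed
    with m(1) show ?thesis by auto
  next
    case True
    have A': "A \<subseteq> Inr ` Field s"
    proof
      fix x assume x: "x \<in> A"
      then have "x \<in> Inl ` Field r \<or> x \<in> Inr ` Field s" using A(1) F by auto
      then show "x \<in> Inr ` Field s" using True x by auto
    qed
    then have sub: "Inr -` A \<subseteq> Field s" by auto
    have ne: "Inr -` A \<noteq> {}" using A' A(2) by auto
    define m where "m = wo_rel.minim s (Inr -` A)"
    have m: "m \<in> Inr -` A" "\<And>b. b \<in> Inr -` A \<Longrightarrow> (m, b) \<in> s"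
      unfolding m_def using wo_rel.minim_in[OF ws sub ne] wo_rel.minim_least[OF ws sub] by auto
    have "(Inr m, a') \<in> ord_sum r s" if "a' \<in> A" for a'
    proof -
      have "a' \<in> Inr ` Field s" using A' that by auto
      then obtain c where "a' = Inr c" by auto
      then show ?thesis using m(2)[of c] that by simp
    qed
    with m(1) show ?thesis by auto
  qed
  then show ?thesis using Linear_order_Well_order_iff[OF lin] by blast
qed

lemma underS_ord_sum_Inl: "underS (ord_sum r s) (Inl a) = Inl ` underS r a"
proof -
  have "x \<in> underS (ord_sum r s) (Inl a) \<longleftrightarrow> x \<in> Inl ` underS r a" for x
    by (cases x) (auto simp: underS_def)
  then show ?thesis by blast
qed

lemma underS_ord_sum_Inr:
  assumes "b \<in> Field s"
  shows "underS (ord_sum r s) (Inr b) = Inl ` Field r \<union> Inr ` underS s b"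
proof -
  have "x \<in> underS (ord_sum r s) (Inr b) \<longleftrightarrow> x \<in> Inl ` Field r \<union> Inr ` underS s b" for x
    using assms by (cases x) (auto simp: underS_def)
  then show ?thesis by blast
qed

lemma cb_step_subtopology:
  assumes "T \<subseteq> D" shows "cb_step (subtopology X D) T = cb_step X T"
proof -
  have "D \<inter> T = T" using assms by auto
  then show ?thesis using assms unfolding cb_step_def derived_set_of_subtopology by auto
qed

lemma cb_level_ord_sum_Inl:
  assumes r: "Well_order r" and s: "Well_order s" and a: "a \<in> Field r"
  shows "cb_level X (ord_sum r s) (Inl a) = cb_level X r a"
  using r a
proof (induction rule: Well_order_induct)
  case (less a)
  have "(\<Inter>b\<in>Inl ` underS r a. cb_step X (cb_level X (ord_sum r s) b)) =
      (\<Inter>b\<in>underS r a. cb_step X (cb_level X r b))"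
    using less.IH by simp
  then show ?case
    unfolding cb_level_rec[OF Well_order_ord_sum[OF r s], of X "Inl a"] cb_level_rec[OF r, of X a]
      underS_ord_sum_Inl by simp
qed

lemma cb_level_ord_sum_Inr:
  assumes r: "Well_order r" and s: "Well_order s" and b: "b \<in> Field s"
  shows "cb_level X (ord_sum r s) (Inr b) = cb_level (subtopology X (cb_derivative X r)) s b"
  using s b
proof (induction rule: Well_order_induct)
  case (less b)
  let ?D = "cb_derivative X r" and ?L = "cb_level X (ord_sum r s)"
  have DX: "topspace (subtopology X ?D) = ?D" by (auto simp: cb_derivative_def)
  have "cb_step X (?L (Inr c)) = cb_step (subtopology X ?D) (cb_level (subtopology X ?D) s c)"
    if "c \<in> underS s b" for c
    using cb_step_subtopology[of "cb_level (subtopology X ?D) s c" ?D X]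
      cb_level_subset_topspace[OF s, of "subtopology X ?D" c] less.IH[OF that] DX by simp
  then have "(\<Inter>c\<in>underS s b. cb_step X (?L (Inr c))) =
      (\<Inter>c\<in>underS s b. cb_step (subtopology X ?D) (cb_level (subtopology X ?D) s c))" by simp
  moreover have "topspace X \<inter> (\<Inter>a\<in>Field r. cb_step X (?L (Inl a))) = ?D"
    unfolding cb_derivative_def using cb_level_ord_sum_Inl[OF r s, of _ X] by simp
  moreover have "?L (Inr b) = (topspace X \<inter> (\<Inter>a\<in>Field r. cb_step X (?L (Inl a)))) \<inter>
      (\<Inter>c\<in>underS s b. cb_step X (?L (Inr c)))"
    by (subst cb_level_rec[OF Well_order_ord_sum[OF r s]])
       (auto simp: underS_ord_sum_Inr[OF less.hyps])
  ultimately show ?case unfolding cb_level_rec[OF s, of "subtopology X ?D" b] DX by simp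
qed

lemma cb_derivative_ord_sum:
  assumes r: "Well_order r" and s: "Well_order s"
  shows "cb_derivative X (ord_sum r s) = cb_derivative (subtopology X (cb_derivative X r)) s"
proof -
  let ?D = "cb_derivative X r" and ?L = "cb_level X (ord_sum r s)"
  have DX: "topspace (subtopology X ?D) = ?D" by (auto simp: cb_derivative_def)
  have "cb_step X (?L (Inr c)) = cb_step (subtopology X ?D) (cb_level (subtopology X ?D) s c)"
    if "c \<in> Field s" for c
    using cb_step_subtopology[of "cb_level (subtopology X ?D) s c" ?D X]
      cb_level_subset_topspace[OF s, of "subtopology X ?D" c] cb_level_ord_sum_Inr[OF r s that, of X] DX
    by simp
  then have "(\<Inter>c\<in>Field s. cb_step X (?L (Inr c))) =
      (\<Inter>c\<in>Field s. cb_step (subtopology X ?D) (cb_level (subtopology X ?D) s c))" by simp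
  moreover have "topspace X \<inter> (\<Inter>a\<in>Field r. cb_step X (?L (Inl a))) = ?D"
    unfolding cb_derivative_def using cb_level_ord_sum_Inl[OF r s, of _ X] by simp
  moreover have "cb_derivative X (ord_sum r s) =
      (topspace X \<inter> (\<Inter>a\<in>Field r. cb_step X (?L (Inl a)))) \<inter> (\<Inter>c\<in>Field s. cb_step X (?L (Inr c)))"
    unfolding cb_derivative_def[of X "ord_sum r s"] Field_ord_sum[OF r s] by auto
  ultimately show ?thesis unfolding cb_derivative_def[of "subtopology X ?D"] DX by simp
qed

lemma cb_derivative_antimono:
  assumes "r \<le>o s" shows "cb_derivative X s \<subseteq> cb_derivative X r"
proof -
  obtain f where r: "Well_order r" and s: "Well_order s" and f: "embed r s f"
    using assms by (auto simp: ordLeq_def)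
  have "f a \<in> Field s" if "a \<in> Field r" for a using embed_Field[OF f] that by auto
  moreover have "cb_level X s (f a) = cb_level X r a" if "a \<in> Field r" for a
    by (rule cb_level_embed[OF r s f that])
  ultimately show ?thesis unfolding cb_derivative_def by force
qed

text \<open>
  This removes the choice of a representative in the definition of the rank: from here on only the
  vanishing of derivatives matters.
\<close>

lemma cb_rank_less_iff:
  assumes X: "scattered_space X" and s: "Well_order s"
  shows "s <o cb_rank X \<longleftrightarrow> cb_derivative X s \<noteq> {}"
proof
  have rk: "has_cb_rank X (cb_rank X)" by (rule has_cb_rank_cb_rank[OF X])
  note wo = has_cb_rankD(1)[OF rk]
  {
    assume less: "s <o cb_rank X"
    then obtain a where a: "(s, Restr (cb_rank X) (underS (cb_rank X) a)) \<in> ordIso"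
      using ordLess_iff_ordIso_Restr[OF wo s] by blast
    then have "Restr (cb_rank X) (underS (cb_rank X) a) <o cb_rank X"
      by (rule ordIso_ordLess_trans[OF ordIso_symmetric less])
    then have "cb_derivative X (Restr (cb_rank X) (underS (cb_rank X) a)) \<noteq> {}"
      using rk unfolding has_cb_rank_def by (elim conjE allE impE)
    then show "cb_derivative X s \<noteq> {}" using cb_derivative_ordIso[OF a, of X] by simp
  }
  {
    assume ne: "cb_derivative X s \<noteq> {}"
    show "s <o cb_rank X"
    proof (rule ccontr)
      assume "\<not> s <o cb_rank X"
      then have "cb_rank X \<le>o s" using not_ordLess_iff_ordLeq[OF wo s] by simp
      from cb_derivative_antimono[OF this, of X] has_cb_rankD(2)[OF rk] ne show False by simp
    qed
  }
qed

lemma cb_rank_leq_iff: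
  assumes X: "scattered_space X" and s: "Well_order s"
  shows "cb_rank X \<le>o s \<longleftrightarrow> cb_derivative X s = {}"
  using cb_rank_less_iff[OF X s]
    not_ordLess_iff_ordLeq[OF has_cb_rankD(1)[OF has_cb_rank_cb_rank[OF X]] s] by blast

lemma h_poset_eq:
  assumes l: "Well_order l"
  shows "\<P> l = {[X]\<^sub>h | X :: 'a topology. small_P X \<and> cb_derivative X l \<noteq> {} \<and>
    cb_derivative (subtopology X (cb_derivative X l)) natLeq = {}}"
proof -
  have "(regular_space X \<and> t1_space X \<and> scattered_space X \<and> P_space X \<and> weight_le X \<omega>\<^sub>1 \<and>
      l <o cb_rank X \<and> cb_rank X \<le>o ord_sum l natLeq) \<longleftrightarrow>
    (small_P X \<and> cb_derivative X l \<noteq> {} \<and>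
      cb_derivative (subtopology X (cb_derivative X l)) natLeq = {})" for X :: "'a topology"
    using cb_rank_less_iff[OF _ l, of X]
      cb_rank_leq_iff[OF _ Well_order_ord_sum[OF l natLeq_Well_order], of X]
    unfolding small_P_def cb_derivative_ord_sum[OF l natLeq_Well_order] by blast
  then show ?thesis unfolding h_poset_def by simp
qed

section \<open>A tree of prescribed countable rank\<close>

text \<open>
  The head of a sequence is its newest entry. First components decrease along a branch, so they
  are the Cantor-Bendixson ranks of the nodes, the root \<open>[]\<close> having the rank \<open>l\<close>. Second components
  provide \<open>\<omega>\<^sub>1\<close> many children for each first component.
\<close>

definition tree_nodes :: "'l rel \<Rightarrow> ('l \<times> nat set) list set" where
  "tree_nodes l = {s. set s \<subseteq> Field l \<times> Field \<omega>\<^sub>1 \<and> sorted_wrt (\<lambda>x y. fst x \<in> underS l (fst y)) s}"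

text \<open>
  The entry \<open>last u\<close> is the first step on the way from \<open>s\<close> to \<open>u @ s\<close>: the neighbourhood keeps the
  whole subtrees above all children of \<open>s\<close> whose second component exceeds \<open>\<gamma>\<close>.
\<close>

definition tree_nbhd :: "'l rel \<Rightarrow> ('l \<times> nat set) list \<Rightarrow> nat set \<Rightarrow> ('l \<times> nat set) list set" where
  "tree_nbhd l s \<gamma> = {t \<in> tree_nodes l. \<exists>u. t = u @ s \<and> (u \<noteq> [] \<longrightarrow> \<gamma> \<in> underS \<omega>\<^sub>1 (snd (last u)))}"

definition tree_topology :: "'l rel \<Rightarrow> ('l \<times> nat set) list topology" where
  "tree_topology l = topology (\<lambda>U. U \<subseteq> tree_nodes l \<and> (\<forall>s\<in>U. \<exists>\<gamma>\<in>Field \<omega>\<^sub>1. tree_nbhd l s \<gamma> \<subseteq> U))"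

lemma tree_nbhd_self: "s \<in> tree_nodes l \<Longrightarrow> s \<in> tree_nbhd l s \<gamma>"
  by (auto simp: tree_nbhd_def)

lemma tree_nbhd_mono: "\<gamma> \<in> underS \<omega>\<^sub>1 \<delta> \<Longrightarrow> tree_nbhd l s \<delta> \<subseteq> tree_nbhd l s \<gamma>"
  using underS_trans[OF Well_order_omega1] unfolding tree_nbhd_def by blast

lemma tree_nodes_snd_last:
  assumes "u @ s \<in> tree_nodes l" "u \<noteq> []" shows "snd (last u) \<in> Field \<omega>\<^sub>1"
proof -
  have "last u \<in> Field l \<times> Field \<omega>\<^sub>1"
    using assms last_in_set[OF assms(2)] by (auto simp: tree_nodes_def)
  then show ?thesis by auto
qed

lemma openin_tree_topology:
  "openin (tree_topology l) U \<longleftrightarrow> U \<subseteq> tree_nodes l \<and> (\<forall>s\<in>U. \<exists>\<gamma>\<in>Field \<omega>\<^sub>1. tree_nbhd l s \<gamma> \<subseteq> U)"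
proof -
  let ?P = "\<lambda>U. U \<subseteq> tree_nodes l \<and> (\<forall>s\<in>U. \<exists>\<gamma>\<in>Field \<omega>\<^sub>1. tree_nbhd l s \<gamma> \<subseteq> U)"
  have "istopology ?P"
    unfolding istopology_def
  proof (intro conjI allI impI)
    fix U V assume U: "?P U" and V: "?P V"
    show "U \<inter> V \<subseteq> tree_nodes l" using U by auto
    show "\<forall>s\<in>U \<inter> V. \<exists>\<gamma>\<in>Field \<omega>\<^sub>1. tree_nbhd l s \<gamma> \<subseteq> U \<inter> V"
    proof
      fix s assume s: "s \<in> U \<inter> V"
      obtain \<gamma> where \<gamma>: "\<gamma> \<in> Field \<omega>\<^sub>1" "tree_nbhd l s \<gamma> \<subseteq> U" using U s by auto
      obtain \<delta> where \<delta>: "\<delta> \<in> Field \<omega>\<^sub>1" "tree_nbhd l s \<delta> \<subseteq> V" using V s by auto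
      obtain \<epsilon> where \<epsilon>: "\<epsilon> \<in> Field \<omega>\<^sub>1" "{\<gamma>, \<delta>} \<subseteq> underS \<omega>\<^sub>1 \<epsilon>"
        using countable_bounded_omega1[of "{\<gamma>, \<delta>}"] \<gamma>(1) \<delta>(1) by auto
      then show "\<exists>\<gamma>\<in>Field \<omega>\<^sub>1. tree_nbhd l s \<gamma> \<subseteq> U \<inter> V"
        using tree_nbhd_mono[of \<gamma> \<epsilon> l s] tree_nbhd_mono[of \<delta> \<epsilon> l s] \<gamma>(2) \<delta>(2)
        by (intro bexI[of _ \<epsilon>]) auto
    qed
  next
    fix \<K> assume K: "\<forall>K\<in>\<K>. ?P K"
    show "\<Union>\<K> \<subseteq> tree_nodes l" using K by auto
    show "\<forall>s\<in>\<Union>\<K>. \<exists>\<gamma>\<in>Field \<omega>\<^sub>1. tree_nbhd l s \<gamma> \<subseteq> \<Union>\<K>"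
    proof
      fix s assume "s \<in> \<Union>\<K>"
      then obtain K' where K': "K' \<in> \<K>" "s \<in> K'" by auto
      then obtain \<gamma> where "\<gamma> \<in> Field \<omega>\<^sub>1" "tree_nbhd l s \<gamma> \<subseteq> K'" using K by blast
      with K'(1) show "\<exists>\<gamma>\<in>Field \<omega>\<^sub>1. tree_nbhd l s \<gamma> \<subseteq> \<Union>\<K>" by (intro bexI[of _ \<gamma>]) auto
    qed
  qed
  then show ?thesis unfolding tree_topology_def by (simp add: topology_inverse')
qed

lemma exists_Field_omega1: "\<exists>\<gamma>. \<gamma> \<in> Field \<omega>\<^sub>1"
  using infinite_Field_omega1 by (metis finite.emptyI ex_in_conv)

lemma topspace_tree_topology: "topspace (tree_topology l) = tree_nodes l"
proof
  show "topspace (tree_topology l) \<subseteq> tree_nodes l"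
    using openin_topspace[of "tree_topology l"] unfolding openin_tree_topology by blast
  have "openin (tree_topology l) (tree_nodes l)"
    unfolding openin_tree_topology using exists_Field_omega1 by (auto simp: tree_nbhd_def)
  then show "tree_nodes l \<subseteq> topspace (tree_topology l)" by (rule openin_subset)
qed

lemma openin_tree_nbhd:
  assumes "\<gamma> \<in> Field \<omega>\<^sub>1" shows "openin (tree_topology l) (tree_nbhd l s \<gamma>)"
  unfolding openin_tree_topology
proof (intro conjI ballI)
  show "tree_nbhd l s \<gamma> \<subseteq> tree_nodes l" by (auto simp: tree_nbhd_def)
  fix t assume "t \<in> tree_nbhd l s \<gamma>"
  then obtain u where u: "t = u @ s" "u \<noteq> [] \<Longrightarrow> \<gamma> \<in> underS \<omega>\<^sub>1 (snd (last u))"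
    by (auto simp: tree_nbhd_def)
  have "w \<in> tree_nbhd l s \<gamma>" if w: "w \<in> tree_nbhd l t \<gamma>" for w
  proof -
    obtain v where v: "w = v @ t" "v \<noteq> [] \<Longrightarrow> \<gamma> \<in> underS \<omega>\<^sub>1 (snd (last v))" "w \<in> tree_nodes l"
      using w by (auto simp: tree_nbhd_def)
    have "v @ u \<noteq> [] \<Longrightarrow> \<gamma> \<in> underS \<omega>\<^sub>1 (snd (last (v @ u)))" using u(2) v(2) by (cases "u = []") auto
    then show ?thesis unfolding tree_nbhd_def using v(1,3) u(1) by (auto intro!: exI[of _ "v @ u"])
  qed
  then show "\<exists>\<delta>\<in>Field \<omega>\<^sub>1. tree_nbhd l t \<delta> \<subseteq> tree_nbhd l s \<gamma>" using assms by auto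
qed

text \<open>
  The only obstruction is that \<open>s\<close> extends \<open>t\<close>; then the child of \<open>t\<close> on the way to \<open>s\<close> is excluded by
  taking its own second component as \<open>\<delta>\<close>.
\<close>

lemma tree_nbhd_disjoint:
  assumes s: "s \<in> tree_nodes l" and t: "t \<in> tree_nodes l" "t \<notin> tree_nbhd l s \<gamma>"
  shows "\<exists>\<delta>\<in>Field \<omega>\<^sub>1. tree_nbhd l t \<delta> \<inter> tree_nbhd l s \<gamma> = {}"
proof -
  have *: "\<exists>u'. s = u' @ t \<and> u' \<noteq> [] \<and> snd (last u') = snd (last v)"
    if w: "w = u @ s" "u \<noteq> [] \<Longrightarrow> \<gamma> \<in> underS \<omega>\<^sub>1 (snd (last u))" "w = v @ t" for w u v
  proof -
    have "u @ s = v @ t" using w by simp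
    then consider u' where "u = v @ u'" "u' @ s = t" | u' where "u @ u' = v" "s = u' @ t"
      unfolding append_eq_append_conv2 by blast
    then show ?thesis
    proof cases
      case 1
      have "u' \<noteq> [] \<longrightarrow> \<gamma> \<in> underS \<omega>\<^sub>1 (snd (last u'))" using w(2) 1(1) by auto
      then have "t \<in> tree_nbhd l s \<gamma>" using t(1) 1(2) by (auto simp: tree_nbhd_def)
      with t(2) show ?thesis by simp
    next
      case 2
      have "u' \<noteq> []"
      proof
        assume "u' = []"
        then have "t = s" using 2 by simp
        with t(2) tree_nbhd_self[OF s] show False by simp
      qed
      then show ?thesis using 2 by (intro exI[of _ u']) auto
    qed
  qed
  show ?thesis
  proof (cases "\<exists>u'. s = u' @ t \<and> u' \<noteq> []")
    case True
    then obtain u' where u': "s = u' @ t" "u' \<noteq> []" by blast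
    have "tree_nbhd l t (snd (last u')) \<inter> tree_nbhd l s \<gamma> = {}"
    proof (rule ccontr)
      assume "\<not> ?thesis"
      then obtain w u v where w: "w = u @ s" "u \<noteq> [] \<Longrightarrow> \<gamma> \<in> underS \<omega>\<^sub>1 (snd (last u))" "w = v @ t"
        "v \<noteq> [] \<Longrightarrow> snd (last u') \<in> underS \<omega>\<^sub>1 (snd (last v))" by (auto simp: tree_nbhd_def)
      obtain u'' where "s = u'' @ t" "snd (last u'') = snd (last v)" using *[OF w(1-3)] by blast
      then have "u'' = u'" using u'(1) by simp
      moreover have "v \<noteq> []" using w(1,3) u' by auto
      ultimately show False using w(4) \<open>snd (last u'') = snd (last v)\<close> underS_irrefl by metis
    qed
    moreover have "snd (last u') \<in> Field \<omega>\<^sub>1"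
      using tree_nodes_snd_last[of u' t l] s u' by simp
    ultimately show ?thesis by blast
  next
    case False
    have "tree_nbhd l t \<delta> \<inter> tree_nbhd l s \<gamma> = {}" for \<delta>
    proof (rule ccontr)
      assume "\<not> ?thesis"
      then obtain w u v where w: "w = u @ s" "u \<noteq> [] \<Longrightarrow> \<gamma> \<in> underS \<omega>\<^sub>1 (snd (last u))" "w = v @ t"
        by (auto simp: tree_nbhd_def)
      show False using *[OF w] False by blast
    qed
    then show ?thesis using exists_Field_omega1 by blast
  qed
qed

lemma closedin_tree_nbhd:
  assumes "s \<in> tree_nodes l" shows "closedin (tree_topology l) (tree_nbhd l s \<gamma>)"
  unfolding closedin_def topspace_tree_topology
proof
  show "tree_nbhd l s \<gamma> \<subseteq> tree_nodes l" by (auto simp: tree_nbhd_def)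
  show "openin (tree_topology l) (tree_nodes l - tree_nbhd l s \<gamma>)"
    unfolding openin_tree_topology
  proof (intro conjI ballI)
    fix t assume "t \<in> tree_nodes l - tree_nbhd l s \<gamma>"
    then obtain \<delta> where "\<delta> \<in> Field \<omega>\<^sub>1" "tree_nbhd l t \<delta> \<inter> tree_nbhd l s \<gamma> = {}"
      using tree_nbhd_disjoint[OF assms, of t \<gamma>] by blast
    then show "\<exists>\<delta>\<in>Field \<omega>\<^sub>1. tree_nbhd l t \<delta> \<subseteq> tree_nodes l - tree_nbhd l s \<gamma>"
      by (intro bexI[of _ \<delta>]) (auto simp: tree_nbhd_def)
  qed auto
qed

text \<open>
  There are \<open>\<omega>\<^sub>1\<close> sequences of each finite length.
\<close>

lemma tree_nodes_card: 
  assumes "countable (Field l)" shows "|tree_nodes l| \<le>o \<omega>\<^sub>1"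
proof -
  let ?A = "Field l \<times> Field \<omega>\<^sub>1"
  define L where "L n = {s. set s \<subseteq> ?A \<and> length s = n}" for n
  have nat: "natLeq \<le>o \<omega>\<^sub>1" by (rule ordLess_imp_ordLeq[OF cardSuc_greater[OF natLeq_Card_order]])
  have "|Field l| \<le>o \<omega>\<^sub>1"
    using assms nat unfolding countable_iff_ordLeq_natLeq by (rule ordLeq_transitive)
  moreover have "|Field \<omega>\<^sub>1| \<le>o \<omega>\<^sub>1" using Field_omega1_ordIso by (rule ordIso_imp_ordLeq)
  ultimately have A: "|?A| \<le>o \<omega>\<^sub>1"
    by (rule card_of_Times_ordLeq_infinite_Field[OF infinite_Field_omega1 _ _ Card_order_omega1])
  have L: "|L n| \<le>o \<omega>\<^sub>1" for n
  proof (induction n)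
    case 0
    have "L 0 \<subseteq> {[]}" by (auto simp: L_def)
    then have "countable (L 0)" by (rule countable_subset) simp
    then show ?case using nat unfolding countable_iff_ordLeq_natLeq by (rule ordLeq_transitive)
  next
    case (Suc n)
    have "L (Suc n) \<subseteq> (\<lambda>(a, s). a # s) ` (?A \<times> L n)"
    proof
      fix s assume "s \<in> L (Suc n)"
      then obtain a s' where "s = a # s'" "a \<in> ?A" "s' \<in> L n" by (cases s) (auto simp: L_def)
      then show "s \<in> (\<lambda>(a, s). a # s) ` (?A \<times> L n)" by force
    qed
    then have "|L (Suc n)| \<le>o |(\<lambda>(a, s). a # s) ` (?A \<times> L n)|" by (rule card_of_mono1)
    also have "|(\<lambda>(a, s). a # s) ` (?A \<times> L n)| \<le>o |?A \<times> L n|" by (rule card_of_image)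
    also have "|?A \<times> L n| \<le>o \<omega>\<^sub>1"
      by (rule card_of_Times_ordLeq_infinite_Field[OF infinite_Field_omega1 A Suc Card_order_omega1])
    finally show ?case .
  qed
  have "|\<Union>n\<in>UNIV. L n| \<le>o |Field \<omega>\<^sub>1|"
  proof (rule card_of_UNION_ordLeq_infinite[OF infinite_Field_omega1])
    have "|UNIV :: nat set| \<le>o natLeq" using countable_iff_ordLeq_natLeq[of "UNIV :: nat set"] by simp
    then have "|UNIV :: nat set| \<le>o \<omega>\<^sub>1" using nat by (rule ordLeq_transitive)
    then show "|UNIV :: nat set| \<le>o |Field \<omega>\<^sub>1|" by (simp add: ordLeq_omega1_iff)
    show "\<forall>n\<in>UNIV. |L n| \<le>o |Field \<omega>\<^sub>1|" using L by (simp add: ordLeq_omega1_iff)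
  qed
  moreover have "|tree_nodes l| \<le>o |\<Union>n\<in>UNIV. L n|"
    by (rule card_of_mono1) (auto simp: tree_nodes_def L_def)
  ultimately show ?thesis unfolding ordLeq_omega1_iff by (rule ordLeq_transitive[rotated])
qed

lemma tree_extension_head:
  assumes "u @ s \<in> tree_nodes l" "u \<noteq> []" "s \<noteq> []"
  shows "fst (hd (u @ s)) \<in> underS l (fst (hd s))"
  using assms by (cases u; cases s) (auto simp: tree_nodes_def)

text \<open>
  Take a node whose first component is least; all proper extensions have smaller ones.
\<close>

lemma tree_maximal_node:
  assumes wo: "Well_order l" and S: "S \<subseteq> tree_nodes l" "S \<noteq> {}"
  shows "\<exists>s\<in>S. \<forall>\<gamma>. tree_nbhd l s \<gamma> \<inter> S = {s}"
proof -
  have self: "s \<in> tree_nbhd l s \<gamma> \<inter> S" if "s \<in> S" for s \<gamma> using tree_nbhd_self S(1) that by auto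
  show ?thesis
  proof (cases "S \<subseteq> {[]}")
    case True
    then have "tree_nbhd l [] \<gamma> \<inter> S = {[]}" for \<gamma> using S(2) self[of "[]" \<gamma>] by auto
    with True S(2) show ?thesis by auto
  next
    case False
    define H where "H = (\<lambda>s. fst (hd s)) ` (S - {[]})"
    have head: "fst (hd s) \<in> Field l" if "s \<in> S - {[]}" for s
      using that S(1) by (cases s) (auto simp: tree_nodes_def)
    then have "H \<subseteq> Field l" by (auto simp: H_def)
    moreover have "H \<noteq> {}" using False S(2) by (auto simp: H_def)
    ultimately obtain a where a: "a \<in> H" "\<And>b. b \<in> H \<Longrightarrow> b \<notin> underS l a"
      using Well_order_least[OF wo] by metis
    then obtain s where s: "s \<in> S" "s \<noteq> []" "a = fst (hd s)" by (auto simp: H_def)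
    have "t = s" if t: "t \<in> tree_nbhd l s \<gamma> \<inter> S" for t \<gamma>
    proof (rule ccontr)
      assume "t \<noteq> s"
      obtain u where u: "t = u @ s" "t \<in> tree_nodes l" using t by (auto simp: tree_nbhd_def)
      then have "fst (hd t) \<in> underS l a"
        using tree_extension_head[of u s l] \<open>t \<noteq> s\<close> s(2,3) by auto
      moreover have "fst (hd t) \<in> H" using t u s(2) by (auto simp: H_def)
      ultimately show False using a(2) by simp
    qed
    then have "tree_nbhd l s \<gamma> \<inter> S = {s}" for \<gamma> using self[OF s(1)] by blast
    with s(1) show ?thesis by blast
  qed
qed

lemma small_P_tree_topology:
  assumes wo: "Well_order l" and count: "countable (Field l)"
  shows "small_P (tree_topology l)"
  unfolding small_P_def
proof (intro conjI)
  let ?T = "tree_topology l"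
  have nb: "\<exists>\<gamma>\<in>Field \<omega>\<^sub>1. tree_nbhd l s \<gamma> \<subseteq> U" if "openin ?T U" "s \<in> U" for U s
    using that unfolding openin_tree_topology by blast
  show "regular_space ?T"
    unfolding regular_space_def
  proof (intro allI impI)
    fix C s assume C: "closedin ?T C \<and> s \<in> topspace ?T - C"
    then have s: "s \<in> tree_nodes l" by (simp add: topspace_tree_topology)
    have "openin ?T (topspace ?T - C)" using C by (simp add: closedin_def)
    then obtain \<gamma> where \<gamma>: "\<gamma> \<in> Field \<omega>\<^sub>1" "tree_nbhd l s \<gamma> \<subseteq> topspace ?T - C" using nb C by meson
    have "openin ?T (topspace ?T - tree_nbhd l s \<gamma>)"
      using closedin_tree_nbhd[OF s] by (simp add: closedin_def)
    moreover have "C \<subseteq> topspace ?T - tree_nbhd l s \<gamma>" using C \<gamma>(2) closedin_subset[of ?T C] by auto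
    ultimately show "\<exists>U V. openin ?T U \<and> openin ?T V \<and> s \<in> U \<and> C \<subseteq> V \<and> disjnt U V"
      using openin_tree_nbhd[OF \<gamma>(1), of l s] tree_nbhd_self[OF s, of \<gamma>]
      by (intro exI[of _ "tree_nbhd l s \<gamma>"] exI[of _ "topspace ?T - tree_nbhd l s \<gamma>"])
         (auto simp: disjnt_def)
  qed
  show "t1_space ?T"
    unfolding t1_space_def topspace_tree_topology
  proof (intro ballI impI)
    fix s t assume s: "s \<in> tree_nodes l" and t: "t \<in> tree_nodes l" and ne: "s \<noteq> t"
    show "\<exists>U. openin ?T U \<and> s \<in> U \<and> t \<notin> U"
    proof (cases "\<exists>u. t = u @ s")
      case True
      then obtain u where u: "t = u @ s" by blast
      then have "u \<noteq> []" using ne by auto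
      have \<gamma>: "snd (last u) \<in> Field \<omega>\<^sub>1" using tree_nodes_snd_last[of u s l] t u \<open>u \<noteq> []\<close> by simp
      have "t \<notin> tree_nbhd l s (snd (last u))"
        using u \<open>u \<noteq> []\<close> underS_irrefl[of "snd (last u)" \<omega>\<^sub>1] by (auto simp: tree_nbhd_def)
      then show ?thesis using openin_tree_nbhd[OF \<gamma>, of l s] tree_nbhd_self[OF s] by blast
    next
      case False
      obtain \<gamma> where \<gamma>: "\<gamma> \<in> Field \<omega>\<^sub>1" using exists_Field_omega1 by blast
      have "t \<notin> tree_nbhd l s \<gamma>" using False by (auto simp: tree_nbhd_def)
      then show ?thesis using openin_tree_nbhd[OF \<gamma>, of l s] tree_nbhd_self[OF s] by blast
    qed
  qed
  show "scattered_space ?T"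
    unfolding scattered_space_iff topspace_tree_topology
  proof (intro allI impI)
    fix S assume S: "S \<subseteq> tree_nodes l" "S \<noteq> {}"
    obtain s where s: "s \<in> S" "\<And>\<gamma>. tree_nbhd l s \<gamma> \<inter> S = {s}"
      using tree_maximal_node[OF wo S] by blast
    obtain \<gamma> where \<gamma>: "\<gamma> \<in> Field \<omega>\<^sub>1" using exists_Field_omega1 by blast
    show "\<exists>x\<in>S. \<exists>N. openin ?T N \<and> N \<inter> S = {x}"
      using s openin_tree_nbhd[OF \<gamma>] by blast
  qed
  show "P_space ?T"
  proof (rule P_spaceI)
    fix \<C> assume C: "countable \<C>" "\<C> \<noteq> {}" "\<And>U. U \<in> \<C> \<Longrightarrow> openin ?T U"
    show "openin ?T (\<Inter>\<C>)"
      unfolding openin_tree_topology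
    proof (intro conjI ballI)
      obtain U0 where U0: "U0 \<in> \<C>" using C(2) by auto
      have "U0 \<subseteq> tree_nodes l" using C(3)[OF U0] unfolding openin_tree_topology by simp
      then show "\<Inter>\<C> \<subseteq> tree_nodes l" using U0 by auto
      fix s assume s: "s \<in> \<Inter>\<C>"
      have "\<exists>\<gamma>\<in>Field \<omega>\<^sub>1. tree_nbhd l s \<gamma> \<subseteq> U" if "U \<in> \<C>" for U
        using nb[OF C(3)[OF that]] s that by auto
      then obtain g where g: "\<And>U. U \<in> \<C> \<Longrightarrow> g U \<in> Field \<omega>\<^sub>1" "\<And>U. U \<in> \<C> \<Longrightarrow> tree_nbhd l s (g U) \<subseteq> U"
        by metis
      have "g ` \<C> \<subseteq> Field \<omega>\<^sub>1" "countable (g ` \<C>)" using g(1) C(1) by auto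
      then obtain \<delta> where \<delta>: "\<delta> \<in> Field \<omega>\<^sub>1" "g ` \<C> \<subseteq> underS \<omega>\<^sub>1 \<delta>"
        using countable_bounded_omega1[of "g ` \<C>"] by metis
      have "tree_nbhd l s \<delta> \<subseteq> U" if "U \<in> \<C>" for U
      proof -
        have "g U \<in> underS \<omega>\<^sub>1 \<delta>" using \<delta>(2) that by auto
        from tree_nbhd_mono[OF this, of l s] g(2)[OF that] show ?thesis by auto
      qed
      then show "\<exists>\<gamma>\<in>Field \<omega>\<^sub>1. tree_nbhd l s \<gamma> \<subseteq> \<Inter>\<C>" using \<delta>(1) by (intro bexI[of _ \<delta>]) auto
    qed
  qed
  show "weight_le ?T \<omega>\<^sub>1"
    unfolding weight_le_def
  proof (intro exI[of _ "(\<lambda>(s, \<gamma>). tree_nbhd l s \<gamma>) ` (tree_nodes l \<times> Field \<omega>\<^sub>1)"] conjI ballI allI impI)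
    have "|tree_nodes l \<times> Field \<omega>\<^sub>1| \<le>o \<omega>\<^sub>1"
      by (rule card_of_Times_ordLeq_infinite_Field[OF infinite_Field_omega1 tree_nodes_card[OF count]
            ordIso_imp_ordLeq[OF Field_omega1_ordIso] Card_order_omega1])
    with card_of_image show "|(\<lambda>(s, \<gamma>). tree_nbhd l s \<gamma>) ` (tree_nodes l \<times> Field \<omega>\<^sub>1)| \<le>o \<omega>\<^sub>1"
      by (rule ordLeq_transitive)
    show "openin ?T V" if "V \<in> (\<lambda>(s, \<gamma>). tree_nbhd l s \<gamma>) ` (tree_nodes l \<times> Field \<omega>\<^sub>1)" for V
      using that openin_tree_nbhd by auto
    fix U s assume U: "openin ?T U \<and> s \<in> U"
    then have s: "s \<in> tree_nodes l" unfolding openin_tree_topology by auto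
    obtain \<gamma> where \<gamma>: "\<gamma> \<in> Field \<omega>\<^sub>1" "tree_nbhd l s \<gamma> \<subseteq> U" using nb U by meson
    show "\<exists>V\<in>(\<lambda>(s, \<gamma>). tree_nbhd l s \<gamma>) ` (tree_nodes l \<times> Field \<omega>\<^sub>1). s \<in> V \<and> V \<subseteq> U"
      by (rule bexI[of _ "tree_nbhd l s \<gamma>"]) (use \<gamma> s tree_nbhd_self[OF s, of \<gamma>] in auto)
  qed
qed

lemma small_P_prod_topology:
  assumes X: "small_P X" and Y: "small_P Y" shows "small_P (prod_topology X Y)"
  unfolding small_P_def
proof (intro conjI)
  note Xs = small_PD[OF X] and Ys = small_PD[OF Y]
  show "regular_space (prod_topology X Y)" using Xs(1) Ys(1) by (simp add: regular_space_prod_topology)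
  show "t1_space (prod_topology X Y)" using Xs(2) Ys(2) by (simp add: t1_space_prod_topology)
  show "scattered_space (prod_topology X Y)"
    unfolding scattered_space_iff
  proof (intro allI impI)
    fix S assume S: "S \<subseteq> topspace (prod_topology X Y)" "S \<noteq> {}"
    have "fst ` S \<subseteq> topspace X" "fst ` S \<noteq> {}" using S by auto
    then obtain x M where M: "x \<in> fst ` S" "openin X M" "M \<inter> fst ` S = {x}"
      using Xs(3) unfolding scattered_space_iff by meson
    define F where "F = {y. (x, y) \<in> S}"
    have "F \<subseteq> topspace Y" "F \<noteq> {}" using S M(1) by (auto simp: F_def)
    then obtain y N where N: "y \<in> F" "openin Y N" "N \<inter> F = {y}"
      using Ys(3) unfolding scattered_space_iff by meson
    have "p = (x, y)" if p: "p \<in> (M \<times> N) \<inter> S" for p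
    proof -
      have "fst p \<in> M \<inter> fst ` S" using p by auto
      then have 1: "fst p = x" unfolding M(3) by simp
      then have "snd p \<in> N \<inter> F" using p by (auto simp: F_def)
      then have "snd p = y" unfolding N(3) by simp
      with 1 show ?thesis by (simp add: prod_eq_iff)
    qed
    moreover have "(x, y) \<in> (M \<times> N) \<inter> S" using M(3) N(1,3) by (auto simp: F_def)
    ultimately have "(M \<times> N) \<inter> S = {(x, y)}" by blast
    moreover have "openin (prod_topology X Y) (M \<times> N)" using M(2) N(2) by (simp add: openin_prod_Times_iff)
    moreover have "(x, y) \<in> S" using N(1) by (simp add: F_def)
    ultimately show "\<exists>p\<in>S. \<exists>N. openin (prod_topology X Y) N \<and> N \<inter> S = {p}" by blast
  qed
  show "P_space (prod_topology X Y)"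
  proof (rule P_spaceI)
    fix \<C> assume C: "countable \<C>" "\<C> \<noteq> {}" "\<And>U. U \<in> \<C> \<Longrightarrow> openin (prod_topology X Y) U"
    show "openin (prod_topology X Y) (\<Inter>\<C>)"
      unfolding openin_prod_topology_alt
    proof (intro allI impI)
      fix x y assume xy: "(x, y) \<in> \<Inter>\<C>"
      have "\<exists>U V. openin X U \<and> openin Y V \<and> x \<in> U \<and> y \<in> V \<and> U \<times> V \<subseteq> C" if "C \<in> \<C>" for C
        using C(3)[OF that] xy that unfolding openin_prod_topology_alt by blast
      then obtain U V where UV: "\<And>C. C \<in> \<C> \<Longrightarrow> openin X (U C)" "\<And>C. C \<in> \<C> \<Longrightarrow> openin Y (V C)"
        "\<And>C. C \<in> \<C> \<Longrightarrow> x \<in> U C" "\<And>C. C \<in> \<C> \<Longrightarrow> y \<in> V C" "\<And>C. C \<in> \<C> \<Longrightarrow> U C \<times> V C \<subseteq> C" by metis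
      obtain C0 where C0: "C0 \<in> \<C>" using C(2) by auto
      have "x \<in> topspace X" "y \<in> topspace Y"
        using UV(3)[OF C0] openin_subset[OF UV(1)[OF C0]] UV(4)[OF C0] openin_subset[OF UV(2)[OF C0]] by auto
      moreover have "openin X (topspace X \<inter> (\<Inter>C\<in>\<C>. U C))" "openin Y (topspace Y \<inter> (\<Inter>C\<in>\<C>. V C))"
        using UV(1,2) C(1) by (intro P_space_openin_INT[OF Xs(4)] P_space_openin_INT[OF Ys(4)]; simp)+
      moreover have "(topspace X \<inter> (\<Inter>C\<in>\<C>. U C)) \<times> (topspace Y \<inter> (\<Inter>C\<in>\<C>. V C)) \<subseteq> \<Inter>\<C>"
        using UV(5) by blast
      ultimately show "\<exists>U V. openin X U \<and> openin Y V \<and> x \<in> U \<and> y \<in> V \<and> U \<times> V \<subseteq> \<Inter>\<C>"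
        using UV(3,4) by (intro exI[of _ "topspace X \<inter> (\<Inter>C\<in>\<C>. U C)"]
          exI[of _ "topspace Y \<inter> (\<Inter>C\<in>\<C>. V C)"]) simp
    qed
  qed
  show "weight_le (prod_topology X Y) \<omega>\<^sub>1"
  proof -
    obtain \<B> where B: "|\<B>| \<le>o \<omega>\<^sub>1" "\<forall>V\<in>\<B>. openin X V"
      "\<And>U x. openin X U \<Longrightarrow> x \<in> U \<Longrightarrow> \<exists>V\<in>\<B>. x \<in> V \<and> V \<subseteq> U"
      using Xs(5) unfolding weight_le_def by meson
    obtain \<D> where D: "|\<D>| \<le>o \<omega>\<^sub>1" "\<forall>V\<in>\<D>. openin Y V"
      "\<And>U x. openin Y U \<Longrightarrow> x \<in> U \<Longrightarrow> \<exists>V\<in>\<D>. x \<in> V \<and> V \<subseteq> U"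
      using Ys(5) unfolding weight_le_def by meson
    show ?thesis
      unfolding weight_le_def
    proof (intro exI[of _ "(\<lambda>(B, D). B \<times> D) ` (\<B> \<times> \<D>)"] conjI ballI allI impI)
      have "|\<B> \<times> \<D>| \<le>o \<omega>\<^sub>1"
        by (rule card_of_Times_ordLeq_infinite_Field[OF infinite_Field_omega1 B(1) D(1) Card_order_omega1])
      with card_of_image show "|(\<lambda>(B, D). B \<times> D) ` (\<B> \<times> \<D>)| \<le>o \<omega>\<^sub>1" by (rule ordLeq_transitive)
      show "openin (prod_topology X Y) V" if "V \<in> (\<lambda>(B, D). B \<times> D) ` (\<B> \<times> \<D>)" for V
        using that B(2) D(2) by (auto simp: openin_prod_Times_iff)
      fix U p assume U: "openin (prod_topology X Y) U \<and> p \<in> U"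
      obtain x y where p: "p = (x, y)" by (cases p)
      obtain M N where MN: "openin X M" "openin Y N" "x \<in> M" "y \<in> N" "M \<times> N \<subseteq> U"
        using U unfolding p openin_prod_topology_alt by meson
      obtain B' where B': "B' \<in> \<B>" "x \<in> B'" "B' \<subseteq> M" using B(3)[OF MN(1,3)] by auto
      obtain D' where D': "D' \<in> \<D>" "y \<in> D'" "D' \<subseteq> N" using D(3)[OF MN(2,4)] by auto
      show "\<exists>V\<in>(\<lambda>(B, D). B \<times> D) ` (\<B> \<times> \<D>). p \<in> V \<and> V \<subseteq> U"
        by (rule bexI[of _ "B' \<times> D'"]) (use B' D' MN(5) p in auto)
    qed
  qed
qed


section \<open>Every space is a derivative\<close>

text \<open>
  A copy of the tree is attached by its root to each isolated point of \<open>Z\<close>, and \<open>Z\<close> itself sits at the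
  roots. The subspace topology of the product makes the trees over isolated points \<open>z'\<close> shrink to
  \<open>(z, [])\<close> as \<open>z'\<close> tends to a non-isolated point \<open>z\<close>.
\<close>

definition attach_trees :: "'a topology \<Rightarrow> 'l rel \<Rightarrow> ('a \<times> ('l \<times> nat set) list) topology" where
  "attach_trees Z l = subtopology (prod_topology Z (tree_topology l)) {(z, s). s = [] \<or> openin Z {z}}"

lemma Nil_tree_node: "[] \<in> tree_nodes l"
  by (simp add: tree_nodes_def)

lemma mem_attach_trees:
  "(z, s) \<in> topspace (attach_trees Z l) \<longleftrightarrow> z \<in> topspace Z \<and> s \<in> tree_nodes l \<and> (s = [] \<or> openin Z {z})"
  by (auto simp: attach_trees_def topspace_tree_topology)

lemma small_P_attach_trees:
  assumes "small_P Z" "Well_order l" "countable (Field l)" shows "small_P (attach_trees Z l)"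
  unfolding attach_trees_def
  by (rule small_P_embeds[OF subtopology_embeds small_P_prod_topology[OF assms(1) small_P_tree_topology[OF assms(2,3)]]])

lemma attach_trees_nbhd:
  assumes "openin (attach_trees Z l) T" "(z, s) \<in> T"
  shows "\<exists>U \<gamma>. openin Z U \<and> z \<in> U \<and> \<gamma> \<in> Field \<omega>\<^sub>1 \<and>
    (\<forall>y t. y \<in> U \<longrightarrow> t \<in> tree_nbhd l s \<gamma> \<longrightarrow> t = [] \<or> openin Z {y} \<longrightarrow> (y, t) \<in> T)"
proof -
  obtain T' where T': "openin (prod_topology Z (tree_topology l)) T'" "T = T' \<inter> {(z, s). s = [] \<or> openin Z {z}}"
    using assms(1) unfolding attach_trees_def openin_subtopology by blast
  have "(z, s) \<in> T'" using assms(2) T'(2) by simp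
  then obtain U V where UV: "openin Z U" "openin (tree_topology l) V" "z \<in> U" "s \<in> V" "U \<times> V \<subseteq> T'"
    using T'(1) unfolding openin_prod_topology_alt by meson
  obtain \<gamma> where \<gamma>: "\<gamma> \<in> Field \<omega>\<^sub>1" "tree_nbhd l s \<gamma> \<subseteq> V"
    using UV(2,4) unfolding openin_tree_topology by blast
  have "(y, t) \<in> T" if "y \<in> U" "t \<in> tree_nbhd l s \<gamma>" "t = [] \<or> openin Z {y}" for y t
    unfolding T'(2) using that UV(5) \<gamma>(2) by auto
  then show ?thesis using UV(1,3) \<gamma>(1) by (intro exI[of _ U] exI[of _ \<gamma>]) simp
qed

text \<open>
  A node with first component \<open>b\<close> is isolated among the nodes of rank at least \<open>b\<close>, because its
  proper extensions have smaller rank. A node with larger first component has children with first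
  component \<open>b\<close> arbitrarily near. The roots over non-isolated points of \<open>Z\<close> survive because isolated
  points are dense in a scattered space.
\<close>

lemma cb_step_attach_trees:
  assumes Z: "small_P Z" and wo: "Well_order l" and b: "b \<in> Field l"
  defines "X \<equiv> attach_trees Z l"
  shows "cb_step X {(z, s) \<in> topspace X. s \<noteq> [] \<longrightarrow> fst (hd s) \<notin> underS l b} =
    {(z, s) \<in> topspace X. s \<noteq> [] \<longrightarrow> b \<in> underS l (fst (hd s))}"
    (is "cb_step X ?D = ?E")
proof (rule set_eqI)
  fix p :: "'a \<times> ('b \<times> nat set) list"
  obtain z s where p: "p = (z, s)" by (cases p)
  have mem: "(z, s) \<in> topspace X \<longleftrightarrow> z \<in> topspace Z \<and> s \<in> tree_nodes l \<and> (s = [] \<or> openin Z {z})" for z s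
    unfolding X_def by (rule mem_attach_trees)
  obtain \<gamma>0 where \<gamma>0: "\<gamma>0 \<in> Field \<omega>\<^sub>1" using exists_Field_omega1 by blast
  show "p \<in> cb_step X ?D \<longleftrightarrow> p \<in> ?E"
    unfolding p
  proof
    assume L: "(z, s) \<in> cb_step X ?D"
    then have zs: "(z, s) \<in> ?D" "(z, s) \<in> topspace X" by (simp_all add: mem_cb_step_iff)
    show "(z, s) \<in> ?E"
    proof (cases "s = []")
      case True
      then show ?thesis using zs(2) by simp
    next
      case False
      have z: "openin Z {z}" and s: "s \<in> tree_nodes l" using zs(2) False by (simp_all add: mem)
      have a: "fst (hd s) \<notin> underS l b" using zs(1) False by simp
      have aF: "fst (hd s) \<in> Field l" using s False by (cases s) (auto simp: tree_nodes_def)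
      have "fst (hd s) \<noteq> b"
      proof
        assume ab: "fst (hd s) = b"
        define T where "T = ({z} \<times> tree_nbhd l s \<gamma>0) \<inter> {(z, s). s = [] \<or> openin Z {z}}"
        have "openin (prod_topology Z (tree_topology l)) ({z} \<times> tree_nbhd l s \<gamma>0)"
          using z openin_tree_nbhd[OF \<gamma>0, of l s] by (simp add: openin_prod_Times_iff)
        then have T: "openin X T" unfolding X_def attach_trees_def T_def openin_subtopology by blast
        have "(z, s) \<in> T" using z tree_nbhd_self[OF s, of \<gamma>0] by (simp add: T_def)
        then obtain q where q: "q \<in> ?D \<inter> T" "q \<noteq> (z, s)" using L T unfolding mem_cb_step_iff by meson
        then obtain t where t: "q = (z, t)" "t \<in> tree_nbhd l s \<gamma>0" "t \<noteq> s" by (auto simp: T_def)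
        then obtain u where u: "t = u @ s" "t \<in> tree_nodes l" by (auto simp: tree_nbhd_def)
        have "fst (hd t) \<in> underS l b"
          using tree_extension_head[of u s l] u t(3) False unfolding ab by auto
        moreover have "t \<noteq> []" using u(1) False by simp
        ultimately show False using q(1) t(1) by simp
      qed
      then have "b \<in> underS l (fst (hd s))" using Well_order_linear[OF wo b aF] a by auto
      then show ?thesis using zs(2) by simp
    qed
  next
    assume R: "(z, s) \<in> ?E"
    then have zs: "(z, s) \<in> topspace X" and head: "s \<noteq> [] \<Longrightarrow> b \<in> underS l (fst (hd s))" by auto
    have z: "z \<in> topspace Z" and s: "s \<in> tree_nodes l" using zs by (simp_all add: mem)
    have "fst (hd s) \<notin> underS l b" if "s \<noteq> []"
      using underS_trans[OF wo head[OF that]] underS_irrefl by metis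
    then have "(z, s) \<in> ?D" using zs by simp
    moreover have "\<exists>q\<in>?D \<inter> T. q \<noteq> (z, s)" if T: "(z, s) \<in> T" "openin X T" for T
    proof -
      obtain U \<gamma> where U: "openin Z U" "z \<in> U" and \<gamma>: "\<gamma> \<in> Field \<omega>\<^sub>1"
        and UT: "\<And>y t. y \<in> U \<Longrightarrow> t \<in> tree_nbhd l s \<gamma> \<Longrightarrow> t = [] \<or> openin Z {y} \<Longrightarrow> (y, t) \<in> T"
        using attach_trees_nbhd[OF T(2)[unfolded X_def] T(1)] by meson
      show ?thesis
      proof (cases "openin Z {z}")
        case True
        obtain \<xi> where \<xi>: "\<xi> \<in> Field \<omega>\<^sub>1" "\<gamma> \<in> underS \<omega>\<^sub>1 \<xi>"
          using countable_bounded_omega1[of "{\<gamma>}"] \<gamma> by auto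
        let ?t = "(b, \<xi>) # s"
        have "b \<in> underS l (fst y)" if "y \<in> set s" for y
        proof -
          have "s \<noteq> []" using that by auto
          then obtain y0 s' where s0: "s = y0 # s'" by (cases s) auto
          then have b0: "b \<in> underS l (fst y0)" using head by simp
          show ?thesis
          proof (cases "y = y0")
            case False
            then have "fst y0 \<in> underS l (fst y)" using that s s0 by (auto simp: tree_nodes_def)
            with b0 show ?thesis by (rule underS_trans[OF wo])
          qed (use b0 in simp)
        qed
        then have t: "?t \<in> tree_nodes l" using s b \<xi>(1) by (auto simp: tree_nodes_def)
        then have "?t \<in> tree_nbhd l s \<gamma>" using \<xi>(2) by (auto simp: tree_nbhd_def)
        then have "(z, ?t) \<in> T" using UT[OF U(2)] True by simp
        moreover have "(z, ?t) \<in> ?D" using t True z by (simp add: mem underS_irrefl)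
        ultimately show ?thesis by (intro bexI[of _ "(z, ?t)"]) auto
      next
        case False
        then have "s = []" using zs by (simp add: mem)
        have "U \<subseteq> topspace Z" "U \<noteq> {}" using openin_subset[OF U(1)] U(2) by auto
        then obtain y N where y: "y \<in> U" "openin Z N" "N \<inter> U = {y}"
          using small_PD(3)[OF Z] unfolding scattered_space_iff by meson
        have yo: "openin Z {y}" unfolding y(3)[symmetric] using y(2) U(1) by (rule openin_Int)
        then have "y \<noteq> z" using False by auto
        have "(y, []) \<in> T"
          using UT[OF y(1), of "[]"] tree_nbhd_self[OF Nil_tree_node[of l], of \<gamma>] \<open>s = []\<close> by simp
        moreover have "(y, []) \<in> ?D"
          using y(1) openin_subset[OF U(1)] Nil_tree_node by (auto simp: mem)
        ultimately show ?thesis using \<open>y \<noteq> z\<close> by (intro bexI[of _ "(y, [])"]) auto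
      qed
    qed
    ultimately show "(z, s) \<in> cb_step X ?D" unfolding mem_cb_step_iff using zs by simp
  qed
qed

lemma cb_derivative_attach_trees:
  assumes Z: "small_P Z" and wo: "Well_order l"
  shows "cb_derivative (attach_trees Z l) l = topspace Z \<times> {[]}"
proof -
  let ?X = "attach_trees Z l"
  have level: "cb_level ?X l b = {(z, s) \<in> topspace ?X. s \<noteq> [] \<longrightarrow> fst (hd s) \<notin> underS l b}"
    if b: "b \<in> Field l" for b
    using wo b
  proof (induction rule: Well_order_induct)
    case (less b)
    have "cb_level ?X l b = topspace ?X \<inter>
        (\<Inter>c\<in>underS l b. {(z, s) \<in> topspace ?X. s \<noteq> [] \<longrightarrow> c \<in> underS l (fst (hd s))})"
    proof (subst cb_level_rec[OF wo], rule arg_cong2[of _ _ _ _ "(\<inter>)"], rule refl, rule INF_cong, rule refl)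
      fix c assume c: "c \<in> underS l b"
      then have cF: "c \<in> Field l" using underS_in_Field by metis
      show "cb_step ?X (cb_level ?X l c) = {(z, s) \<in> topspace ?X. s \<noteq> [] \<longrightarrow> c \<in> underS l (fst (hd s))}"
        unfolding less.IH[OF c] by (rule cb_step_attach_trees[OF Z wo cF])
    qed
    also have "\<dots> = {(z, s) \<in> topspace ?X. s \<noteq> [] \<longrightarrow> fst (hd s) \<notin> underS l b}"
    proof -
      have "(\<forall>c\<in>underS l b. c \<in> underS l (fst (hd s))) \<longleftrightarrow> fst (hd s) \<notin> underS l b"
        if s: "s \<in> tree_nodes l" "s \<noteq> []" for s
      proof
        have aF: "fst (hd s) \<in> Field l" using s by (cases s) (auto simp: tree_nodes_def)
        show "fst (hd s) \<notin> underS l b" if "\<forall>c\<in>underS l b. c \<in> underS l (fst (hd s))"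
          using that underS_irrefl by metis
        assume "fst (hd s) \<notin> underS l b"
        then have "fst (hd s) = b \<or> b \<in> underS l (fst (hd s))"
          using Well_order_linear[OF wo aF less.hyps] by auto
        then show "\<forall>c\<in>underS l b. c \<in> underS l (fst (hd s))" using underS_trans[OF wo] by metis
      qed
      then show ?thesis by (auto simp: mem_attach_trees)
    qed
    finally show ?case .
  qed
  have "cb_derivative ?X l = topspace ?X \<inter>
      (\<Inter>c\<in>Field l. {(z, s) \<in> topspace ?X. s \<noteq> [] \<longrightarrow> c \<in> underS l (fst (hd s))})"
    unfolding cb_derivative_def
    by (rule arg_cong2[of _ _ _ _ "(\<inter>)"], rule refl, rule INF_cong, rule refl)
       (simp only: level cb_step_attach_trees[OF Z wo])
  also have "\<dots> = topspace Z \<times> {[]}"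
  proof -
    have *: "\<not> (\<forall>c\<in>Field l. c \<in> underS l (fst (hd s)))" if "s \<in> tree_nodes l" "s \<noteq> []" for s
    proof
      assume all: "\<forall>c\<in>Field l. c \<in> underS l (fst (hd s))"
      have "fst (hd s) \<in> Field l" using that by (cases s) (auto simp: tree_nodes_def)
      then have "fst (hd s) \<in> underS l (fst (hd s))" using all by blast
      then show False using underS_irrefl by metis
    qed
    have "(z, s) \<in> topspace ?X \<inter>
        (\<Inter>c\<in>Field l. {(z, s) \<in> topspace ?X. s \<noteq> [] \<longrightarrow> c \<in> underS l (fst (hd s))}) \<longleftrightarrow>
      (z, s) \<in> topspace Z \<times> {[]}" for z s
    proof (cases "s = []")
      case True
      then show ?thesis using Nil_tree_node[of l] by (auto simp: mem_attach_trees)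
    next
      case False
      then show ?thesis using *[of s] by (auto simp: mem_attach_trees)
    qed
    then show ?thesis by (intro set_eqI) (simp only: split_paired_all)
  qed
  finally show ?thesis .
qed

lemma derivative_attach_trees_homeomorphic:
  assumes "small_P Z" "Well_order l"
  shows "subtopology (attach_trees Z l) (cb_derivative (attach_trees Z l) l) homeomorphic_space Z"
proof -
  have "{(z, s). s = [] \<or> openin Z {z}} \<inter> (topspace Z \<times> {[] :: ('b \<times> nat set) list}) = topspace Z \<times> {[]}" by auto
  then have "subtopology (attach_trees Z l) (cb_derivative (attach_trees Z l) l) =
      subtopology (prod_topology Z (tree_topology l)) (topspace Z \<times> {[]})"
    unfolding cb_derivative_attach_trees[OF assms] unfolding attach_trees_def subtopology_subtopology by simp
  also have "\<dots> = prod_topology (subtopology Z (topspace Z)) (subtopology (tree_topology l) {[]})"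
    by (rule subtopology_Times)
  also have "\<dots> = prod_topology Z (subtopology (tree_topology l) {[]})" by simp
  also have "\<dots> homeomorphic_space Z"
    by (rule homeomorphic_space_sym[THEN iffD1], rule homeomorphic_space_prod_topology_sing1)
       (simp add: topspace_tree_topology Nil_tree_node)
  finally show ?thesis .
qed

lemma cb_derivative_empty_embeds:
  assumes r: "Well_order r" and X: "t1_space X" and "X \<subset>\<^sub>h Y" "cb_derivative Y r = {}"
  shows "cb_derivative X r = {}"
proof -
  obtain f where f: "emb_on X (topspace X) Y f" using assms(3) embeds_iff_emb_on[OF X] by blast
  from cb_derivative_image[OF r f emb_on_inj[OF X f]] assms(4) show ?thesis by auto
qed

theorem exists_space_with_derivative:
  fixes Z :: "'a topology" and l :: "'l rel"
  assumes U: "uncountable (UNIV :: 'a set)" and Z: "small_P Z" and wo: "Well_order l" and count: "countable (Field l)"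
  shows "\<exists>Y :: 'a topology. small_P Y \<and> subtopology Y (cb_derivative Y l) =\<^sub>h Z"
proof -
  let ?X = "attach_trees Z l"
  have X: "small_P ?X" by (rule small_P_attach_trees[OF Z wo count])
  obtain Y :: "'a topology" where Y: "?X homeomorphic_space Y"
    using scattered_weight_le_representable[OF U small_PD(3,5)[OF X]] by blast
  have YX: "Y \<subset>\<^sub>h ?X" "?X \<subset>\<^sub>h Y"
    by (rule homeomorphic_imp_embeds, rule homeomorphic_space_sym[THEN iffD1, OF Y])
       (rule homeomorphic_imp_embeds[OF Y])
  have sY: "small_P Y" by (rule small_P_embeds[OF YX(1) X])
  have dX: "subtopology ?X (cb_derivative ?X l) \<subset>\<^sub>h Z" "Z \<subset>\<^sub>h subtopology ?X (cb_derivative ?X l)"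
    by (rule homeomorphic_imp_embeds[OF derivative_attach_trees_homeomorphic[OF Z wo]],
        rule homeomorphic_imp_embeds[OF homeomorphic_space_sym[THEN iffD1,
          OF derivative_attach_trees_homeomorphic[OF Z wo]]])
  have "subtopology Y (cb_derivative Y l) \<subset>\<^sub>h Z"
    using derivative_embeds[OF wo small_PD(2)[OF sY] YX(1)] dX(1) by (rule embeds_trans)
  moreover have "Z \<subset>\<^sub>h subtopology Y (cb_derivative Y l)"
    using dX(2) derivative_embeds[OF wo small_PD(2)[OF X] YX(2)] by (rule embeds_trans)
  ultimately show ?thesis using sY by (intro exI[of _ Y]) (simp add: h_equiv_def)
qed


section \<open>The isomorphism of the posets\<close>

lemma h_class_eq_iff:
  fixes X Y :: "'a topology"
  shows "[X]\<^sub>h = [Y]\<^sub>h \<longleftrightarrow> X =\<^sub>h Y"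
proof
  assume eq: "[X]\<^sub>h = [Y]\<^sub>h"
  have "Y \<in> [Y]\<^sub>h" by (simp add: h_class_def h_equiv_def embeds_refl)
  then show "X =\<^sub>h Y" unfolding eq[symmetric] by (simp add: h_class_def)
next
  assume XY: "X =\<^sub>h Y"
  have "X =\<^sub>h W \<longleftrightarrow> Y =\<^sub>h W" for W :: "'a topology"
    using XY embeds_trans[of X Y W] embeds_trans[of Y X W] embeds_trans[of W X Y] embeds_trans[of W Y X]
    unfolding h_equiv_def by blast
  then show "[X]\<^sub>h = [Y]\<^sub>h" by (simp add: h_class_def)
qed

text \<open>
  The relation on classes does not depend on the chosen representatives.
\<close>

lemma h_less_classes: "[X]\<^sub>h <\<^sub>h [Y]\<^sub>h \<longleftrightarrow> X \<subset>\<^sub>h Y"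
proof
  assume "[X]\<^sub>h <\<^sub>h [Y]\<^sub>h"
  then obtain X' Y' where "[X]\<^sub>h = [X']\<^sub>h" "[Y]\<^sub>h = [Y']\<^sub>h" "X' \<subset>\<^sub>h Y'" unfolding h_less_def by blast
  then have XX: "X \<subset>\<^sub>h X'" "X' \<subset>\<^sub>h Y'" "Y' \<subset>\<^sub>h Y" by (simp_all add: h_class_eq_iff h_equiv_def)
  show "X \<subset>\<^sub>h Y" by (rule embeds_trans[OF embeds_trans[OF XX(1,2)] XX(3)])
next
  assume "X \<subset>\<^sub>h Y"
  then show "[X]\<^sub>h <\<^sub>h [Y]\<^sub>h" unfolding h_less_def by (intro exI[of _ X] exI[of _ Y]) simp
qed

theorem theorem30:
  fixes l :: "'l rel"
  assumes "uncountable (UNIV :: 'a set)"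
    and "limit_ordinal l" and "countable (Field l)"
  shows "\<exists>\<psi> :: 'a topology set \<Rightarrow> 'a topology set.
    bij_betw \<psi> (\<P> l) (\<P> ({} :: nat rel)) \<and>
    (\<forall>a\<in>\<P> l. \<forall>b\<in>\<P> l. a <\<^sub>h b \<longleftrightarrow> \<psi> a <\<^sub>h \<psi> b)"
proof -
  have wo: "Well_order l" using assms(2) by (simp add: limit_ordinal_def)
  have wo0: "Well_order ({} :: nat rel)" by simp
  define d where "d X = subtopology X (cb_derivative X l)" for X :: "'a topology"
  define K where "K X \<longleftrightarrow> small_P X \<and> cb_derivative X l \<noteq> {} \<and> cb_derivative (d X) natLeq = {}" for X
  define K0 where "K0 Z \<longleftrightarrow> small_P Z \<and> topspace Z \<noteq> {} \<and> cb_derivative Z natLeq = {}" for Z :: "'a topology"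
  have P: "\<P> l = {[X]\<^sub>h | X. K X}" unfolding h_poset_eq[OF wo] K_def d_def ..
  have P0: "\<P> ({} :: nat rel) = {[X]\<^sub>h | X. K0 X}"
    unfolding h_poset_eq[OF wo0] K0_def cb_derivative_zero subtopology_topspace ..
  have small: "small_P (d X)" if "small_P X" for X
    unfolding d_def by (rule small_P_embeds[OF subtopology_embeds that])
  have top: "topspace (d X) = cb_derivative X l" for X
    unfolding d_def by (auto simp: cb_derivative_def)
  have KK0: "K0 (d X)" if "K X" for X using that small top unfolding K_def K0_def by simp
  have iff: "X \<subset>\<^sub>h Y \<longleftrightarrow> d X \<subset>\<^sub>h d Y" if "K X" "K Y" for X Y
  proof
    have X: "small_P X" "cb_derivative X l \<noteq> {}" and Y: "small_P Y" using that by (simp_all add: K_def)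
    show "d X \<subset>\<^sub>h d Y" if "X \<subset>\<^sub>h Y" unfolding d_def by (rule derivative_embeds[OF wo small_PD(2)[OF X(1)] that])
    show "X \<subset>\<^sub>h Y" if "d X \<subset>\<^sub>h d Y"
      by (rule embeds_of_derivative_embeds[OF X(1) Y assms(2,3) X(2) that[unfolded d_def]])
  qed
  define rep where "rep a = (SOME X. K X \<and> a = [X]\<^sub>h)" for a
  define \<psi> where "\<psi> a = [d (rep a)]\<^sub>h" for a
  have rep: "K (rep a) \<and> a = [rep a]\<^sub>h" if "a \<in> \<P> l" for a
  proof -
    have "\<exists>X. K X \<and> a = [X]\<^sub>h" using that unfolding P by blast
    then show ?thesis unfolding rep_def by (rule someI_ex)
  qed
  have \<psi>: "\<psi> [X]\<^sub>h = [d X]\<^sub>h" if X: "K X" for X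
  proof -
    have "[X]\<^sub>h \<in> \<P> l" using X unfolding P by blast
    from rep[OF this] have R: "K (rep [X]\<^sub>h)" "X =\<^sub>h rep [X]\<^sub>h" by (simp_all add: h_class_eq_iff)
    have "rep [X]\<^sub>h =\<^sub>h X" using R(2) by (simp add: h_equiv_def)
    then have "d (rep [X]\<^sub>h) =\<^sub>h d X" unfolding h_equiv_def using iff[OF R(1) X] iff[OF X R(1)] by simp
    then show ?thesis unfolding \<psi>_def h_class_eq_iff .
  qed
  have order: "a <\<^sub>h b \<longleftrightarrow> \<psi> a <\<^sub>h \<psi> b" if ab: "a \<in> \<P> l" "b \<in> \<P> l" for a b
  proof -
    obtain X Y where "K X" "a = [X]\<^sub>h" "K Y" "b = [Y]\<^sub>h" using ab unfolding P by blast
    then show ?thesis using iff[of X Y] by (simp add: \<psi> h_less_classes)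
  qed
  have "bij_betw \<psi> (\<P> l) (\<P> ({} :: nat rel))"
    unfolding bij_betw_def
  proof
    show "inj_on \<psi> (\<P> l)"
    proof (rule inj_onI)
      fix a b assume ab: "a \<in> \<P> l" "b \<in> \<P> l" "\<psi> a = \<psi> b"
      obtain X Y where XY: "K X" "a = [X]\<^sub>h" "K Y" "b = [Y]\<^sub>h" using ab(1,2) unfolding P by blast
      then have "d X =\<^sub>h d Y" using ab(3) by (simp add: \<psi> h_class_eq_iff)
      then have "X =\<^sub>h Y" using iff[OF XY(1,3)] iff[OF XY(3,1)] by (simp add: h_equiv_def)
      then show "a = b" using XY by (simp add: h_class_eq_iff)
    qed
    show "\<psi> ` \<P> l = \<P> ({} :: nat rel)"
    proof
      show "\<psi> ` \<P> l \<subseteq> \<P> ({} :: nat rel)"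
      proof (rule image_subsetI)
        fix a :: "'a topology set" assume "a \<in> \<P> l"
        then obtain X where "K X" "a = [X]\<^sub>h" unfolding P by blast
        then show "\<psi> a \<in> \<P> ({} :: nat rel)" unfolding P0 using \<psi> KK0 by blast
      qed
      show "\<P> ({} :: nat rel) \<subseteq> \<psi> ` \<P> l"
      proof
        fix c :: "'a topology set" assume "c \<in> \<P> ({} :: nat rel)"
        then obtain Z where Z: "K0 Z" "c = [Z]\<^sub>h" unfolding P0 by blast
        then have sZ: "small_P Z" by (simp add: K0_def)
        obtain Y :: "'a topology" where Y: "small_P Y" "d Y =\<^sub>h Z"
          using exists_space_with_derivative[OF assms(1) sZ wo assms(3)] unfolding d_def by blast
        have Ys: "small_P (d Y)" by (rule small[OF Y(1)])
        have "cb_derivative (d Y) natLeq = {}"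
          using Y(2) Z(1) unfolding h_equiv_def K0_def
          by (intro cb_derivative_empty_embeds[OF natLeq_Well_order small_PD(2)[OF Ys], of Z]) simp_all
        moreover have "cb_derivative Y l \<noteq> {}"
        proof
          assume "cb_derivative Y l = {}"
          then have "cb_derivative (d Y) ({} :: nat rel) = {}" by (simp add: cb_derivative_zero top)
          then have "cb_derivative Z ({} :: nat rel) = {}"
            using Y(2) unfolding h_equiv_def
            by (intro cb_derivative_empty_embeds[OF wo0 small_PD(2)[OF sZ], of "d Y"]) simp_all
          then show False using Z(1) by (simp add: cb_derivative_zero K0_def)
        qed
        ultimately have "K Y" using Y(1) by (simp add: K_def)
        moreover have "c = \<psi> [Y]\<^sub>h" unfolding \<psi>[OF \<open>K Y\<close>] Z(2) h_class_eq_iff using Y(2) by (simp add: h_equiv_def)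
        ultimately show "c \<in> \<psi> ` \<P> l" unfolding P by blast
      qed
    qed
  qed
  with order show ?thesis by blast
qed

end
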